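(* Let $a,b\in(0,1)$ and $p\in(0,1)$. Let $\{X_n\}$ be the swap-model random walk with parameter $p$ in the Markov environment $\{U_i\}_{i\in\mathbb Z}$ with parameters $a,b$ (see context). Then the drift $V=\lim_{n\to\infty}X_n/n$ exists almost surely and is a deterministic constant, and the following hold. (1a) If either $a>b$ and $p\in\left(\frac12,\frac{1-b}{(1-a)+(1-b)}\right)$, or $a<b$ and $p\in\left(\frac{1-b}{(1-a)+(1-b)},\frac12\right)$, then almost surely $\lim_{n\to\infty}X_n=\infty$ and $$V=(2p-1)\,\frac{(1-b)(1-p)-(1-a)p}{\left(b+\frac{a-b}{a+b}\right)(1-p)+\left(a-\frac{a-b}{a+b}\right)p}>0.$$ (1b) If either $a>b$ and $p\in\left(\frac{1-a}{(1-a)+(1-b)},\frac12\right)$, or $a<b$ and $p\in\left(\frac12,\frac{1-a}{(1-a)+(1-b)}\right)$, then almost surely $\lim_{n\to\infty}X_n=-\infty$ and $$V=-(1-2p)\,\frac{(1-b)p-(1-a)(1-p)}{\left(b+\frac{a-b}{a+b}\right)p+\left(a-\frac{a-b}{a+b}\right)(1-p)}<0.$$ (2a) If either $a>b$ and $p\in\left[\frac{1-b}{(1-a)+(1-b)},1\right)$, or $a<b$ and $p\in\left(0,\frac{1-b}{(1-a)+(1-b)}\right]$, then almost surely $\lim_{n\to\infty}X_n=\infty$, but $V=0$. (2b) If either $a>b$ and $p\in\left(0,\frac{1-a}{(1-a)+(1-b)}\right]$, or $a<b$ and $p\in\left[\frac{1-a}{(1-a)+(1-b)},1\right)$, then almost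 surely $\lim_{n\to\infty}X_n=-\infty$, but $V=0$. (3) Otherwise (when $a=b$ or $p=1/2$ or both), $\{X_n\}$ is recurrent, i.e. almost surely $\liminf_{n\to\infty}X_n=-\infty$ and $\limsup_{n\to\infty}X_n=\infty$, and $V=0$.
   Context: Swap model: let $\mathbf U=\{U_i\}_{i\in\mathbb Z}$ be a stationary ergodic random environment with $U_i\in\{-1,1\}$, and let $p\in(0,1)$. Given $\mathbf U=\mathbf u$, the process $\{X_n,n=0,1,2,\ldots\}$ is a nearest-neighbour Markov chain on $\mathbb Z$ started from a fixed state $X_0=x_0\in\mathbb Z$, with $\mathbb P(X_{n+1}=i+1\mid X_n=i,\mathbf U=\mathbf u)=p$ if $u_i=1$ and $=1-p$ if $u_i=-1$, and $\mathbb P(X_{n+1}=i-1\mid X_n=i,\mathbf U=\mathbf u)=1-p$ if $u_i=1$ and $=p$ if $u_i=-1$. The environment is sampled once and stays fixed over time; $\mathbb P$ (and "almost surely") refers to the joint law of environment and walk. Markov environment with parameters $a,b\in(0,1)$: $\{U_i\}_{i\in\mathbb Z}$ is a stationary Markov chain on $\{-1,1\}$ with transition probabilities $\mathbb P(U_{i+1}=1\mid U_i=-1)=a$, $\mathbb P(U_{i+1}=-1\mid U_i=-1)=1-a$, $\mathbb P(U_{i+1}=-1\mid U_i=1)=b$, $\mathbb P(U_{i+1}=1\mid U_i=1)=1-b$. Drift: $V$ denotes the almost sure limit $\lim_{n\to\infty}X_n/n$. *)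

theory Defs
  imports "HOL-Probability.Probability"
begin

text \<open>A time-homogeneous discrete-time Markov chain with transition matrix \<open>K\<close>, for the index
  types \<open>nat\<close> and \<open>int\<close>. Conditioning is on finite stretches of the past \<open>{r..t}\<close>; for \<open>nat\<close> the
  choice \<open>r = 0\<close> is the whole past. The initial distribution is left open.\<close>

definition is_markov_chain ::
    "'w measure \<Rightarrow> ('t::linordered_semidom \<Rightarrow> 'w \<Rightarrow> 's) \<Rightarrow> ('s \<Rightarrow> 's \<Rightarrow> real) \<Rightarrow> bool" where
  "is_markov_chain M X K \<longleftrightarrow>
     (\<forall>r t s y. r \<le> t \<longrightarrow> \<P>(\<omega> in M. \<forall>j\<in>{r..t}. X j \<omega> = s j) > 0 \<longrightarrow>
        \<P>(\<omega> in M. X (t + 1) \<omega> = y \<bar> \<forall>j\<in>{r..t}. X j \<omega> = s j) = K (s t) y)"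

definition env_space :: "(int \<Rightarrow> int) measure" where
  "env_space = (\<Pi>\<^sub>M i\<in>UNIV. count_space {-1, 1})"

definition path_space :: "(nat \<Rightarrow> int) measure" where
  "path_space = (\<Pi>\<^sub>M n\<in>UNIV. count_space UNIV)"

definition stationary_env :: "'w measure \<Rightarrow> (int \<Rightarrow> 'w \<Rightarrow> int) \<Rightarrow> bool" where
  "stationary_env M U \<longleftrightarrow>
     (\<forall>k. distr M env_space (\<lambda>\<omega> i. U (i + k) \<omega>) = distr M env_space (\<lambda>\<omega> i. U i \<omega>))"

text \<open>Only the values at states in \<open>{-1, 1}\<close> matter.\<close>

definition env_trans :: "real \<Rightarrow> real \<Rightarrow> int \<Rightarrow> int \<Rightarrow> real" where
  "env_trans a b s t =
     (if s = -1 \<and> t = 1 then a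
      else if s = -1 \<and> t = -1 then 1 - a
      else if s = 1 \<and> t = -1 then b
      else if s = 1 \<and> t = 1 then 1 - b
      else 0)"

definition markov_environment ::
    "'w measure \<Rightarrow> (int \<Rightarrow> 'w \<Rightarrow> int) \<Rightarrow> real \<Rightarrow> real \<Rightarrow> bool" where
  "markov_environment M U a b \<longleftrightarrow>
     (\<forall>i. U i \<in> M \<rightarrow>\<^sub>M count_space {-1, 1}) \<and>
     stationary_env M U \<and>
     is_markov_chain M U (env_trans a b)"

definition swap_trans :: "real \<Rightarrow> (int \<Rightarrow> int) \<Rightarrow> int \<Rightarrow> int \<Rightarrow> real" where
  "swap_trans p u i j =
     (if j = i + 1 then (if u i = 1 then p else 1 - p)
      else if j = i - 1 then (if u i = 1 then 1 - p else p)
      else 0)"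

text \<open>\<open>Q u\<close> is the law of the walk given \<open>U = u\<close> (a regular conditional distribution of the path
  \<open>X\<close> given the whole environment \<open>U\<close>); the last conjunct says that the joint law of
  \<open>(U, X)\<close> is obtained by mixing \<open>Q u\<close> over the law of the environment.\<close>

definition swap_walk ::
    "'w measure \<Rightarrow> (int \<Rightarrow> 'w \<Rightarrow> int) \<Rightarrow> (nat \<Rightarrow> 'w \<Rightarrow> int) \<Rightarrow> real \<Rightarrow> int \<Rightarrow> bool" where
  "swap_walk M U X p x0 \<longleftrightarrow>
     (\<forall>n. X n \<in> M \<rightarrow>\<^sub>M count_space UNIV) \<and>
     (\<exists>Q \<in> env_space \<rightarrow>\<^sub>M prob_algebra path_space.
        (\<forall>u \<in> space env_space.
           (AE x in Q u. x 0 = x0) \<and>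
           is_markov_chain (Q u) (\<lambda>n x. x n) (swap_trans p u)) \<and>
        (\<forall>A \<in> sets env_space. \<forall>B \<in> sets path_space.
           emeasure M {\<omega> \<in> space M. (\<lambda>i. U i \<omega>) \<in> A \<and> (\<lambda>n. X n \<omega>) \<in> B} =
           (\<integral>\<^sup>+ u \<in> A. emeasure (Q u) B \<partial>distr M env_space (\<lambda>\<omega> i. U i \<omega>))))"

definition ballistic_right :: "real \<Rightarrow> real \<Rightarrow> real \<Rightarrow> bool" where
  "ballistic_right a b p \<longleftrightarrow>
     a > b \<and> p \<in> {1/2 <..< (1 - b) / ((1 - a) + (1 - b))} \<or>
     a < b \<and> p \<in> {(1 - b) / ((1 - a) + (1 - b)) <..< 1/2}"

definition ballistic_left :: "real \<Rightarrow> real \<Rightarrow> real \<Rightarrow> bool" where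
  "ballistic_left a b p \<longleftrightarrow>
     a > b \<and> p \<in> {(1 - a) / ((1 - a) + (1 - b)) <..< 1/2} \<or>
     a < b \<and> p \<in> {1/2 <..< (1 - a) / ((1 - a) + (1 - b))}"

definition zero_speed_right :: "real \<Rightarrow> real \<Rightarrow> real \<Rightarrow> bool" where
  "zero_speed_right a b p \<longleftrightarrow>
     a > b \<and> p \<in> {(1 - b) / ((1 - a) + (1 - b)) ..< 1} \<or>
     a < b \<and> p \<in> {0 <.. (1 - b) / ((1 - a) + (1 - b))}"

definition zero_speed_left :: "real \<Rightarrow> real \<Rightarrow> real \<Rightarrow> bool" where
  "zero_speed_left a b p \<longleftrightarrow>
     a > b \<and> p \<in> {0 <.. (1 - a) / ((1 - a) + (1 - b))} \<or>
     a < b \<and> p \<in> {(1 - a) / ((1 - a) + (1 - b)) ..< 1}"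

end

theory Submission
  imports Defs
begin

text \<open>Let \<open>\<sigma> = (1 - p) / p\<close>, so the walk
  has odds \<open>\<sigma>\<close> to the power \<open>u x\<close> of stepping left at \<open>x\<close>. The expected passage time from \<open>x\<close> to
  \<open>x + 1\<close> satisfies \<open>g x = (1 + r x) + r x * g (x - 1)\<close>; truncating this recursion after \<open>K\<close> steps gives a
  bounded local function \<open>g\<^sub>K\<close>, and with \<open>h\<^sub>K\<close> its discrete primitive, \<open>h\<^sub>K (X n) - n\<close> is a
  martingale up to a nonnegative compensator. Second moments, Borel-Cantelli along polynomial times and the
  Lipschitz property of the paths give \<open>limsup X n / n \<le> 1 / E g\<^sub>K\<close> for every \<open>K\<close>, which already
  settles the zero-speed cases.

  For the matching lower bound in the ballistic case, \<open>K\<close> grows like the logarithm of time. The compensator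
  times the Green function collapses to increments \<open>g\<^sub>k\<^sub>+\<^sub>1 - g\<^sub>k\<close> with \<open>k > K\<close> at shifted sites, so
  its annealed mean is controlled by the geometric convergence of \<open>E g\<^sub>K\<close>.

  Transience and recurrence follow from the bound on visits of the walk killed at a level. For \<open>a = b\<close> the same
  argument, applied to the environment chain together with its partial sums, shows that these sums oscillate.\<close>

text \<open>The recursion for \<open>g\<close> is the first-step equation
  \<open>g x = 1 + (1 - w x) * (g (x - 1) + g x)\<close>, with \<open>w x\<close> the chance of a
  right step, solved for \<open>g x\<close>. Untruncated, \<open>g\<close> is a series over the
  whole environment to the left; its second moment can be infinite although its mean is finite, so
  variance bounds valid up to the exact threshold call for truncation, at the price of factors
  \<open>R ^ K\<close>. For the lower bound a fixed \<open>K\<close> fails: the compensator is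
  controlled in mean only, so Markov's inequality gives a small but not summable probability. With
  \<open>K\<close> logarithmic it becomes summable, while \<open>R ^ K\<close> is a power of the
  time index, paid for by sparser polynomial times.

  Passage times look left, whereas the chain property of the environment looks right. A stationary
  two-state chain is reversible, so moments are computed in the reversed environment. Motion to the
  left is motion to the right after reflecting space, which replaces \<open>p\<close> by
  \<open>1 - p\<close>; the drift is the difference of the two one-sided speeds, at most one of
  which is positive.\<close>

text \<open>Stands in for measurability with respect to the sigma-algebra of the coordinates in
  \<open>J\<close>. Together with Borel measurability it is all that "depends on the past" has to
  mean for processes with finitely many values in bounded time.\<close>

definition det_by :: "'w measure \<Rightarrow> ('t \<Rightarrow> 'w \<Rightarrow> 's) \<Rightarrow> 't set \<Rightarrow> ('w \<Rightarrow> 'b) \<Rightarrow> bool" where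
  "det_by M X J Z \<longleftrightarrow>
     (\<forall>\<omega>\<in>space M. \<forall>\<omega>'\<in>space M. (\<forall>j\<in>J. X j \<omega> = X j \<omega>') \<longrightarrow> Z \<omega> = Z \<omega>')"

lemma det_by_const [intro, simp]: "det_by M X J (\<lambda>_. c)"
  by (simp add: det_by_def)

lemma det_by_coord: "j \<in> J \<Longrightarrow> det_by M X J (\<lambda>\<omega>. X j \<omega>)"
  by (simp add: det_by_def)

lemma det_by_comp: "det_by M X J Z \<Longrightarrow> det_by M X J (\<lambda>\<omega>. f (Z \<omega>))"
  unfolding det_by_def by (intro ballI impI arg_cong[where f = f]) blast

lemma det_by_comp2:
  "det_by M X J Z \<Longrightarrow> det_by M X J Z' \<Longrightarrow> det_by M X J (\<lambda>\<omega>. f (Z \<omega>) (Z' \<omega>))"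
  unfolding det_by_def by (intro ballI impI arg_cong2[where f = f]) blast+

lemma det_by_mono: "det_by M X J Z \<Longrightarrow> J \<subseteq> J' \<Longrightarrow> det_by M X J' Z"
  unfolding det_by_def by blast

lemma det_by_sum:
  "(\<And>i. i \<in> I \<Longrightarrow> det_by M X J (Z i)) \<Longrightarrow> det_by M X J (\<lambda>\<omega>. \<Sum>i\<in>I. Z i \<omega>)"
  unfolding det_by_def by (intro ballI impI sum.cong refl) blast

lemma det_by_Ball:
  "(\<And>i. i \<in> I \<Longrightarrow> det_by M X J (Z i)) \<Longrightarrow> det_by M X J (\<lambda>\<omega>. \<forall>i\<in>I. Z i \<omega>)"
  unfolding det_by_def by (intro ballI impI ball_cong refl) blast

section \<open>From sparse times to all times\<close>

text \<open>Between consecutive sampled times the path moves by at most \<open>B\<close> times a gap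
  that is a vanishing fraction of the time, so a linear bound along \<open>t\<close> survives at the
  cost of \<open>e\<close>. Borel-Cantelli is therefore needed only along times sparse enough for
  summability.\<close>

lemma lipschitz_subsequence_lower_bound:
  fixes y :: "nat \<Rightarrow> real" and t :: "nat \<Rightarrow> nat"
  assumes lip: "\<And>n. \<bar>y (Suc n) - y n\<bar> \<le> B"
    and t: "filterlim t at_top sequentially"
    and ratio: "(\<lambda>j. real (t (Suc j)) / real (t j)) \<longlonglongrightarrow> 1"
    and lower: "eventually (\<lambda>j. l * real (t j) \<le> y (t j)) sequentially"
    and e: "0 < e"
  shows "eventually (\<lambda>n. (l - e) * real n \<le> y n) sequentially"
proof -
  have B: "0 \<le> B" using lip[of 0] by linarith
  \<comment> \<open>Relative gap for which the total error
    \<open>(\<bar>l\<bar> + B) * \<eta> * n\<close> stays below \<open>e * n\<close>; the summand 1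
    keeps the denominator positive.\<close>
  define \<eta> where "\<eta> = e / (\<bar>l\<bar> + B + 1)"
  have \<eta>: "0 < \<eta>" using e B unfolding \<eta>_def by (intro divide_pos_pos) auto
  have "eventually (\<lambda>j. real (t (Suc j)) / real (t j) < 1 + \<eta>) sequentially"
    using order_tendstoD(2)[OF ratio] \<eta> by simp
  moreover have "eventually (\<lambda>j. 1 \<le> t j) sequentially"
    using t by (simp add: filterlim_at_top)
  ultimately have "eventually (\<lambda>j. real (t (Suc j)) - real (t j) \<le> \<eta> * real (t j) \<and> l * real (t j) \<le> y (t j)) sequentially"
    using lower
  proof eventually_elim
    case (elim j)
    then have "real (t (Suc j)) < (1 + \<eta>) * real (t j)" by (simp add: pos_divide_less_eq)
    with elim show ?case by (simp add: algebra_simps)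
  qed
  then obtain j0 where j0: "\<And>j. j0 \<le> j \<Longrightarrow> real (t (Suc j)) - real (t j) \<le> \<eta> * real (t j)"
    "\<And>j. j0 \<le> j \<Longrightarrow> l * real (t j) \<le> y (t j)"
    by (auto simp: eventually_sequentially)
  have "(l - e) * real n \<le> y n" if n: "t j0 \<le> n" for n
  proof -
    \<comment> \<open>\<open>t\<close> may fail to be monotone, so \<open>n\<close> is located
      through the last index whose sampled time is at most \<open>n\<close>; the next sampled time
      then exceeds \<open>n\<close>.\<close>
    define J where "J = {j. j0 \<le> j \<and> t j \<le> n}"
    obtain j1 where j1: "\<And>j. j1 \<le> j \<Longrightarrow> n + 1 \<le> t j"
      using t unfolding filterlim_at_top eventually_sequentially by blast
    have "J \<subseteq> {..j1}"
    proof
      fix j assume "j \<in> J"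
      then show "j \<in> {..j1}" using j1[of j] by (cases "j1 \<le> j") (auto simp: J_def)
    qed
    then have "finite J" by (rule finite_subset) simp
    moreover have "j0 \<in> J" using n by (simp add: J_def)
    ultimately have "Max J \<in> J" "Suc (Max J) \<notin> J"
      using Max_in[of J] Max_ge[of J "Suc (Max J)"] by (blast, metis not_less_eq_eq order_refl)
    then obtain j where j: "j \<in> J" "Suc j \<notin> J" by blast
    then have tj: "j0 \<le> j" "t j \<le> n" "n \<le> t (Suc j)" by (auto simp: J_def)
    have gap: "real n - real (t j) \<le> \<eta> * real n"
    proof -
      have "real n - real (t j) \<le> \<eta> * real (t j)" using j0(1)[OF tj(1)] tj(3) by linarith
      also have "\<dots> \<le> \<eta> * real n" using \<eta> tj by (intro mult_left_mono) auto
      finally show ?thesis .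
    qed
    have "\<bar>y n - y (t j)\<bar> \<le> B * (real n - real (t j))"
      using tj(2)
    proof (induction n rule: dec_induct)
      case (step k)
      then show ?case using lip[of k] by (simp add: algebra_simps)
    qed simp
    then have 1: "y n \<ge> l * real (t j) - B * (real n - real (t j))" using j0(2)[OF tj(1)] by linarith
    have 2: "l * real (t j) \<ge> l * real n - \<bar>l\<bar> * (real n - real (t j))"
    proof -
      have "l * (real n - real (t j)) \<le> \<bar>l\<bar> * (real n - real (t j))" using tj by (intro mult_right_mono) auto
      then show ?thesis by (simp add: algebra_simps)
    qed
    have "y n \<ge> l * real n - (\<bar>l\<bar> + B) * (real n - real (t j))"
      unfolding distrib_right using 1 2 by linarith
    moreover have "(\<bar>l\<bar> + B) * (real n - real (t j)) \<le> (\<bar>l\<bar> + B + 1) * (\<eta> * real n)"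
      using gap B tj \<eta> by (intro mult_mono) auto
    moreover have "(\<bar>l\<bar> + B + 1) * (\<eta> * real n) = e * real n"
      using B unfolding \<eta>_def by (simp add: add_nonneg_eq_0_iff)
    ultimately show ?thesis unfolding left_diff_distrib by linarith
  qed
  then show ?thesis unfolding eventually_sequentially by blast
qed

lemma power_ratio_tendsto_1: "(\<lambda>j. real (Suc j ^ m) / real (j ^ m)) \<longlonglongrightarrow> 1"
proof -
  have "(\<lambda>j. (real (Suc j) / real j) ^ m) \<longlonglongrightarrow> 1 ^ m"
    by (intro tendsto_power LIMSEQ_Suc_n_over_n)
  then show ?thesis unfolding power_divide of_nat_power power_one .
qed

lemma filterlim_power_nat:
  assumes "0 < m"
  shows "filterlim (\<lambda>j::nat. j ^ m) at_top sequentially"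
proof (rule filterlim_at_top_mono[OF filterlim_ident])
  show "eventually (\<lambda>j::nat. j \<le> j ^ m) sequentially"
    using eventually_ge_at_top[of 1] by eventually_elim (use assms in \<open>simp add: self_le_power\<close>)
qed

section \<open>Borel-Cantelli, a strong law, and the integrated Markov property\<close>

context prob_space
begin

text \<open>The intersection lies in every \<open>A n\<close>, so its probability is at most the
  limit of \<open>q n + e\<close>, for each \<open>e\<close>. In the applications \<open>A n\<close>
  is survival up to time \<open>n\<close>, \<open>q\<close> bounds survival inside a finite window
  and \<open>e\<close> survival far away.\<close>

lemma AE_exists_notin:
  assumes [measurable]: "\<And>n. A n \<in> sets M"
    and small: "\<And>e::real. 0 < e \<Longrightarrow> \<exists>q. q \<longlonglongrightarrow> 0 \<and> (\<forall>n::nat. prob (A n) \<le> q n + e)"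
  shows "AE \<omega> in M. \<exists>n. \<omega> \<notin> A n"
proof -
  have "prob (\<Inter>n. A n) \<le> 0 + e" if e: "0 < e" for e
  proof -
    obtain q where q: "q \<longlonglongrightarrow> 0" "\<And>n. prob (A n) \<le> q n + e" using small[OF e] by blast
    have "prob (\<Inter>n. A n) \<le> q n + e" for n
      by (rule order_trans[OF _ q(2)[of n]]) (intro finite_measure_mono, auto)
    then show ?thesis
      by (intro LIMSEQ_le_const[OF tendsto_add[OF q(1) tendsto_const]]) auto
  qed
  then have "prob (\<Inter>n. A n) \<le> 0" by (rule field_le_epsilon) simp
  then have "emeasure M (\<Inter>n. A n) = 0" by (simp add: emeasure_eq_measure measure_le_0_iff)
  then have "(\<Inter>n. A n) \<in> null_sets M" by (rule null_setsI) measurable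
  from AE_not_in[OF this] show ?thesis by (rule AE_mp) simp
qed

lemma chebyshev_abs:
  assumes [measurable]: "Z \<in> borel_measurable M" and "integrable M (\<lambda>\<omega>. (Z \<omega>)\<^sup>2)" and c: "0 < c"
  shows "prob {\<omega>\<in>space M. c \<le> \<bar>Z \<omega>\<bar>} \<le> expectation (\<lambda>\<omega>. (Z \<omega>)\<^sup>2) / c\<^sup>2"
proof -
  have "{\<omega>\<in>space M. c \<le> \<bar>Z \<omega>\<bar>} = {\<omega>\<in>space M. c\<^sup>2 \<le> (Z \<omega>)\<^sup>2}"
    using c by (auto simp: abs_le_square_iff[symmetric])
  moreover have "prob {\<omega>\<in>space M. c\<^sup>2 \<le> (Z \<omega>)\<^sup>2} \<le> expectation (\<lambda>\<omega>. (Z \<omega>)\<^sup>2) / c\<^sup>2"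
    using assms by (intro integral_Markov_inequality_measure[where A = "{}"]) auto
  ultimately show ?thesis by simp
qed

lemma borel_cantelli_eventually:
  assumes [measurable]: "\<And>j. Measurable.pred M (P j)"
    and "summable q" and "eventually (\<lambda>j. prob {\<omega>\<in>space M. P j \<omega>} \<le> q j) sequentially"
  shows "AE \<omega> in M. eventually (\<lambda>j. \<not> P j \<omega>) sequentially"
proof -
  have "AE \<omega> in M. eventually (\<lambda>j. \<omega> \<in> space M - {\<omega>\<in>space M. P j \<omega>}) sequentially"
  proof (rule borel_cantelli_AE1)
    show "summable (\<lambda>j. prob {\<omega>\<in>space M. P j \<omega>})"
      by (rule summable_comparison_test_ev[OF _ assms(2)]) (use assms(3) in simp)
  qed (auto simp: emeasure_eq_measure)
  then show ?thesis using AE_space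
    by eventually_elim (auto elim: eventually_mono)
qed

text \<open>A variance linear in \<open>n\<close> makes Chebyshev's bound summable along the
  squares, where it is of order \<open>1 / j^2\<close>; the Lipschitz property fills the gaps. This
  one law serves the environment sums, the truncated passage times and the martingale of the
  walk.\<close>

theorem lipschitz_lln:
  fixes Z :: "nat \<Rightarrow> 'a \<Rightarrow> real"
  assumes [measurable]: "\<And>n. Z n \<in> borel_measurable M"
    and int: "\<And>n. integrable M (\<lambda>\<omega>. (Z n \<omega>)\<^sup>2)"
    and var: "\<And>n. expectation (\<lambda>\<omega>. (Z n \<omega>)\<^sup>2) \<le> C * real n"
    and lip: "AE \<omega> in M. \<forall>n. \<bar>Z (Suc n) \<omega> - Z n \<omega>\<bar> \<le> B"
  shows "AE \<omega> in M. (\<lambda>n. Z n \<omega> / real n) \<longlonglongrightarrow> 0"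
proof -
  have "AE \<omega> in M. \<forall>i::nat. eventually (\<lambda>j. \<not> real (j^2) / real (Suc i) \<le> \<bar>Z (j^2) \<omega>\<bar>) sequentially"
    unfolding AE_all_countable
  proof
    fix i :: nat
    let ?q = "\<lambda>j. C * real (Suc i) ^ 2 * inverse (real j ^ 2)"
    show "AE \<omega> in M. eventually (\<lambda>j. \<not> real (j^2) / real (Suc i) \<le> \<bar>Z (j^2) \<omega>\<bar>) sequentially"
    proof (rule borel_cantelli_eventually)
      show "summable ?q" by (intro summable_mult inverse_power_summable) simp
      show "eventually (\<lambda>j. prob {\<omega>\<in>space M. real (j^2) / real (Suc i) \<le> \<bar>Z (j^2) \<omega>\<bar>} \<le> ?q j) sequentially"
        using eventually_gt_at_top[of 0]
      proof eventually_elim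
        case (elim j)
        have "prob {\<omega>\<in>space M. real (j^2) / real (Suc i) \<le> \<bar>Z (j^2) \<omega>\<bar>}
            \<le> expectation (\<lambda>\<omega>. (Z (j^2) \<omega>)\<^sup>2) / (real (j^2) / real (Suc i))\<^sup>2"
          using elim by (intro chebyshev_abs int) auto
        also have "\<dots> \<le> (C * real (j^2)) / (real (j^2) / real (Suc i))\<^sup>2"
          by (intro divide_right_mono var) simp
        also have "\<dots> = ?q j" using elim by (simp add: field_simps power2_eq_square)
        finally show ?case .
      qed
    qed measurable
  qed
  then show ?thesis using lip
  proof eventually_elim
    case (elim \<omega>)
    have sq: "filterlim (\<lambda>j::nat. j ^ 2) at_top sequentially" by (rule filterlim_power_nat) simp
    show ?case
    proof (rule LIMSEQ_I)
      fix r :: real assume "0 < r"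
      then obtain i where i: "inverse (real (Suc i)) < r / 2"
        using reals_Archimedean[of "r / 2"] by auto
      define e where "e = inverse (real (Suc i))"
      have e: "0 < e" "e < r / 2" using i by (auto simp: e_def)
      have ev: "eventually (\<lambda>j. \<bar>Z (j^2) \<omega>\<bar> < e * real (j^2)) sequentially"
        using elim(1)[rule_format, of i] by (simp add: e_def field_simps not_le)
      have lo: "eventually (\<lambda>n. (- e - e) * real n \<le> Z n \<omega>) sequentially"
        by (rule lipschitz_subsequence_lower_bound[where t = "\<lambda>j. j^2" and B = B, OF _ sq power_ratio_tendsto_1 _ e(1)])
           (use elim(2) ev in \<open>auto elim!: eventually_mono\<close>)
      have hi: "eventually (\<lambda>n. (- e - e) * real n \<le> - Z n \<omega>) sequentially"
        by (rule lipschitz_subsequence_lower_bound[where t = "\<lambda>j. j^2" and B = B, OF _ sq power_ratio_tendsto_1 _ e(1)])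
           (use elim(2) ev in \<open>auto elim!: eventually_mono simp: abs_minus_commute\<close>)
      from lo hi have "eventually (\<lambda>n. norm (Z n \<omega> / real n - 0) < r) sequentially"
        using eventually_gt_at_top[of 0]
      proof eventually_elim
        case (elim n)
        then have "\<bar>Z n \<omega>\<bar> \<le> 2 * e * real n" by auto
        also have "\<dots> < r * real n" using e elim by (intro mult_strict_right_mono) auto
        finally show ?case using elim by (simp add: pos_divide_less_eq)
      qed
      then show "\<exists>no. \<forall>n\<ge>no. norm (Z n \<omega> / real n - 0) < r"
        by (simp add: eventually_sequentially)
    qed
  qed
qed

text \<open>Almost surely only finitely many configurations on \<open>J\<close> occur and
  \<open>Z\<close> is constant on each, so expectations of \<open>Z\<close> reduce to finite sums of
  cylinder probabilities.\<close>

lemma det_by_representation: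
  fixes X :: "'t \<Rightarrow> 'a \<Rightarrow> 's" and Z :: "'a \<Rightarrow> real"
  assumes J: "finite J"
    and meas: "\<And>j. X j \<in> M \<rightarrow>\<^sub>M count_space UNIV"
    and S: "finite S" "\<And>j. j \<in> J \<Longrightarrow> AE \<omega> in M. X j \<omega> \<in> S"
    and Z: "det_by M X J Z"
  obtains z where "AE \<omega> in M. Z \<omega> =
    (\<Sum>s\<in>Pi\<^sub>E J (\<lambda>_. S). z s * indicator {\<omega>\<in>space M. \<forall>j\<in>J. X j \<omega> = s j} \<omega>)"
proof
  define E where "E s = {\<omega>\<in>space M. \<forall>j\<in>J. X j \<omega> = s j}" for s
  \<comment> \<open>On a configuration that never occurs this value is arbitrary, which is harmless
    as the indicator vanishes there.\<close>
  define z where "z s = Z (SOME \<omega>. \<omega> \<in> E s)" for s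
  have "AE \<omega> in M. \<forall>j\<in>J. X j \<omega> \<in> S"
    using S J by (intro AE_finite_allI) auto
  then show "AE \<omega> in M. Z \<omega> = (\<Sum>s\<in>Pi\<^sub>E J (\<lambda>_. S). z s * indicator {\<omega>\<in>space M. \<forall>j\<in>J. X j \<omega> = s j} \<omega>)"
    using AE_space
  proof eventually_elim
    case (elim \<omega>)
    define s0 where "s0 = restrict (\<lambda>j. X j \<omega>) J"
    have s0: "s0 \<in> Pi\<^sub>E J (\<lambda>_. S)" using elim by (auto simp: s0_def)
    have \<omega>: "\<omega> \<in> E s0" using elim by (auto simp: E_def s0_def)
    then have "(SOME \<omega>. \<omega> \<in> E s0) \<in> E s0" by (metis someI)
    moreover have "Z \<omega>1 = Z \<omega>" if "\<omega>1 \<in> E s0" for \<omega>1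
      by (rule Z[unfolded det_by_def, rule_format]) (use that elim in \<open>auto simp: E_def s0_def\<close>)
    ultimately have z: "z s0 = Z \<omega>" unfolding z_def by blast
    have "(\<Sum>s\<in>Pi\<^sub>E J (\<lambda>_. S). z s * indicator (E s) \<omega>) = (\<Sum>s\<in>{s0}. z s * indicator (E s) \<omega>)"
    proof (rule sum.mono_neutral_right)
      show "finite (Pi\<^sub>E J (\<lambda>_. S))" using J S by (auto intro: finite_PiE)
      show "\<forall>i\<in>Pi\<^sub>E J (\<lambda>_. S) - {s0}. z i * indicator (E i) \<omega> = 0"
      proof
        fix s assume s: "s \<in> Pi\<^sub>E J (\<lambda>_. S) - {s0}"
        have "s = s0" if "\<omega> \<in> E s"
        proof (rule PiE_ext)
          show "s \<in> Pi\<^sub>E J (\<lambda>_. S)" using s by auto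
          show "s0 \<in> Pi\<^sub>E J (\<lambda>_. S)" by fact
          show "s j = s0 j" if "j \<in> J" for j using that \<open>\<omega> \<in> E s\<close> by (auto simp: E_def s0_def)
        qed
        then show "z s * indicator (E s) \<omega> = 0" using s by (auto simp: indicator_def)
      qed
    qed (use s0 in auto)
    also have "\<dots> = Z \<omega>" using z \<omega> by simp
    finally show ?case by (simp add: E_def)
  qed
qed

lemma agree_event:
  assumes "finite J" and meas: "\<And>j. X j \<in> M \<rightarrow>\<^sub>M count_space UNIV"
  shows "{\<omega>\<in>space M. \<forall>j\<in>J. X j \<omega> = s j} \<in> sets M"
proof (rule sets.sets_Collect_finite_All[OF _ \<open>finite J\<close>])
  fix j
  have "{\<omega>\<in>space M. X j \<omega> = s j} = X j -` {s j} \<inter> space M" by blast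
  also have "\<dots> \<in> sets M" using meas by (rule measurable_sets) simp
  finally show "{\<omega>\<in>space M. X j \<omega> = s j} \<in> sets M" .
qed

lemma det_by_integrable:
  fixes X :: "'t \<Rightarrow> 'a \<Rightarrow> 's" and Z :: "'a \<Rightarrow> real"
  assumes J: "finite J"
    and meas: "\<And>j. X j \<in> M \<rightarrow>\<^sub>M count_space UNIV"
    and S: "finite S" "\<And>j. j \<in> J \<Longrightarrow> AE \<omega> in M. X j \<omega> \<in> S"
    and Z: "det_by M X J Z" "Z \<in> borel_measurable M"
  shows "integrable M Z"
proof -
  note [measurable] = meas
  have [measurable]: "{\<omega>\<in>space M. \<forall>j\<in>J. X j \<omega> = s j} \<in> sets M" for s
    using agree_event[OF J meas] .
  obtain z where z: "AE \<omega> in M. Z \<omega> =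
    (\<Sum>s\<in>Pi\<^sub>E J (\<lambda>_. S). z s * indicator {\<omega>\<in>space M. \<forall>j\<in>J. X j \<omega> = s j} \<omega>)"
    using det_by_representation[OF J meas S Z(1)] by blast
  have "integrable M (\<lambda>\<omega>. \<Sum>s\<in>Pi\<^sub>E J (\<lambda>_. S). z s * indicator {\<omega>\<in>space M. \<forall>j\<in>J. X j \<omega> = s j} \<omega>)"
    by (intro Bochner_Integration.integrable_sum integrable_mult_right integrable_real_indicator)
       (auto simp: emeasure_eq_measure)
  then show ?thesis
    using integrable_cong_AE[OF Z(2) _ z] by auto
qed

text \<open>The chain property multiplied out: it now also covers conditioning events of probability
  zero, where both sides vanish.\<close>

lemma markov_joint:
  fixes X :: "'t::linordered_semidom \<Rightarrow> 'a \<Rightarrow> 's"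
  assumes mc: "is_markov_chain M X K" and "r \<le> t" and "finite {r..t}"
    and meas: "\<And>j. X j \<in> M \<rightarrow>\<^sub>M count_space UNIV"
  shows "\<P>(\<omega> in M. X (t+1) \<omega> = y \<and> (\<forall>j\<in>{r..t}. X j \<omega> = s j))
           = K (s t) y * \<P>(\<omega> in M. \<forall>j\<in>{r..t}. X j \<omega> = s j)"
proof -
  define p where "p = \<P>(\<omega> in M. \<forall>j\<in>{r..t}. X j \<omega> = s j)"
  define q where "q = \<P>(\<omega> in M. X (t+1) \<omega> = y \<and> (\<forall>j\<in>{r..t}. X j \<omega> = s j))"
  have "q \<le> p" unfolding p_def q_def
    by (rule finite_measure_mono[OF _ agree_event[OF \<open>finite {r..t}\<close> meas]]) blast
  have "0 \<le> q" unfolding q_def by (rule measure_nonneg)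
  have "q / p = K (s t) y" if "0 < p"
    using mc[unfolded is_markov_chain_def, rule_format, OF \<open>r \<le> t\<close> that[unfolded p_def], of y]
    unfolding cond_prob_def p_def q_def .
  with \<open>q \<le> p\<close> \<open>0 \<le> q\<close> have "q = K (s t) y * p"
    by (cases "p = 0") (auto simp: field_simps)
  then show ?thesis unfolding p_def q_def .
qed

text \<open>Testing against every past-determined \<open>Z\<close> replaces conditional expectation
  given the past. Both sides are expanded over cylinders and compared term by term through
  \<open>markov_joint\<close>.\<close>

lemma markov_expectation:
  fixes X :: "'t::linordered_semidom \<Rightarrow> 'a \<Rightarrow> 's" and Z :: "'a \<Rightarrow> real"
  assumes mc: "is_markov_chain M X K" and rt: "r \<le> t" and fin: "finite {r..t}"
    and meas: "\<And>j. X j \<in> M \<rightarrow>\<^sub>M count_space UNIV"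
    and S: "finite S" "\<And>j. j \<in> {r..t} \<Longrightarrow> AE \<omega> in M. X j \<omega> \<in> S" "AE \<omega> in M. X (t+1) \<omega> \<in> S"
    and Z: "det_by M X {r..t} Z" "Z \<in> borel_measurable M"
  shows "expectation (\<lambda>\<omega>. Z \<omega> * f (X (t+1) \<omega>))
       = expectation (\<lambda>\<omega>. Z \<omega> * (\<Sum>y\<in>S. K (X t \<omega>) y * f y))"
proof -
  note [measurable] = meas Z(2)
  have [measurable]: "f \<in> borel_measurable (count_space UNIV)"
    "(\<lambda>s. \<Sum>y\<in>S. K s y * f y) \<in> borel_measurable (count_space UNIV)" by simp_all
  define E where "E s = {\<omega>\<in>space M. \<forall>j\<in>{r..t}. X j \<omega> = s j}" for s
  have [measurable]: "E s \<in> sets M" for s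
    unfolding E_def using agree_event[OF fin meas] .
  let ?P = "Pi\<^sub>E {r..t} (\<lambda>_. S)"
  let ?B = "\<lambda>y. {\<omega>\<in>space M. X (t+1) \<omega> = y}"
  obtain z where z: "AE \<omega> in M. Z \<omega> = (\<Sum>s\<in>?P. z s * indicator (E s) \<omega>)"
    using det_by_representation[OF fin meas S(1,2) Z(1)] unfolding E_def by blast
  have [simp]: "integrable M (indicator A :: 'a \<Rightarrow> real)" if "A \<in> sets M" for A
    using that by (auto simp: emeasure_eq_measure)
  have "expectation (\<lambda>\<omega>. Z \<omega> * f (X (t+1) \<omega>))
      = expectation (\<lambda>\<omega>. \<Sum>s\<in>?P. \<Sum>y\<in>S. z s * f y * indicator (E s \<inter> ?B y) \<omega>)"
  proof (rule integral_cong_AE)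
    show "AE \<omega> in M. Z \<omega> * f (X (t + 1) \<omega>) = (\<Sum>s\<in>?P. \<Sum>y\<in>S. z s * f y * indicator (E s \<inter> ?B y) \<omega>)"
      using z S(3) AE_space
    proof eventually_elim
      case (elim \<omega>)
      have "f (X (t + 1) \<omega>) = (\<Sum>y\<in>S. f y * indicator (?B y) \<omega>)"
        using elim S(1) by (subst sum.remove[of _ "X (t+1) \<omega>"]) (auto intro!: sum.neutral simp: indicator_def)
      then show ?case
        unfolding elim(1) by (simp add: sum_product indicator_inter_arith mult_ac)
    qed
  qed measurable
  also have "\<dots> = (\<Sum>s\<in>?P. \<Sum>y\<in>S. z s * f y * prob (E s \<inter> ?B y))"
    by (subst Bochner_Integration.integral_sum | simp)+
  also have "\<dots> = (\<Sum>s\<in>?P. \<Sum>y\<in>S. z s * f y * (K (s t) y * prob (E s)))"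
  proof (intro sum.cong refl)
    fix s y
    have "E s \<inter> ?B y = {\<omega>\<in>space M. X (t+1) \<omega> = y \<and> (\<forall>j\<in>{r..t}. X j \<omega> = s j)}"
      by (auto simp: E_def)
    then show "z s * f y * prob (E s \<inter> ?B y) = z s * f y * (K (s t) y * prob (E s))"
      using markov_joint[OF mc rt fin meas, of y s] by (simp add: E_def)
  qed
  also have "\<dots> = (\<Sum>s\<in>?P. z s * (\<Sum>y\<in>S. K (s t) y * f y) * prob (E s))"
    by (simp add: sum_distrib_left sum_distrib_right mult_ac)
  also have "\<dots> = expectation (\<lambda>\<omega>. \<Sum>s\<in>?P. z s * (\<Sum>y\<in>S. K (s t) y * f y) * indicator (E s) \<omega>)"
    by (subst Bochner_Integration.integral_sum | simp)+
  also have "\<dots> = expectation (\<lambda>\<omega>. Z \<omega> * (\<Sum>y\<in>S. K (X t \<omega>) y * f y))"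
  proof (rule integral_cong_AE)
    show "AE \<omega> in M. (\<Sum>s\<in>?P. z s * (\<Sum>y\<in>S. K (s t) y * f y) * indicator (E s) \<omega>) =
        Z \<omega> * (\<Sum>y\<in>S. K (X t \<omega>) y * f y)"
      using z
    proof eventually_elim
      case (elim \<omega>)
      have "z s * indicator (E s) \<omega> * (\<Sum>y\<in>S. K (X t \<omega>) y * f y)
          = z s * (\<Sum>y\<in>S. K (s t) y * f y) * indicator (E s) \<omega>" for s
      proof (cases "\<omega> \<in> E s")
        case True
        then have "X t \<omega> = s t" using rt by (auto simp: E_def)
        with True show ?thesis by simp
      qed simp
      then show ?case unfolding elim sum_distrib_right by (intro sum.cong refl) (simp only: sum_distrib_right)
    qed
  qed measurable
  finally show ?thesis .
qed

end

section \<open>Birth-death walks\<close>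

definition bd_trans :: "(int \<Rightarrow> real) \<Rightarrow> int \<Rightarrow> int \<Rightarrow> real" where
  "bd_trans w i j = (if j = i + 1 then w i else if j = i - 1 then 1 - w i else 0)"

locale bd_walk = prob_space N for N :: "'w measure" +
  fixes Y :: "nat \<Rightarrow> 'w \<Rightarrow> int" and w :: "int \<Rightarrow> real" and x0 :: int
  assumes Y_meas [measurable]: "Y n \<in> N \<rightarrow>\<^sub>M count_space UNIV"
    and w_pos: "0 < w x" and w_lt1: "w x < 1"
    and start: "AE \<omega> in N. Y 0 \<omega> = x0"
    and chain: "is_markov_chain N Y (bd_trans w)"
begin

lemma nearest_neighbour: "AE \<omega> in N. \<forall>n. Y (Suc n) \<omega> = Y n \<omega> + 1 \<or> Y (Suc n) \<omega> = Y n \<omega> - 1"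
proof -
  have null: "AE \<omega> in N. \<not> (Y (Suc n) \<omega> = y \<and> Y n \<omega> = x)" if xy: "y \<noteq> x + 1" "y \<noteq> x - 1" for n x y
  proof -
    have "prob {\<omega>\<in>space N. Y (n + 1) \<omega> = y \<and> (\<forall>j\<in>{n..n}. Y j \<omega> = x)} = 0"
      using markov_joint[OF chain, of n n y "\<lambda>_. x"] Y_meas xy by (simp add: bd_trans_def)
    then show ?thesis
      by (subst AE_iff_measurable[OF _ refl]) (auto simp: emeasure_eq_measure)
  qed
  have "AE \<omega> in N. \<forall>n x y. y \<noteq> x + 1 \<longrightarrow> y \<noteq> x - 1 \<longrightarrow> \<not> (Y (Suc n) \<omega> = y \<and> Y n \<omega> = x)"
  proof (unfold AE_all_countable, intro allI)
    fix n x y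
    show "AE \<omega> in N. y \<noteq> x + 1 \<longrightarrow> y \<noteq> x - 1 \<longrightarrow> \<not> (Y (Suc n) \<omega> = y \<and> Y n \<omega> = x)"
      using null[of y x n] by (cases "y = x + 1 \<or> y = x - 1") auto
  qed
  then show ?thesis by eventually_elim blast
qed

lemma range: "AE \<omega> in N. \<forall>n. \<bar>Y n \<omega> - x0\<bar> \<le> int n"
  using nearest_neighbour start
proof eventually_elim
  case (elim \<omega>)
  have "\<bar>Y n \<omega> - x0\<bar> \<le> int n" for n
  proof (induction n)
    case (Suc n)
    then show ?case using elim(1)[rule_format, of n] by auto
  qed (use elim in simp)
  then show ?case by blast
qed

lemma range_in: "j \<in> {0..n} \<Longrightarrow> AE \<omega> in N. Y j \<omega> \<in> {x0 - int n..x0 + int n}"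
  using range by eventually_elim (auto dest!: spec[of _ j])

lemma past_integrable:
  fixes Z :: "'w \<Rightarrow> real"
  assumes "det_by N Y {0..n} Z" "Z \<in> borel_measurable N"
  shows "integrable N Z"
  by (rule det_by_integrable[where X = Y and J = "{0..n}" and S = "{x0 - int n..x0 + int n}"])
     (use assms range_in in auto)

lemma step:
  fixes Z :: "'w \<Rightarrow> real"
  assumes Z: "det_by N Y {0..n} Z" and [measurable]: "Z \<in> borel_measurable N"
  shows "expectation (\<lambda>\<omega>. Z \<omega> * f (Y (Suc n) \<omega>)) =
    expectation (\<lambda>\<omega>. Z \<omega> * (w (Y n \<omega>) * f (Y n \<omega> + 1) + (1 - w (Y n \<omega>)) * f (Y n \<omega> - 1)))"
proof -
  let ?S = "{x0 - int (Suc n)..x0 + int (Suc n)}"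
  have "expectation (\<lambda>\<omega>. Z \<omega> * f (Y (n+1) \<omega>)) =
      expectation (\<lambda>\<omega>. Z \<omega> * (\<Sum>y\<in>?S. bd_trans w (Y n \<omega>) y * f y))"
    using range_in[of _ "Suc n"]
    by (intro markov_expectation[OF chain, where r = 0] Y_meas Z assms(2)) auto
  also have "\<dots> = expectation (\<lambda>\<omega>. Z \<omega> * (w (Y n \<omega>) * f (Y n \<omega> + 1) + (1 - w (Y n \<omega>)) * f (Y n \<omega> - 1)))"
  proof (rule integral_cong_AE)
    show "AE \<omega> in N. Z \<omega> * (\<Sum>y\<in>?S. bd_trans w (Y n \<omega>) y * f y) =
        Z \<omega> * (w (Y n \<omega>) * f (Y n \<omega> + 1) + (1 - w (Y n \<omega>)) * f (Y n \<omega> - 1))"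
      using range
    proof eventually_elim
      case (elim \<omega>)
      let ?x = "Y n \<omega>"
      have "\<bar>?x - x0\<bar> \<le> int n" using elim by blast
      then have "(\<Sum>y\<in>?S. bd_trans w ?x y * f y) = (\<Sum>y\<in>{?x+1, ?x-1}. bd_trans w ?x y * f y)"
        by (intro sum.mono_neutral_right) (auto simp: bd_trans_def)
      then show ?case by (simp add: bd_trans_def)
    qed
  qed measurable
  finally show ?thesis by simp
qed

definition alive :: "int \<Rightarrow> nat \<Rightarrow> 'w \<Rightarrow> bool" where
  "alive m n \<omega> \<longleftrightarrow> (\<forall>k\<in>{0..n}. Y k \<omega> < m)"

lemma alive_measurable [measurable]: "Measurable.pred N (alive m n)"
  unfolding alive_def by measurable

lemma alive_lt: "alive m n \<omega> \<Longrightarrow> Y n \<omega> < m"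
  by (simp add: alive_def)

lemma alive_Suc: "alive m (Suc n) \<omega> \<longleftrightarrow> alive m n \<omega> \<and> Y (Suc n) \<omega> < m"
  by (auto simp: alive_def atLeastAtMostSuc_conv)

lemma alive_det: "n \<le> n' \<Longrightarrow> det_by N Y {0..n'} (alive m n)"
  unfolding alive_def
  by (intro det_by_Ball det_by_comp[where f = "\<lambda>x. x < m"] det_by_coord) auto

text \<open>A nearest-neighbour path leaves the region below \<open>m\<close> exactly at
  \<open>m\<close>, where \<open>H\<close> vanishes. So the updated survival indicator may be
  replaced by the old one, which depends only on the past, and \<open>step\<close> applies.\<close>

lemma alive_step:
  assumes "H m = 0"
  shows "expectation (\<lambda>\<omega>. of_bool (alive m (Suc n) \<omega>) * H (Y (Suc n) \<omega>)) =
    expectation (\<lambda>\<omega>. of_bool (alive m n \<omega>) *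
      (w (Y n \<omega>) * H (Y n \<omega> + 1) + (1 - w (Y n \<omega>)) * H (Y n \<omega> - 1)))"
proof -
  have "expectation (\<lambda>\<omega>. of_bool (alive m (Suc n) \<omega>) * H (Y (Suc n) \<omega>)) =
      expectation (\<lambda>\<omega>. of_bool (alive m n \<omega>) * H (Y (Suc n) \<omega>))"
  proof (rule integral_cong_AE)
    show "AE \<omega> in N. of_bool (alive m (Suc n) \<omega>) * H (Y (Suc n) \<omega>) =
        of_bool (alive m n \<omega>) * H (Y (Suc n) \<omega>)"
      using nearest_neighbour
    proof eventually_elim
      case (elim \<omega>)
      have "H (Y (Suc n) \<omega>) = 0" if "alive m n \<omega>" "\<not> Y (Suc n) \<omega> < m"
      proof -
        have "Y n \<omega> < m" using that by (auto simp: alive_def)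
        then have "Y (Suc n) \<omega> = m" using that elim[rule_format, of n] by auto
        with assms show ?thesis by simp
      qed
      then show ?case by (auto simp: alive_Suc)
    qed
  qed measurable
  also have "\<dots> = expectation (\<lambda>\<omega>. of_bool (alive m n \<omega>) *
      (w (Y n \<omega>) * H (Y n \<omega> + 1) + (1 - w (Y n \<omega>)) * H (Y n \<omega> - 1)))"
    by (intro step det_by_comp[where f = of_bool] alive_det) auto
  finally show ?thesis .
qed

lemma alive_integrable: "integrable N (\<lambda>\<omega>. of_bool (alive m n \<omega>) * f (Y n \<omega>) :: real)"
proof (rule past_integrable)
  show "det_by N Y {0..n} (\<lambda>\<omega>. of_bool (alive m n \<omega>) * f (Y n \<omega>) :: real)"
    by (intro det_by_comp2[where f = "(*)"] det_by_comp[where f = of_bool] det_by_comp[where f = f]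
        alive_det det_by_coord) auto
qed measurable

lemma alive_0:
  assumes "x0 < m"
  shows "expectation (\<lambda>\<omega>. of_bool (alive m 0 \<omega>) * f (Y 0 \<omega>)) = (f x0 :: real)"
proof -
  have "expectation (\<lambda>\<omega>. of_bool (alive m 0 \<omega>) * f (Y 0 \<omega>)) = expectation (\<lambda>\<omega>. f x0)"
  proof (rule integral_cong_AE)
    show "AE \<omega> in N. of_bool (alive m 0 \<omega>) * f (Y 0 \<omega>) = f x0"
      using start by eventually_elim (use assms in \<open>auto simp: alive_def\<close>)
  qed measurable
  then show ?thesis by (simp add: prob_space)
qed

end

section \<open>Scale functions: exit and visit bounds\<close>

text \<open>\<open>P_harm\<close> says that a function \<open>H\<close> with
  \<open>H y - H (y + 1) = P y\<close> is harmonic for the walk. Only increments are recorded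
  because the primitives in use vanish at a varying level \<open>m\<close>.\<close>

locale bd_scale = bd_walk +
  fixes P :: "int \<Rightarrow> real"
  assumes P_pos: "0 < P x" and P_harm: "w x * P x = (1 - w x) * P (x - 1)"
begin

text \<open>The primitive of \<open>P\<close> vanishing at \<open>m\<close> is harmonic below
  \<open>m\<close>, so its mean over surviving paths is conserved. Markov's inequality then bounds
  the chance of surviving far to the left.\<close>

lemma exit_identity:
  assumes "x0 < m"
  shows "expectation (\<lambda>\<omega>. of_bool (alive m n \<omega>) * (\<Sum>z\<in>{Y n \<omega>..<m}. P z)) = (\<Sum>z\<in>{x0..<m}. P z)"
proof (induction n)
  case 0
  show ?case using alive_0[OF assms, of "\<lambda>y. \<Sum>z\<in>{y..<m}. P z"] .
next
  case (Suc n)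
  define H where "H y = (\<Sum>z\<in>{y..<m}. P z)" for y
  have harm: "w y * H (y + 1) + (1 - w y) * H (y - 1) = H y" if "y < m" for y
  proof -
    have "{y..<m} = insert y {y+1..<m}" "{y-1..<m} = insert (y-1) (insert y {y+1..<m})" using that by auto
    then have H: "H y = P y + H (y+1)" "H (y-1) = P (y-1) + P y + H (y+1)" unfolding H_def by auto
    then show ?thesis using P_harm[of y] by (simp add: algebra_simps)
  qed
  have "expectation (\<lambda>\<omega>. of_bool (alive m (Suc n) \<omega>) * H (Y (Suc n) \<omega>)) =
      expectation (\<lambda>\<omega>. of_bool (alive m n \<omega>) *
        (w (Y n \<omega>) * H (Y n \<omega> + 1) + (1 - w (Y n \<omega>)) * H (Y n \<omega> - 1)))"
    by (rule alive_step) (simp add: H_def)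
  also have "\<dots> = expectation (\<lambda>\<omega>. of_bool (alive m n \<omega>) * H (Y n \<omega>))"
    by (intro Bochner_Integration.integral_cong refl) (auto simp: harm dest: alive_lt)
  finally show ?case using Suc by (simp add: H_def)
qed

text \<open>Flattening the harmonic function to the left of \<open>x\<close> keeps it harmonic
  except at \<open>x\<close>, where every visit costs exactly \<open>w x * P x\<close>. The total
  cost cannot exceed the initial value, which is at most the value on the flat part.\<close>

lemma killed_green:
  assumes m: "x0 < m" and x: "x < m"
  shows "(\<Sum>k<n. prob {\<omega>\<in>space N. alive m k \<omega> \<and> Y k \<omega> = x}) * (w x * P x) \<le> (\<Sum>z\<in>{x..<m}. P z)"
proof -
  define H where "H y = (\<Sum>z\<in>{max x y..<m}. P z)" for y
  define v where "v k = expectation (\<lambda>\<omega>. of_bool (alive m k \<omega>) * H (Y k \<omega>))" for k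
  define q where "q k = prob {\<omega>\<in>space N. alive m k \<omega> \<and> Y k \<omega> = x}" for k
  have H_nonneg: "0 \<le> H y" for y unfolding H_def by (intro sum_nonneg less_imp_le P_pos)
  have harm: "w y * H (y + 1) + (1 - w y) * H (y - 1) = H y - of_bool (y = x) * (w x * P x)" if y: "y < m" for y
  proof -
    consider "y < x" | "y = x" | "x < y" by linarith
    then show ?thesis
    proof cases
      case 1
      then show ?thesis by (simp add: H_def max_absorb1 algebra_simps)
    next
      case 2
      have "{x..<m} = insert x {x+1..<m}" using x by auto
      then have "H x = P x + H (x+1)" "H (x-1) = P x + H (x+1)" unfolding H_def by (auto simp: max_def)
      with 2 show ?thesis by (simp add: algebra_simps)
    next
      case 3
      have "{y..<m} = insert y {y+1..<m}" "{y-1..<m} = insert (y-1) (insert y {y+1..<m})" using y by auto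
      then have H: "H y = P y + H (y+1)" "H (y-1) = P (y-1) + P y + H (y+1)"
        unfolding H_def using 3 by (auto simp: max_def)
      then show ?thesis using P_harm[of y] 3 by (simp add: algebra_simps)
    qed
  qed
  have rec: "v (Suc k) = v k - q k * (w x * P x)" for k
  proof -
    have "v (Suc k) = expectation (\<lambda>\<omega>. of_bool (alive m k \<omega>) *
        (w (Y k \<omega>) * H (Y k \<omega> + 1) + (1 - w (Y k \<omega>)) * H (Y k \<omega> - 1)))"
      unfolding v_def by (rule alive_step) (use x in \<open>simp add: H_def max_def\<close>)
    also have "\<dots> = expectation (\<lambda>\<omega>. of_bool (alive m k \<omega>) * H (Y k \<omega>)
        - of_bool (alive m k \<omega>) * (of_bool (Y k \<omega> = x) * (w x * P x)))"
      by (intro Bochner_Integration.integral_cong refl) (auto simp: harm dest: alive_lt)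
    also have "\<dots> = v k - expectation (\<lambda>\<omega>. of_bool (alive m k \<omega>) * (of_bool (Y k \<omega> = x) * (w x * P x)))"
      unfolding v_def
      by (rule Bochner_Integration.integral_diff alive_integrable
          alive_integrable[where f = "\<lambda>y. of_bool (y = x) * (w x * P x)"])+
    also have "expectation (\<lambda>\<omega>. of_bool (alive m k \<omega>) * (of_bool (Y k \<omega> = x) * (w x * P x)))
        = expectation (\<lambda>\<omega>. (w x * P x) * indicator {\<omega>\<in>space N. alive m k \<omega> \<and> Y k \<omega> = x} \<omega>)"
      by (intro Bochner_Integration.integral_cong refl) (auto simp: indicator_def)
    also have "\<dots> = q k * (w x * P x)" unfolding q_def by simp
    finally show ?thesis .
  qed
  have "v n = v 0 - (\<Sum>k<n. q k) * (w x * P x)"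
    by (induction n) (auto simp: rec algebra_simps)
  moreover have "v n \<ge> 0" unfolding v_def by (intro integral_nonneg_AE) (auto simp: H_nonneg)
  moreover have "v 0 = H x0" unfolding v_def by (rule alive_0[OF m])
  moreover have "H x0 \<le> (\<Sum>z\<in>{x..<m}. P z)"
    unfolding H_def by (intro sum_mono2) (auto simp: less_imp_le[OF P_pos])
  ultimately show ?thesis unfolding q_def by linarith
qed

text \<open>Killing at a level that cannot be reached within \<open>n\<close> steps changes nothing,
  so \<open>killed_green\<close> applies to the free walk.\<close>

lemma green:
  "(\<Sum>k<n. prob {\<omega>\<in>space N. Y k \<omega> = x}) * (w x * P x) \<le> (\<Sum>z\<in>{x..max x x0 + int n}. P z)"
proof -
  define m where "m = max x x0 + int n + 1"
  have m: "x0 < m" "x < m" by (auto simp: m_def)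
  have "(\<Sum>k<n. prob {\<omega>\<in>space N. Y k \<omega> = x}) = (\<Sum>k<n. prob {\<omega>\<in>space N. alive m k \<omega> \<and> Y k \<omega> = x})"
  proof (intro sum.cong refl finite_measure_eq_AE)
    fix k assume k: "k \<in> {..<n}"
    show "AE \<omega> in N. (\<omega> \<in> {\<omega>\<in>space N. Y k \<omega> = x}) = (\<omega> \<in> {\<omega>\<in>space N. alive m k \<omega> \<and> Y k \<omega> = x})"
      using range
    proof eventually_elim
      case (elim \<omega>)
      have "Y j \<omega> < m" if "j \<in> {0..k}" for j
        using elim[rule_format, of j] that k by (auto simp: m_def)
      then show ?case by (auto simp: alive_def)
    qed
  qed measurable
  moreover have "{x..<m} = {x..max x x0 + int n}" by (auto simp: m_def)
  ultimately show ?thesis using killed_green[OF m, of n] by simp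
qed

text \<open>A path surviving below \<open>m\<close> is either in a finite window, whose visit
  probabilities are summable by \<open>killed_green\<close> and so tend to zero, or at or left of
  \<open>l'\<close>, which by \<open>exit_identity\<close> has probability at most
  \<open>H x0 / H l'\<close>. Divergence of the left sums makes this ratio small.\<close>

theorem unbounded_above:
  assumes unb: "\<And>C. \<exists>l. C < (\<Sum>z\<in>{l..<0}. P z)"
  shows "AE \<omega> in N. \<forall>m. \<exists>n. m \<le> Y n \<omega>"
proof -
  have "AE \<omega> in N. \<exists>n. m \<le> Y n \<omega>" for m
  proof (cases "x0 < m")
    case False
    show ?thesis using start by eventually_elim (use False in \<open>auto intro!: exI[of _ 0]\<close>)
  next
    case m: True
    define A where "A n = {\<omega>\<in>space N. alive m n \<omega>}" for n
    define H where "H y = (\<Sum>z\<in>{y..<m}. P z)" for y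
    have [measurable]: "A n \<in> sets N" for n unfolding A_def by measurable
    have H_mono: "H y \<le> H y'" if "y' \<le> y" for y y'
      unfolding H_def using that by (intro sum_mono2) (auto simp: less_imp_le[OF P_pos])
    have visit: "(\<lambda>n. prob {\<omega>\<in>space N. alive m n \<omega> \<and> Y n \<omega> = x}) \<longlonglongrightarrow> 0" if "x < m" for x
    proof (rule summable_LIMSEQ_zero, rule bounded_imp_summable)
      have wP: "0 < w x * P x" using w_pos P_pos by simp
      show "(\<Sum>k\<le>n. prob {\<omega>\<in>space N. alive m k \<omega> \<and> Y k \<omega> = x}) \<le> (\<Sum>z\<in>{x..<m}. P z) / (w x * P x)" for n
        using killed_green[OF m that, of "Suc n"] wP
        by (simp add: lessThan_Suc_atMost pos_le_divide_eq)
    qed simp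
    have "\<exists>q. q \<longlonglongrightarrow> 0 \<and> (\<forall>n. prob (A n) \<le> q n + e)" if e: "0 < e" for e :: real
    proof -
      obtain l where l: "H x0 / e + \<bar>\<Sum>z\<in>{m..<0}. P z\<bar> < (\<Sum>z\<in>{l..<0}. P z)" using unb by blast
      \<comment> \<open>Going below \<open>m\<close> as well makes \<open>H l'\<close> comparable
        with the large sum over \<open>{l..<0}\<close>: they differ by at most a sum that does not
        involve \<open>l\<close>.\<close>
      define l' where "l' = min l (m - 1)"
      have "(\<Sum>z\<in>{l..<0}. P z) \<le> (\<Sum>z\<in>{l'..<m} \<union> {m..<0}. P z)"
        by (intro sum_mono2) (auto simp: l'_def less_imp_le[OF P_pos])
      also have "\<dots> = H l' + (\<Sum>z\<in>{m..<0}. P z)"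
        unfolding H_def by (intro sum.union_disjoint) auto
      finally have "H x0 / e < H l'" using l by linarith
      have "0 \<le> H x0" unfolding H_def by (intro sum_nonneg less_imp_le P_pos)
      with \<open>H x0 / e < H l'\<close> e have Hl: "0 < H l'" by (smt (verit) divide_nonneg_pos)
      have bound: "prob (A n) \<le> (\<Sum>x\<in>{l'<..<m}. prob {\<omega>\<in>space N. alive m n \<omega> \<and> Y n \<omega> = x}) + e" for n
      proof -
        define B where "B = {\<omega>\<in>space N. alive m n \<omega> \<and> Y n \<omega> \<le> l'}"
        have [measurable]: "B \<in> sets N" unfolding B_def by measurable
        have "prob B * H l' = expectation (\<lambda>\<omega>. indicator B \<omega> * H l')" by simp
        also have "\<dots> \<le> expectation (\<lambda>\<omega>. of_bool (alive m n \<omega>) * H (Y n \<omega>))"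
        proof (rule integral_mono)
          show "integrable N (\<lambda>\<omega>. of_bool (alive m n \<omega>) * H (Y n \<omega>))" by (rule alive_integrable)
          show "indicator B \<omega> * H l' \<le> of_bool (alive m n \<omega>) * H (Y n \<omega>)" for \<omega>
            using H_mono[of "Y n \<omega>" l'] Hl
            by (auto simp: B_def indicator_def H_def intro!: sum_nonneg less_imp_le[OF P_pos])
        qed (simp add: emeasure_eq_measure)
        also have "\<dots> = H x0" unfolding H_def by (rule exit_identity[OF m])
        finally have "prob B \<le> H x0 / H l'" using Hl by (simp add: pos_le_divide_eq)
        also have "\<dots> \<le> e" using \<open>H x0 / e < H l'\<close> e Hl by (simp add: field_simps)
        finally have B: "prob B \<le> e" .
        have "A n \<subseteq> (\<Union>x\<in>{l'<..<m}. {\<omega>\<in>space N. alive m n \<omega> \<and> Y n \<omega> = x}) \<union> B"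
          by (auto simp: A_def B_def alive_def)
        then have "prob (A n) \<le> prob ((\<Union>x\<in>{l'<..<m}. {\<omega>\<in>space N. alive m n \<omega> \<and> Y n \<omega> = x}) \<union> B)"
          by (intro finite_measure_mono) measurable
        also have "\<dots> \<le> prob (\<Union>x\<in>{l'<..<m}. {\<omega>\<in>space N. alive m n \<omega> \<and> Y n \<omega> = x}) + prob B"
          by (intro measure_Un_le) measurable
        also have "prob (\<Union>x\<in>{l'<..<m}. {\<omega>\<in>space N. alive m n \<omega> \<and> Y n \<omega> = x})
            \<le> (\<Sum>x\<in>{l'<..<m}. prob {\<omega>\<in>space N. alive m n \<omega> \<and> Y n \<omega> = x})"
          by (intro finite_measure_subadditive_finite) auto
        finally show ?thesis using B by linarith
      qed
      have "(\<lambda>n. \<Sum>x\<in>{l'<..<m}. prob {\<omega>\<in>space N. alive m n \<omega> \<and> Y n \<omega> = x}) \<longlonglongrightarrow> 0"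
        by (intro tendsto_null_sum visit) auto
      with bound show ?thesis by blast
    qed
    then have "AE \<omega> in N. \<exists>n. \<omega> \<notin> A n" by (intro AE_exists_notin) auto
    then show ?thesis using AE_space
      by eventually_elim (auto simp: A_def alive_def not_less)
  qed
  then show ?thesis by (simp add: AE_all_countable)
qed

lemma finitely_many_visits:
  assumes bdd: "\<And>m. (\<Sum>z\<in>{x..m}. P z) \<le> C"
  shows "AE \<omega> in N. eventually (\<lambda>n. Y n \<omega> \<noteq> x) sequentially"
proof -
  have wP: "0 < w x * P x" using w_pos P_pos by simp
  have "AE \<omega> in N. eventually (\<lambda>n. \<omega> \<in> space N - {\<omega>\<in>space N. Y n \<omega> = x}) sequentially"
  proof (rule borel_cantelli_AE1)
    show "summable (\<lambda>n. measure N {\<omega> \<in> space N. Y n \<omega> = x})"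
    proof (rule bounded_imp_summable)
      show "(\<Sum>k\<le>n. prob {\<omega>\<in>space N. Y k \<omega> = x}) \<le> C / (w x * P x)" for n
        using green[of x "Suc n"] bdd[of "max x x0 + int (Suc n)"] wP
        by (simp add: lessThan_Suc_atMost pos_le_divide_eq)
    qed simp
  qed (auto simp: emeasure_eq_measure)
  then show ?thesis using AE_space
    by eventually_elim (auto elim: eventually_mono)
qed

text \<open>Bounded right sums make the visits to each site summable, so the path eventually avoids
  \<open>k\<close>. Being unbounded above and unable to jump over \<open>k\<close>, it ends up to
  the right of \<open>k\<close> for good.\<close>

theorem transient_right:
  assumes unb: "\<And>C. \<exists>l. C < (\<Sum>z\<in>{l..<0}. P z)"
    and bdd: "\<And>x. \<exists>C. \<forall>m. (\<Sum>z\<in>{x..m}. P z) \<le> C"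
  shows "AE \<omega> in N. \<forall>k. eventually (\<lambda>n. k \<le> Y n \<omega>) sequentially"
proof -
  have "AE \<omega> in N. \<forall>x. eventually (\<lambda>n. Y n \<omega> \<noteq> x) sequentially"
    unfolding AE_all_countable using finitely_many_visits bdd by blast
  then show ?thesis using unbounded_above[OF unb] nearest_neighbour
  proof eventually_elim
    case (elim \<omega>)
    show ?case
    proof
      fix k
      obtain n0 where n0: "\<And>n. n0 \<le> n \<Longrightarrow> Y n \<omega> \<noteq> k"
        using elim(1)[rule_format, of k] by (auto simp: eventually_sequentially)
      \<comment> \<open>\<open>c\<close> dominates the path up to \<open>n0\<close>, so a time at
        which the path exceeds \<open>c\<close> comes after the last possible visit to
        \<open>k\<close>.\<close>
      define c where "c = Max (insert k ((\<lambda>j. Y j \<omega>) ` {..n0}))"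
      obtain n1 where n1: "c + 1 \<le> Y n1 \<omega>" using elim(2) by blast
      have c: "k \<le> c" "\<And>j. j \<le> n0 \<Longrightarrow> Y j \<omega> \<le> c"
        unfolding c_def by (rule Max_ge; simp)+
      have "n0 \<le> n1" using c(2)[of n1] n1 by (cases "n0 \<le> n1") auto
      have "k < Y n \<omega>" if "n1 \<le> n" for n
        using that
      proof (induction n rule: dec_induct)
        case base
        then show ?case using n1 c by simp
      next
        case (step n)
        then show ?case using n0[of "Suc n"] elim(3)[rule_format, of n] \<open>n0 \<le> n1\<close> by auto
      qed
      then show "eventually (\<lambda>n. k \<le> Y n \<omega>) sequentially"
        by (auto simp: eventually_sequentially intro!: exI[of _ n1] less_imp_le)
    qed
  qed
qed

end

section \<open>Second moments of corrected functions of the walk, and reflection\<close>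

context bd_walk
begin

text \<open>\<open>b\<close> is the one-step drift of \<open>h\<close>, so \<open>D\<close> is a
  martingale. Its increments are at most \<open>2 * B\<close>, one \<open>B\<close> for the move of
  \<open>h\<close> and one for \<open>b\<close>; their orthogonality gives the second moment
  \<open>(2 * B)^2 * n\<close>.\<close>

lemma corrector_L2:
  assumes g: "\<And>x. \<bar>g x\<bar> \<le> B" and h: "\<And>x. h (x + 1) - h x = g x"
    and b: "\<And>x. b x = w x * g x - (1 - w x) * g (x - 1)"
  defines "D \<equiv> \<lambda>n \<omega>. h (Y n \<omega>) - h x0 - (\<Sum>k<n. b (Y k \<omega>))"
  shows "integrable N (\<lambda>\<omega>. (D n \<omega>)\<^sup>2)" (is ?int)
    and "expectation (\<lambda>\<omega>. (D n \<omega>)\<^sup>2) \<le> 4 * B\<^sup>2 * real n" (is ?bound)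
    and "AE \<omega> in N. \<forall>n. \<bar>D (Suc n) \<omega> - D n \<omega>\<bar> \<le> 2 * B" (is ?lip)
proof -
  have B: "0 \<le> B" using g[of 0] by linarith
  have [measurable]: "D n \<in> borel_measurable N" for n unfolding D_def by measurable
  have det: "det_by N Y {0..n} (D n)" for n
    unfolding D_def
    by (intro det_by_comp2[where f = "(-)"] det_by_comp[where f = h] det_by_comp[where f = b]
        det_by_sum det_by_coord det_by_const) auto
  have b_bound: "\<bar>b x\<bar> \<le> B" for x
  proof -
    have "\<bar>b x\<bar> \<le> w x * \<bar>g x\<bar> + (1 - w x) * \<bar>g (x - 1)\<bar>"
      unfolding b using w_pos[of x] w_lt1[of x] by (simp add: abs_mult abs_triangle_ineq4[THEN order_trans])
    also have "\<dots> \<le> w x * B + (1 - w x) * B"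
      using w_pos[of x] w_lt1[of x] g by (intro add_mono mult_left_mono) auto
    finally show ?thesis by (simp add: algebra_simps)
  qed
  have D_Suc: "D (Suc n) \<omega> = D n \<omega> + (h (Y (Suc n) \<omega>) - h (Y n \<omega>) - b (Y n \<omega>))" for n \<omega>
    by (simp add: D_def)
  have incr: "AE \<omega> in N. \<forall>n. \<bar>h (Y (Suc n) \<omega>) - h (Y n \<omega>) - b (Y n \<omega>)\<bar> \<le> 2 * B"
    using nearest_neighbour
  proof eventually_elim
    case (elim \<omega>)
    show ?case
    proof
      fix n
      have "\<bar>h (Y (Suc n) \<omega>) - h (Y n \<omega>)\<bar> \<le> B"
        using elim[rule_format, of n] h[of "Y n \<omega>"] h[of "Y n \<omega> - 1"] g[of "Y n \<omega>"] g[of "Y n \<omega> - 1"]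
        by auto
      then show "\<bar>h (Y (Suc n) \<omega>) - h (Y n \<omega>) - b (Y n \<omega>)\<bar> \<le> 2 * B"
        using b_bound[of "Y n \<omega>"] by linarith
    qed
  qed
  then show ?lip by (simp add: D_Suc)
  have int2: "integrable N (\<lambda>\<omega>. (D n \<omega>)\<^sup>2)" for n
    by (rule past_integrable[of n]) (auto intro: det_by_comp[where f = "\<lambda>x. x\<^sup>2", OF det])
  then show ?int .
  show ?bound
  proof (induction n)
    case 0
    have "expectation (\<lambda>\<omega>. (D 0 \<omega>)\<^sup>2) = expectation (\<lambda>\<omega>. 0)"
    proof (rule integral_cong_AE)
      show "AE \<omega> in N. (D 0 \<omega>)\<^sup>2 = 0" using start by eventually_elim (simp add: D_def)
    qed measurable
    then show ?case by simp
  next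
    case (Suc n)
    define d where "d \<omega> = h (Y (Suc n) \<omega>) - h (Y n \<omega>) - b (Y n \<omega>)" for \<omega>
    have [measurable]: "d \<in> borel_measurable N" unfolding d_def by measurable
    have det': "det_by N Y {0..Suc n} (D n)" by (rule det_by_mono[OF det]) auto
    have detd: "det_by N Y {0..Suc n} d" unfolding d_def
      by (intro det_by_comp2[where f = "(-)"] det_by_comp[where f = h] det_by_comp[where f = b] det_by_coord) auto
    have intDh: "integrable N (\<lambda>\<omega>. D n \<omega> * f (Y k \<omega>))" if "k \<le> Suc n" for f k
      by (rule past_integrable[of "Suc n"])
         (use that det' in \<open>auto intro!: det_by_comp2[where f = "(*)"] det_by_comp[where f = f] det_by_coord\<close>)
    have intd: "integrable N (\<lambda>\<omega>. (d \<omega>)\<^sup>2)"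
      by (rule past_integrable[of "Suc n"]) (auto intro: det_by_comp[where f = "\<lambda>x. x\<^sup>2", OF detd])
    have intDd: "integrable N (\<lambda>\<omega>. D n \<omega> * d \<omega>)"
      by (rule past_integrable[of "Suc n"]) (use detd det' in \<open>auto intro: det_by_comp2[where f = "(*)"]\<close>)
    have "expectation (\<lambda>\<omega>. D n \<omega> * h (Y (Suc n) \<omega>)) = expectation (\<lambda>\<omega>. D n \<omega> *
        (w (Y n \<omega>) * h (Y n \<omega> + 1) + (1 - w (Y n \<omega>)) * h (Y n \<omega> - 1)))"
      by (intro step det) measurable
    also have "\<dots> = expectation (\<lambda>\<omega>. D n \<omega> * (h (Y n \<omega>) + b (Y n \<omega>)))"
    proof -
      have "w x * h (x + 1) + (1 - w x) * h (x - 1) = h x + b x" for x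
      proof -
        have "h (x + 1) = h x + g x" "h (x - 1) = h x - g (x - 1)" using h[of x] h[of "x - 1"] by auto
        show ?thesis unfolding \<open>h (x + 1) = h x + g x\<close> \<open>h (x - 1) = h x - g (x - 1)\<close> b by algebra
      qed
      then show ?thesis by simp
    qed
    finally have "expectation (\<lambda>\<omega>. D n \<omega> * h (Y (Suc n) \<omega>)) - expectation (\<lambda>\<omega>. D n \<omega> * (h (Y n \<omega>) + b (Y n \<omega>))) = 0"
      by simp
    also have "expectation (\<lambda>\<omega>. D n \<omega> * h (Y (Suc n) \<omega>)) - expectation (\<lambda>\<omega>. D n \<omega> * (h (Y n \<omega>) + b (Y n \<omega>)))
        = expectation (\<lambda>\<omega>. D n \<omega> * d \<omega>)"
      by (subst Bochner_Integration.integral_diff[symmetric])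
         (use intDh[of "Suc n" h] intDh[of n "\<lambda>x. h x + b x"] in \<open>auto simp: d_def algebra_simps\<close>)
    finally have cross: "expectation (\<lambda>\<omega>. D n \<omega> * d \<omega>) = 0" .
    have "expectation (\<lambda>\<omega>. (D (Suc n) \<omega>)\<^sup>2) = expectation (\<lambda>\<omega>. (D n \<omega>)\<^sup>2 + 2 * (D n \<omega> * d \<omega>) + (d \<omega>)\<^sup>2)"
      by (intro Bochner_Integration.integral_cong refl) (simp add: D_Suc d_def[symmetric] power2_sum)
    also have "\<dots> = expectation (\<lambda>\<omega>. (D n \<omega>)\<^sup>2) + expectation (\<lambda>\<omega>. (d \<omega>)\<^sup>2)"
      using int2[of n] intd intDd cross by simp
    also have "expectation (\<lambda>\<omega>. (d \<omega>)\<^sup>2) \<le> expectation (\<lambda>\<omega>. (2 * B)\<^sup>2)"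
    proof (rule integral_mono_AE[OF intd])
      show "AE \<omega> in N. (d \<omega>)\<^sup>2 \<le> (2 * B)\<^sup>2"
        using incr by eventually_elim (use B in \<open>simp only: d_def power2_le_iff_abs_le\<close>)
    qed simp
    finally show ?case using Suc by (simp add: prob_space algebra_simps power2_eq_square)
  qed
qed

lemma reflect: "bd_walk N (\<lambda>n \<omega>. - Y n \<omega>) (\<lambda>x. 1 - w (- x)) (- x0)"
proof
  show "(\<lambda>\<omega>. - Y n \<omega>) \<in> N \<rightarrow>\<^sub>M count_space UNIV" for n by measurable
  show "0 < 1 - w (- x)" "1 - w (- x) < 1" for x using w_pos w_lt1 by auto
  show "AE \<omega> in N. - Y 0 \<omega> = - x0" using start by eventually_elim simp
  show "is_markov_chain N (\<lambda>n \<omega>. - Y n \<omega>) (bd_trans (\<lambda>x. 1 - w (- x)))"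
    unfolding is_markov_chain_def
  proof (intro allI impI)
    fix r t :: nat and s y
    assume rt: "r \<le> t" and pos: "0 < prob {\<omega>\<in>space N. \<forall>j\<in>{r..t}. - Y j \<omega> = s j}"
    have eq: "- (a::int) = b \<longleftrightarrow> a = - b" for a b by auto
    have "cond_prob N (\<lambda>\<omega>. Y (t+1) \<omega> = - y) (\<lambda>\<omega>. \<forall>j\<in>{r..t}. Y j \<omega> = - s j) = bd_trans w (- s t) (- y)"
      using chain[unfolded is_markov_chain_def, rule_format, of r t "\<lambda>j. - s j" "- y"] rt pos
      by (simp add: eq)
    then show "cond_prob N (\<lambda>\<omega>. - Y (t+1) \<omega> = y) (\<lambda>\<omega>. \<forall>j\<in>{r..t}. - Y j \<omega> = s j)
        = bd_trans (\<lambda>x. 1 - w (- x)) (s t) y"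
      by (simp add: eq bd_trans_def)
  qed
qed

end

section \<open>The Markov environment\<close>

text \<open>Transition operator of the environment chain. Every \<open>v\<close> other than 1 is
  treated as -1, so identities and inequalities for it hold for all integers
  \<open>v\<close>.\<close>

definition env_op :: "real \<Rightarrow> real \<Rightarrow> (int \<Rightarrow> real) \<Rightarrow> int \<Rightarrow> real" where
  "env_op a b f v = (if v = 1 then b * f (-1) + (1 - b) * f 1 else (1 - a) * f (-1) + a * f 1)"

lemma env_op_scale: "env_op a b (\<lambda>v. c * f v) v = c * env_op a b f v"
  by (simp add: env_op_def algebra_simps)

definition env_mean :: "real \<Rightarrow> real \<Rightarrow> (int \<Rightarrow> real) \<Rightarrow> real" where
  "env_mean a b f = (b * f (-1) + a * f 1) / (a + b)"

text \<open>Stationarity is recorded only as the one-site law \<open>marginal\<close>; together with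
  the transition probabilities it determines every cylinder probability of the two-sided
  chain.\<close>

locale markov_env = prob_space L for L :: "'w measure" +
  fixes U :: "int \<Rightarrow> 'w \<Rightarrow> int" and a b :: real
  assumes ab: "0 < a" "a < 1" "0 < b" "b < 1"
    and U_meas [measurable]: "U i \<in> L \<rightarrow>\<^sub>M count_space UNIV"
    and U_val: "\<omega> \<in> space L \<Longrightarrow> U i \<omega> = -1 \<or> U i \<omega> = 1"
    and marginal: "prob {\<omega>\<in>space L. U i \<omega> = 1} = a / (a + b)"
    and env_chain: "is_markov_chain L U (env_trans a b)"
begin

lemma U_in: "AE \<omega> in L. U j \<omega> \<in> {-1, 1}"
  using AE_space by eventually_elim (use U_val in blast)

lemma env_integrable:
  fixes Z :: "'w \<Rightarrow> real"
  assumes "det_by L U {r..t} Z" "Z \<in> borel_measurable L"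
  shows "integrable L Z"
  by (rule det_by_integrable[where X = U and J = "{r..t}" and S = "{-1, 1}"])
     (use assms U_in in auto)

text \<open>The function applied to the new coordinate may itself depend on the past. This is what
  the chain of pairs (environment value, partial sum) requires in \<open>above_step\<close>.\<close>

lemma env_step2:
  fixes G :: "int \<Rightarrow> 'w \<Rightarrow> real"
  assumes rt: "r \<le> t" and G: "\<And>y. det_by L U {r..t} (G y)" and [measurable]: "\<And>y. G y \<in> borel_measurable L"
  shows "expectation (\<lambda>\<omega>. G (U (t + 1) \<omega>) \<omega>) = expectation (\<lambda>\<omega>. env_op a b (\<lambda>y. G y \<omega>) (U t \<omega>))"
proof -
  define K where "K v y = env_trans a b v y" for v y
  have 1: "expectation (\<lambda>\<omega>. G y \<omega> * of_bool (U (t + 1) \<omega> = y)) = expectation (\<lambda>\<omega>. G y \<omega> * K (U t \<omega>) y)"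
    if "y \<in> {-1, 1}" for y
  proof -
    have "expectation (\<lambda>\<omega>. G y \<omega> * of_bool (U (t + 1) \<omega> = y)) =
        expectation (\<lambda>\<omega>. G y \<omega> * (\<Sum>z\<in>{-1, 1}. K (U t \<omega>) z * of_bool (z = y)))"
      unfolding K_def
      by (intro markov_expectation[OF env_chain rt]) (use U_in G in auto)
    also have "(\<lambda>\<omega>. \<Sum>z\<in>{-1, 1}. K (U t \<omega>) z * of_bool (z = y)) = (\<lambda>\<omega>. K (U t \<omega>) y)"
      using that by auto
    finally show ?thesis .
  qed
  have [simp]: "integrable L (\<lambda>\<omega>. G y \<omega> * of_bool (U (t + 1) \<omega> = y))" for y
    by (rule env_integrable[of r "t + 1"])
       (auto intro!: det_by_comp2[where f = "(*)"] det_by_mono[OF G] det_by_comp[where f = "\<lambda>x. of_bool (x = y)"] det_by_coord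
         simp: rt order_trans[OF rt])
  have [simp]: "integrable L (\<lambda>\<omega>. G y \<omega> * K (U t \<omega>) y)" for y
    by (rule env_integrable[of r t])
       (auto intro!: det_by_comp2[where f = "(*)"] G det_by_comp[where f = "\<lambda>x. K x y"] det_by_coord simp: rt)
  have "expectation (\<lambda>\<omega>. G (U (t + 1) \<omega>) \<omega>) =
      expectation (\<lambda>\<omega>. G (-1) \<omega> * of_bool (U (t + 1) \<omega> = -1) + G 1 \<omega> * of_bool (U (t + 1) \<omega> = 1))"
    by (intro Bochner_Integration.integral_cong refl) (use U_val[of _ "t + 1"] in force)
  also have "\<dots> = expectation (\<lambda>\<omega>. G (-1) \<omega> * K (U t \<omega>) (-1) + G 1 \<omega> * K (U t \<omega>) 1)"
    using 1 by simp
  also have "\<dots> = expectation (\<lambda>\<omega>. env_op a b (\<lambda>y. G y \<omega>) (U t \<omega>))"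
    by (intro Bochner_Integration.integral_cong refl)
       (use U_val[of _ t] in \<open>force simp: K_def env_trans_def env_op_def\<close>)
  finally show ?thesis .
qed

lemma env_step:
  fixes Z :: "'w \<Rightarrow> real"
  assumes rt: "r \<le> t" and Z: "det_by L U {r..t} Z" and [measurable]: "Z \<in> borel_measurable L"
  shows "expectation (\<lambda>\<omega>. Z \<omega> * f (U (t + 1) \<omega>)) = expectation (\<lambda>\<omega>. Z \<omega> * env_op a b f (U t \<omega>))"
proof -
  have "det_by L U {r..t} (\<lambda>\<omega>. Z \<omega> * f y)" for y
    by (rule det_by_comp[where f = "\<lambda>z. z * f y", OF Z])
  from env_step2[OF rt this] show ?thesis by (simp add: env_op_scale)
qed

lemma prob_minus: "prob {\<omega>\<in>space L. U i \<omega> = -1} = b / (a + b)"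
proof -
  have "prob {\<omega>\<in>space L. U i \<omega> = -1} = prob (space L - {\<omega>\<in>space L. U i \<omega> = 1})"
    using U_val[of _ i] by (intro arg_cong[where f = prob]) force
  also have "\<dots> = 1 - a / (a + b)" by (subst prob_compl) (auto simp: marginal)
  finally show ?thesis using ab by (simp add: field_simps)
qed

lemma expectation_U: "expectation (\<lambda>\<omega>. f (U i \<omega>)) = env_mean a b f"
proof -
  have "expectation (\<lambda>\<omega>. f (U i \<omega>)) = expectation (\<lambda>\<omega>. f (-1) * indicator {\<omega>\<in>space L. U i \<omega> = -1} \<omega>
      + f 1 * indicator {\<omega>\<in>space L. U i \<omega> = 1} \<omega>)"
    by (intro Bochner_Integration.integral_cong refl) (use U_val[of _ i] in \<open>force simp: indicator_def\<close>)
  also have "\<dots> = f (-1) * (b / (a + b)) + f 1 * (a / (a + b))"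
    by (subst Bochner_Integration.integral_add) (auto simp: marginal prob_minus emeasure_eq_measure)
  finally show ?thesis by (simp add: env_mean_def add_divide_distrib mult.commute)
qed

definition stat :: "int \<Rightarrow> real" where
  "stat v = (if v = 1 then a / (a + b) else if v = -1 then b / (a + b) else 0)"

lemma prob_U: "prob {\<omega>\<in>space L. U i \<omega> = v} = stat v"
proof -
  have "{\<omega>\<in>space L. U i \<omega> = v} = {}" if "v \<noteq> 1" "v \<noteq> -1" using U_val[of _ i] that by auto
  then have "prob {\<omega>\<in>space L. U i \<omega> = v} = 0" if "v \<noteq> 1" "v \<noteq> -1" using that by (metis measure_empty)
  then show ?thesis using marginal prob_minus by (auto simp: stat_def)
qed

lemma cylinder_prob:
  "prob {\<omega>\<in>space L. \<forall>j\<in>{r..r + int n}. U j \<omega> = s j} =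
    stat (s r) * (\<Prod>i<n. env_trans a b (s (r + int i)) (s (r + int i + 1)))"
proof (induction n)
  case 0
  have "{r..r + int 0} = {r}" by auto
  then show ?case using prob_U[of r "s r"] by simp
next
  case (Suc n)
  have "{r..r + int (Suc n)} = insert (r + int n + 1) {r..r + int n}" by auto
  then have "{\<omega>\<in>space L. \<forall>j\<in>{r..r + int (Suc n)}. U j \<omega> = s j} =
      {\<omega>\<in>space L. U (r + int n + 1) \<omega> = s (r + int n + 1) \<and> (\<forall>j\<in>{r..r + int n}. U j \<omega> = s j)}"
    by auto
  then show ?case
    using markov_joint[OF env_chain, of r "r + int n" "s (r + int n + 1)" s] Suc by (simp add: mult_ac)
qed

lemma detailed_balance: "stat v * env_trans a b v v' = stat v' * env_trans a b v' v"
proof -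
  have 1: "stat v = 0" "env_trans a b v v' = 0" "env_trans a b v' v = 0" if "v \<noteq> 1" "v \<noteq> -1" for v v'
    using that by (simp_all add: stat_def env_trans_def)
  have 2: "stat 1 * env_trans a b 1 (-1) = stat (-1) * env_trans a b (-1) 1"
    by (simp add: stat_def env_trans_def)
  consider "v \<noteq> 1" "v \<noteq> -1" | "v' \<noteq> 1" "v' \<noteq> -1" | "v = v'" | "v = 1" "v' = -1" | "v = -1" "v' = 1"
    by blast
  then show ?thesis using 1 2 by cases simp_all
qed

text \<open>Detailed balance lets the transition product of a cylinder be read from right to left.
  It is needed because a passage time to the right depends on the environment to the left of the
  walker.\<close>

lemma env_reverse: "markov_env L (\<lambda>i. U (- i)) a b"
proof
  show "is_markov_chain L (\<lambda>i. U (- i)) (env_trans a b)"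
    unfolding is_markov_chain_def
  proof (intro allI impI)
    fix r t :: int and s y
    assume rt: "r \<le> t" and pos: "0 < prob {\<omega>\<in>space L. \<forall>j\<in>{r..t}. U (- j) \<omega> = s j}"
    define n where "n = nat (t - r)"
    \<comment> \<open>\<open>s\<close> read backwards, with the new value \<open>y\<close> placed at
      the site \<open>- t - 1\<close>; the joint event becomes a cylinder that starts one site
      earlier.\<close>
    define s' where "s' j = (if j = - t - 1 then y else s (- j))" for j
    have n: "- r = - t + int n" using rt by (simp add: n_def)
    define T where "T = (\<Prod>i<n. env_trans a b (s' (- t + int i)) (s' (- t + int i + 1)))"
    have ball: "(\<forall>j\<in>{r..t}. U (- j) \<omega> = s j) \<longleftrightarrow> (\<forall>j\<in>{- t..- t + int n}. U j \<omega> = s' j)" for \<omega>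
    proof safe
      fix j assume "\<forall>j\<in>{r..t}. U (- j) \<omega> = s j" "j \<in> {- t..- t + int n}"
      then show "U j \<omega> = s' j" using n by (auto simp: s'_def dest!: bspec[of _ _ "- j"])
    next
      fix j assume "\<forall>j\<in>{- t..- t + int n}. U j \<omega> = s' j" "j \<in> {r..t}"
      then show "U (- j) \<omega> = s j" using n by (auto simp: s'_def dest!: bspec[of _ _ "- j"])
    qed
    have ball': "U (- (t + 1)) \<omega> = y \<and> (\<forall>j\<in>{r..t}. U (- j) \<omega> = s j) \<longleftrightarrow>
        (\<forall>j\<in>{- t - 1..- t - 1 + int (Suc n)}. U j \<omega> = s' j)" for \<omega>
    proof -
      have "{- t - 1..- t - 1 + int (Suc n)} = insert (- t - 1) {- t..- t + int n}" by auto
      then show ?thesis unfolding ball by (simp add: s'_def)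
    qed
    have p: "prob {\<omega>\<in>space L. \<forall>j\<in>{r..t}. U (- j) \<omega> = s j} = stat (s t) * T"
      unfolding ball using cylinder_prob[of "- t" n s'] by (simp add: T_def s'_def)
    have "(\<Prod>i<Suc n. env_trans a b (s' (- t - 1 + int i)) (s' (- t - 1 + int i + 1))) =
        env_trans a b (s' (- t - 1)) (s' (- t)) * T"
      unfolding prod.lessThan_Suc_shift T_def
      by (intro arg_cong2[where f = "(*)"] prod.cong refl) (simp_all add: algebra_simps)
    moreover have "s' (- t - 1) = y" "s' (- t) = s t" by (simp_all add: s'_def)
    ultimately
    have "prob {\<omega>\<in>space L. U (- (t + 1)) \<omega> = y \<and> (\<forall>j\<in>{r..t}. U (- j) \<omega> = s j)} = stat y * (env_trans a b y (s t) * T)"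
      unfolding ball' cylinder_prob by simp
    also have "\<dots> = env_trans a b (s t) y * (stat (s t) * T)"
      using detailed_balance[of y "s t"] by (simp add: mult_ac)
    finally have joint: "prob {\<omega>\<in>space L. U (- (t + 1)) \<omega> = y \<and> (\<forall>j\<in>{r..t}. U (- j) \<omega> = s j)} =
        env_trans a b (s t) y * (stat (s t) * T)" .
    show "cond_prob L (\<lambda>\<omega>. U (- (t + 1)) \<omega> = y) (\<lambda>\<omega>. \<forall>j\<in>{r..t}. U (- j) \<omega> = s j) = env_trans a b (s t) y"
      using pos unfolding cond_prob_def p joint by (metis less_irrefl nonzero_mult_div_cancel_right)
  qed
qed (use ab U_val marginal in auto)

lemma env_negate: "markov_env L (\<lambda>i \<omega>. - U i \<omega>) b a"
proof
  have eq: "- (x::int) = y \<longleftrightarrow> x = - y" for x y by auto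
  show "is_markov_chain L (\<lambda>i \<omega>. - U i \<omega>) (env_trans b a)"
    unfolding is_markov_chain_def
  proof (intro allI impI)
    fix r t :: int and s y
    assume rt: "r \<le> t" and pos: "0 < prob {\<omega>\<in>space L. \<forall>j\<in>{r..t}. - U j \<omega> = s j}"
    have "cond_prob L (\<lambda>\<omega>. U (t+1) \<omega> = - y) (\<lambda>\<omega>. \<forall>j\<in>{r..t}. U j \<omega> = - s j) = env_trans a b (- s t) (- y)"
      using env_chain[unfolded is_markov_chain_def, rule_format, of r t "\<lambda>j. - s j" "- y"] rt pos
      by (simp add: eq)
    moreover have "env_trans a b (- s t) (- y) = env_trans b a (s t) y"
      by (simp add: env_trans_def eq)
    ultimately show "cond_prob L (\<lambda>\<omega>. - U (t+1) \<omega> = y) (\<lambda>\<omega>. \<forall>j\<in>{r..t}. - U j \<omega> = s j) = env_trans b a (s t) y"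
      by (simp add: eq)
  qed
  show "prob {\<omega> \<in> space L. - U i \<omega> = 1} = b / (b + a)" for i
    using prob_minus[of i] by (simp add: eq add.commute)
  show "- U i \<omega> = -1 \<or> - U i \<omega> = 1" if "\<omega> \<in> space L" for i \<omega> using U_val[OF that, of i] by auto
qed (use ab in auto)

definition \<mu> :: real where "\<mu> = (a - b) / (a + b)"

lemma mu_bound: "\<bar>\<mu>\<bar> \<le> 1"
  using ab by (simp add: \<mu>_def abs_le_iff field_simps)

definition S :: "int \<Rightarrow> nat \<Rightarrow> 'w \<Rightarrow> real" where
  "S c n \<omega> = (\<Sum>x\<in>{c..<c + int n}. of_int (U x \<omega>) - \<mu>)"

lemma S_measurable [measurable]: "S c n \<in> borel_measurable L"
  unfolding S_def by measurable

lemma S_det: "det_by L U {c..c + int n} (S c n)"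
  unfolding S_def
  by (intro det_by_sum det_by_comp[where f = "\<lambda>x. of_int x - \<mu>"] det_by_coord) auto

lemma S_Suc: "S c (Suc n) \<omega> = S c n \<omega> + (of_int (U (c + int n) \<omega>) - \<mu>)"
proof -
  have "{c..<c + int (Suc n)} = insert (c + int n) {c..<c + int n}" by auto
  then show ?thesis by (simp add: S_def)
qed

definition S_var :: real where "S_var = 8 / (1 - \<bar>1 - a - b\<bar>) + 4"

text \<open>The centred coordinate is an eigenfunction of \<open>env_op\<close> with eigenvalue
  \<open>1 - a - b\<close>, of modulus below one. The covariance of the sum with its next term
  therefore obeys a contracting recursion and stays bounded, so the variance grows at most
  linearly.\<close>

lemma S_variance:
  shows "integrable L (\<lambda>\<omega>. (S c n \<omega>)\<^sup>2)"
    and "expectation (\<lambda>\<omega>. (S c n \<omega>)\<^sup>2) \<le> S_var * real n"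
proof -
  define l where "l = 1 - a - b"
  have l: "\<bar>l\<bar> < 1" using ab by (simp add: l_def abs_less_iff)
  \<comment> \<open>Chosen with \<open>C * (1 - \<bar>l\<bar>) = 4\<close>, where 4 bounds the
    second moment of a centred coordinate; then the bound \<open>C\<close> reproduces itself under
    the recursion.\<close>
  define C where "C = 4 / (1 - \<bar>l\<bar>)"
  have C: "\<bar>l\<bar> * (C + 4) \<le> C" "0 \<le> C"
  proof -
    have "C * (1 - \<bar>l\<bar>) = 4" using C_def l by (simp only: eq_divide_eq)
    then show "\<bar>l\<bar> * (C + 4) \<le> C" using l by (simp add: algebra_simps)
    show "0 \<le> C" using l by (simp add: C_def)
  qed
  define ub where "ub i \<omega> = of_int (U i \<omega>) - \<mu>" for i \<omega>
  have [measurable]: "ub i \<in> borel_measurable L" for i unfolding ub_def by measurable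
  have ub_bound: "\<bar>ub i \<omega>\<bar> \<le> 2" if "\<omega> \<in> space L" for i \<omega>
    using U_val[OF that, of i] mu_bound by (auto simp: ub_def)
  have op: "env_op a b (\<lambda>v. of_int v - \<mu>) v = l * (of_int v - \<mu>)" if "v = -1 \<or> v = 1" for v
  proof -
    have "(a + b) * \<mu> = a - b" using ab by (simp add: \<mu>_def)
    then show ?thesis using that by (auto simp: env_op_def l_def algebra_simps)
  qed
  have det_ub: "det_by L U {c..c + int n} (ub i)" if "c \<le> i" "i \<le> c + int n" for i n
    unfolding ub_def using that by (intro det_by_comp[where f = "\<lambda>x. of_int x - \<mu>"] det_by_coord) auto
  have int_Sub: "integrable L (\<lambda>\<omega>. S c n \<omega> * ub (c + int n) \<omega>)" for n
    by (rule env_integrable[of c "c + int n"]) (auto intro!: det_by_comp2[where f = "(*)"] S_det det_ub)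
  have int_ub2: "integrable L (\<lambda>\<omega>. (ub (c + int n) \<omega>)\<^sup>2)" for n
    by (rule env_integrable[of c "c + int n"]) (auto intro!: det_by_comp[where f = "\<lambda>x. x\<^sup>2"] det_ub)
  have int_S2: "integrable L (\<lambda>\<omega>. (S c n \<omega>)\<^sup>2)" for n
    by (rule env_integrable[of c "c + int n"]) (auto intro!: det_by_comp[where f = "\<lambda>x. x\<^sup>2"] S_det)
  then show "integrable L (\<lambda>\<omega>. (S c n \<omega>)\<^sup>2)" .
  have ub2: "0 \<le> expectation (\<lambda>\<omega>. (ub (c + int n) \<omega>)\<^sup>2)" "expectation (\<lambda>\<omega>. (ub (c + int n) \<omega>)\<^sup>2) \<le> 4" for n
  proof -
    have "expectation (\<lambda>\<omega>. (ub (c + int n) \<omega>)\<^sup>2) \<le> expectation (\<lambda>\<omega>. 4)"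
    proof (rule integral_mono[OF int_ub2])
      show "(ub (c + int n) \<omega>)\<^sup>2 \<le> 4" if "\<omega> \<in> space L" for \<omega>
        using ub_bound[OF that, of "c + int n"] power2_le_iff_abs_le[of 2 "ub (c + int n) \<omega>"] by simp
    qed simp
    then show "expectation (\<lambda>\<omega>. (ub (c + int n) \<omega>)\<^sup>2) \<le> 4" by (simp add: prob_space)
  qed simp
  have T: "\<bar>expectation (\<lambda>\<omega>. S c n \<omega> * ub (c + int n) \<omega>)\<bar> \<le> C" for n
  proof (induction n)
    case 0
    show ?case using C by (simp add: S_def)
  next
    case (Suc n)
    have "expectation (\<lambda>\<omega>. S c (Suc n) \<omega> * ub (c + int (Suc n)) \<omega>) =
        expectation (\<lambda>\<omega>. S c (Suc n) \<omega> * ub (c + int n + 1) \<omega>)" by (simp add: add_ac)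
    also have "\<dots> = expectation (\<lambda>\<omega>. S c (Suc n) \<omega> * env_op a b (\<lambda>v. of_int v - \<mu>) (U (c + int n) \<omega>))"
      unfolding ub_def
    proof (rule env_step[of c])
      have "det_by L U {c..c + int n} (\<lambda>\<omega>. S c n \<omega> + ub (c + int n) \<omega>)"
        by (intro det_by_comp2[where f = "(+)"] S_det det_ub) auto
      then show "det_by L U {c..c + int n} (S c (Suc n))" by (simp add: S_Suc[abs_def] ub_def)
    qed auto
    also have "\<dots> = expectation (\<lambda>\<omega>. l * (S c n \<omega> * ub (c + int n) \<omega> + (ub (c + int n) \<omega>)\<^sup>2))"
      by (intro Bochner_Integration.integral_cong refl)
         (use U_val in \<open>simp add: op S_Suc ub_def algebra_simps power2_eq_square\<close>)
    also have "\<dots> = l * (expectation (\<lambda>\<omega>. S c n \<omega> * ub (c + int n) \<omega>) + expectation (\<lambda>\<omega>. (ub (c + int n) \<omega>)\<^sup>2))"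
      using int_Sub int_ub2 by simp
    also have "\<bar>\<dots>\<bar> \<le> \<bar>l\<bar> * (C + 4)"
      unfolding abs_mult by (rule mult_left_mono) (use Suc ub2[of n] in linarith, simp)
    finally show ?case using C by linarith
  qed
  show "expectation (\<lambda>\<omega>. (S c n \<omega>)\<^sup>2) \<le> S_var * real n"
  proof (induction n)
    case (Suc n)
    have "expectation (\<lambda>\<omega>. (S c (Suc n) \<omega>)\<^sup>2) =
        expectation (\<lambda>\<omega>. (S c n \<omega>)\<^sup>2 + 2 * (S c n \<omega> * ub (c + int n) \<omega>) + (ub (c + int n) \<omega>)\<^sup>2)"
      by (intro Bochner_Integration.integral_cong refl) (simp add: S_Suc ub_def power2_sum)
    also have "\<dots> = expectation (\<lambda>\<omega>. (S c n \<omega>)\<^sup>2) + 2 * expectation (\<lambda>\<omega>. S c n \<omega> * ub (c + int n) \<omega>)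
        + expectation (\<lambda>\<omega>. (ub (c + int n) \<omega>)\<^sup>2)"
      using int_Sub int_ub2 int_S2 by simp
    also have "\<dots> \<le> S_var * real n + (2 * C + 4)" using Suc T[of n] ub2[of n] by linarith
    also have "2 * C + 4 = S_var" by (simp add: C_def S_var_def l_def)
    finally show ?case by (simp add: algebra_simps)
  qed (simp add: S_def)
qed

theorem env_lln: "AE \<omega> in L. (\<lambda>n. (\<Sum>x\<in>{1..int n}. of_int (U x \<omega>)) / real n) \<longlonglongrightarrow> \<mu>"
proof -
  have "AE \<omega> in L. (\<lambda>n. S 1 n \<omega> / real n) \<longlonglongrightarrow> 0"
  proof (rule lipschitz_lln[OF _ S_variance])
    show "AE \<omega> in L. \<forall>n. \<bar>S 1 (Suc n) \<omega> - S 1 n \<omega>\<bar> \<le> 2"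
      using AE_space
    proof eventually_elim
      case (elim \<omega>)
      have "\<bar>of_int (U i \<omega>) - \<mu>\<bar> \<le> 2" for i using U_val[OF elim, of i] mu_bound by auto
      then show ?case by (simp add: S_Suc)
    qed
  qed measurable
  then show ?thesis
  proof eventually_elim
    case (elim \<omega>)
    have "{1..<1 + int n} = {1..int n}" for n by auto
    then have "S 1 n \<omega> = (\<Sum>x\<in>{1..int n}. of_int (U x \<omega>)) - real n * \<mu>" for n
      by (simp add: S_def sum_subtractf)
    then have eq: "S 1 n \<omega> / real n + \<mu> = (\<Sum>x\<in>{1..int n}. of_int (U x \<omega>)) / real n" if "n > 0" for n
      using that by (simp add: field_simps)
    have "(\<lambda>n. S 1 n \<omega> / real n + \<mu>) \<longlonglongrightarrow> 0 + \<mu>" by (intro tendsto_add elim tendsto_const)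
    then have "(\<lambda>n. S 1 n \<omega> / real n + \<mu>) \<longlonglongrightarrow> \<mu>" by simp
    then show ?case
      by (rule Lim_transform_eventually) (use eventually_gt_at_top[of 0] in \<open>eventually_elim, use eq in auto\<close>)
  qed
qed

end

section \<open>Truncated passage times\<close>

text \<open>Looks to the right, in the direction of the chain property. The quantity of the walk
  looks to the left and is recovered by reflection in \<open>trunc_passage\<close>.\<close>

primrec trunc_passage_fwd :: "(int \<Rightarrow> real) \<Rightarrow> nat \<Rightarrow> int \<Rightarrow> real" where
  "trunc_passage_fwd r 0 x = 0"
| "trunc_passage_fwd r (Suc K) x = 1 + r x + r x * trunc_passage_fwd r K (x + 1)"

text \<open>Conditional mean of \<open>trunc_passage_fwd\<close> at a site whose environment value
  is \<open>v\<close>, for weights that are \<open>\<rho>\<close> of the environment;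
  \<open>F_cond\<close> justifies this reading.\<close>

primrec trunc_passage_cond :: "real \<Rightarrow> real \<Rightarrow> (int \<Rightarrow> real) \<Rightarrow> nat \<Rightarrow> int \<Rightarrow> real" where
  "trunc_passage_cond a b \<rho> 0 = (\<lambda>v. 0)"
| "trunc_passage_cond a b \<rho> (Suc K) = (\<lambda>v. 1 + \<rho> v + \<rho> v * env_op a b (trunc_passage_cond a b \<rho> K) v)"

definition trunc_passage_mean :: "real \<Rightarrow> real \<Rightarrow> (int \<Rightarrow> real) \<Rightarrow> nat \<Rightarrow> real" where
  "trunc_passage_mean a b \<rho> K = env_mean a b (trunc_passage_cond a b \<rho> K)"

locale env_rho = markov_env +
  fixes \<rho> :: "int \<Rightarrow> real" and R :: real
  assumes rho_pos: "0 < \<rho> v" and rho_le: "\<rho> 1 + 2 \<le> R" "\<rho> (-1) + 2 \<le> R"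
begin

definition F :: "nat \<Rightarrow> int \<Rightarrow> 'a \<Rightarrow> real" where
  "F K x \<omega> = trunc_passage_fwd (\<lambda>y. \<rho> (U y \<omega>)) K x"

lemma F_0: "F 0 x \<omega> = 0"
  by (simp add: F_def)

lemma F_Suc: "F (Suc K) x \<omega> = 1 + \<rho> (U x \<omega>) + \<rho> (U x \<omega>) * F K (x + 1) \<omega>"
  by (simp add: F_def)

lemma F_measurable [measurable]: "F K x \<in> borel_measurable L"
proof (induction K arbitrary: x)
  case 0
  show ?case by (simp add: F_0[abs_def])
next
  case (Suc K)
  note [measurable] = Suc
  show ?case unfolding F_Suc[abs_def] by measurable
qed

lemma F_det: "det_by L U {x..x + int K} (F K x)"
proof (induction K arbitrary: x)
  case 0
  show ?case by (simp add: F_0[abs_def])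
next
  case (Suc K)
  have 1: "det_by L U {x..x + int (Suc K)} (\<lambda>\<omega>. \<rho> (U x \<omega>))"
    by (intro det_by_comp[where f = \<rho>] det_by_coord) auto
  have 2: "det_by L U {x..x + int (Suc K)} (F K (x + 1))"
    by (rule det_by_mono[OF Suc]) auto
  show ?case unfolding F_Suc[abs_def]
    by (rule det_by_comp2[where f = "\<lambda>p q. 1 + p + p * q", OF 1 2])
qed

lemma R_ge: "2 \<le> R"
  using rho_le(1) rho_pos[of 1] by linarith

text \<open>The bound \<open>R ^ K - 1\<close> is inductive because \<open>R\<close> exceeds the
  weight by at least 2, so that \<open>(R - \<rho> v) * R ^ K\<close> is at least 2.\<close>

lemma recursion_bound:
  assumes "v = -1 \<or> v = 1" "0 \<le> z" "z \<le> R ^ K - 1"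
  shows "0 \<le> 1 + \<rho> v + \<rho> v * z \<and> 1 + \<rho> v + \<rho> v * z \<le> R ^ Suc K - 1"
proof
  have pos: "0 < \<rho> v" by (rule rho_pos)
  then show "0 \<le> 1 + \<rho> v + \<rho> v * z" using assms(2) by simp
  have le: "\<rho> v + 2 \<le> R" using assms(1) rho_le by auto
  have RK: "1 \<le> R ^ K" using R_ge by (intro one_le_power) simp
  have "2 * 1 \<le> (R - \<rho> v) * R ^ K" using le RK by (intro mult_mono) auto
  moreover have "\<rho> v * z \<le> \<rho> v * (R ^ K - 1)" using assms(3) pos by (intro mult_left_mono) auto
  ultimately show "1 + \<rho> v + \<rho> v * z \<le> R ^ Suc K - 1" by (simp add: algebra_simps)
qed

lemma F_bounds: "\<omega> \<in> space L \<Longrightarrow> 0 \<le> F K x \<omega> \<and> F K x \<omega> \<le> R ^ K - 1"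
proof (induction K arbitrary: x)
  case (Suc K)
  show ?case unfolding F_Suc
    using U_val[OF Suc.prems, of x] Suc.IH[OF Suc.prems, of "x + 1"] by (intro recursion_bound) auto
qed (simp add: F_0)

lemma env_op_mono_bounds:
  assumes "\<And>v. v = -1 \<or> v = 1 \<Longrightarrow> l \<le> f v \<and> f v \<le> u"
  shows "l \<le> env_op a b f v \<and> env_op a b f v \<le> u"
proof -
  have f: "l \<le> f 1" "f 1 \<le> u" "l \<le> f (-1)" "f (-1) \<le> u" using assms by auto
  have conv: "l \<le> t * f (-1) + (1 - t) * f 1 \<and> t * f (-1) + (1 - t) * f 1 \<le> u"
    if "0 \<le> t" "t \<le> 1" for t :: real
  proof -
    have "t * l + (1 - t) * l \<le> t * f (-1) + (1 - t) * f 1"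
      "t * f (-1) + (1 - t) * f 1 \<le> t * u + (1 - t) * u"
      using that f by (intro add_mono mult_left_mono; simp)+
    then show ?thesis by (simp add: algebra_simps)
  qed
  show ?thesis using conv[of b] conv[of "1 - a"] ab by (auto simp: env_op_def)
qed

lemma trunc_passage_cond_bounds: "v = -1 \<or> v = 1 \<Longrightarrow> 0 \<le> trunc_passage_cond a b \<rho> K v \<and> trunc_passage_cond a b \<rho> K v \<le> R ^ K - 1"
proof (induction K arbitrary: v)
  case (Suc K)
  have "0 \<le> env_op a b (trunc_passage_cond a b \<rho> K) v \<and> env_op a b (trunc_passage_cond a b \<rho> K) v \<le> R ^ K - 1"
    by (rule env_op_mono_bounds) (rule Suc.IH)
  then show ?case unfolding trunc_passage_cond.simps using Suc.prems by (intro recursion_bound) auto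
qed simp

text \<open>Sites are averaged out from the far right: the induction hypothesis at
  \<open>x + 1\<close>, with the weight at \<open>x\<close> absorbed into the test variable, leaves
  a function of \<open>U (x + 1)\<close>, and \<open>env_step\<close> averages over that
  site.\<close>

lemma F_cond:
  assumes "r \<le> x" "det_by L U {r..x} Z" "Z \<in> borel_measurable L"
  shows "expectation (\<lambda>\<omega>. Z \<omega> * F K x \<omega>) = expectation (\<lambda>\<omega>. Z \<omega> * trunc_passage_cond a b \<rho> K (U x \<omega>))"
  using assms
proof (induction K arbitrary: x Z)
  case 0
  show ?case by (simp add: F_0)
next
  case (Suc K)
  note [measurable] = Suc.prems(3)
  define Z' where "Z' \<omega> = Z \<omega> * \<rho> (U x \<omega>)" for \<omega>
  define W where "W \<omega> = Z \<omega> * (1 + \<rho> (U x \<omega>))" for \<omega>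
  have [measurable]: "Z' \<in> borel_measurable L" "W \<in> borel_measurable L"
    unfolding Z'_def W_def by measurable
  have Ux: "det_by L U {r..x} (U x)" using Suc.prems(1) by (intro det_by_coord) auto
  have Z': "det_by L U {r..x} Z'" unfolding Z'_def
    by (rule det_by_comp2[where f = "\<lambda>p q. p * \<rho> q", OF Suc.prems(2) Ux])
  have W: "det_by L U {r..x} W" unfolding W_def
    by (rule det_by_comp2[where f = "\<lambda>p q. p * (1 + \<rho> q)", OF Suc.prems(2) Ux])
  have intW: "integrable L W" by (rule env_integrable[OF W]) measurable
  have int1: "integrable L (\<lambda>\<omega>. Z' \<omega> * F K (x + 1) \<omega>)"
  proof (rule env_integrable[of r "x + 1 + int K"])
    have "det_by L U {r..x + 1 + int K} Z'" by (rule det_by_mono[OF Z']) auto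
    moreover have "det_by L U {r..x + 1 + int K} (F K (x + 1))"
      by (rule det_by_mono[OF F_det]) (use Suc.prems(1) in auto)
    ultimately show "det_by L U {r..x + 1 + int K} (\<lambda>\<omega>. Z' \<omega> * F K (x + 1) \<omega>)"
      by (rule det_by_comp2[where f = "(*)"])
  qed measurable
  have int2: "integrable L (\<lambda>\<omega>. Z' \<omega> * env_op a b (trunc_passage_cond a b \<rho> K) (U x \<omega>))"
    by (rule env_integrable[OF det_by_comp2[where f = "\<lambda>p q. p * env_op a b (trunc_passage_cond a b \<rho> K) q", OF Z' Ux]]) measurable
  have "expectation (\<lambda>\<omega>. Z \<omega> * F (Suc K) x \<omega>) = expectation (\<lambda>\<omega>. W \<omega> + Z' \<omega> * F K (x + 1) \<omega>)"
    by (intro Bochner_Integration.integral_cong refl) (simp add: F_Suc W_def Z'_def algebra_simps)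
  also have "\<dots> = expectation W + expectation (\<lambda>\<omega>. Z' \<omega> * F K (x + 1) \<omega>)"
    using intW int1 by simp
  also have "expectation (\<lambda>\<omega>. Z' \<omega> * F K (x + 1) \<omega>) = expectation (\<lambda>\<omega>. Z' \<omega> * trunc_passage_cond a b \<rho> K (U (x + 1) \<omega>))"
    by (rule Suc.IH) (use Suc.prems(1) in \<open>auto intro: det_by_mono[OF Z']\<close>)
  also have "\<dots> = expectation (\<lambda>\<omega>. Z' \<omega> * env_op a b (trunc_passage_cond a b \<rho> K) (U x \<omega>))"
    by (rule env_step[OF Suc.prems(1) Z']) measurable
  also have "expectation W + \<dots> = expectation (\<lambda>\<omega>. W \<omega> + Z' \<omega> * env_op a b (trunc_passage_cond a b \<rho> K) (U x \<omega>))"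
    using intW int2 by simp
  also have "\<dots> = expectation (\<lambda>\<omega>. Z \<omega> * trunc_passage_cond a b \<rho> (Suc K) (U x \<omega>))"
    by (intro Bochner_Integration.integral_cong refl) (simp add: W_def Z'_def algebra_simps)
  finally show ?case .
qed

lemma F_mean: "expectation (F K x) = trunc_passage_mean a b \<rho> K"
  using F_cond[of x x "\<lambda>_. 1" K] by (simp add: expectation_U trunc_passage_mean_def)

lemma F_integrable: "integrable L (F K x)"
  by (rule env_integrable[OF F_det]) measurable

text \<open>\<open>2 * real K + 1\<close> counts the sites within distance \<open>K\<close>,
  \<open>S_var\<close> comes from the environment sums, and the factors 2 from bounding the square
  of a sum of two terms.\<close>

definition F_var :: "nat \<Rightarrow> real" where
  "F_var K = (2 * (2 * real K + 1) + 2 * S_var) * (R ^ K)\<^sup>2"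

text \<open>Subtract from \<open>F K x\<close> its conditional mean given \<open>U x\<close>. Such
  residuals are orthogonal at distance at least \<open>K\<close>. The conditional mean, a function
  on two points, is affine in \<open>U x\<close>, so its centred sum is a multiple of
  \<open>S\<close>.\<close>

theorem F_variance:
  shows "integrable L (\<lambda>\<omega>. (\<Sum>x\<in>{c..<c + int n}. F K x \<omega> - trunc_passage_mean a b \<rho> K)\<^sup>2)"
    and "expectation (\<lambda>\<omega>. (\<Sum>x\<in>{c..<c + int n}. F K x \<omega> - trunc_passage_mean a b \<rho> K)\<^sup>2) \<le> F_var K * real n"
proof -
  define T where "T \<omega> = (\<Sum>x\<in>{c..<c + int n}. F K x \<omega> - trunc_passage_mean a b \<rho> K)" for \<omega>
  define res where "res x \<omega> = F K x \<omega> - trunc_passage_cond a b \<rho> K (U x \<omega>)" for x \<omega>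
  define Q where "Q \<omega> = (\<Sum>x\<in>{c..<c + int n}. res x \<omega>)" for \<omega>
  define sl where "sl = (trunc_passage_cond a b \<rho> K 1 - trunc_passage_cond a b \<rho> K (-1)) / 2"
  have [measurable]: "res x \<in> borel_measurable L" "Q \<in> borel_measurable L" "T \<in> borel_measurable L" for x
    unfolding res_def Q_def T_def by measurable
  have RK: "0 \<le> R ^ K" using R_ge by simp
  have sl: "\<bar>sl\<bar> \<le> R ^ K" using trunc_passage_cond_bounds[of 1 K] trunc_passage_cond_bounds[of "-1" K] by (auto simp: sl_def)
  have res_bound: "\<bar>res x \<omega>\<bar> \<le> R ^ K" if "\<omega> \<in> space L" for x \<omega>
    using F_bounds[OF that, where K = K and x = x] trunc_passage_cond_bounds[OF U_val[OF that, of x], of K] by (auto simp: res_def)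
  have trunc_passage_cond_affine: "trunc_passage_cond a b \<rho> K v - trunc_passage_mean a b \<rho> K = sl * (of_int v - \<mu>)" if "v = -1 \<or> v = 1" for v
  proof -
    have "a + b \<noteq> 0" using ab by simp
    then show ?thesis using that by (auto simp: trunc_passage_mean_def env_mean_def sl_def \<mu>_def field_simps)
  qed
  have T_eq: "T \<omega> = Q \<omega> + sl * S c n \<omega>" if "\<omega> \<in> space L" for \<omega>
    unfolding T_def Q_def S_def sum_distrib_left sum.distrib[symmetric]
  proof (rule sum.cong[OF refl])
    fix x
    show "F K x \<omega> - trunc_passage_mean a b \<rho> K = res x \<omega> + sl * (of_int (U x \<omega>) - \<mu>)"
      using trunc_passage_cond_affine[OF U_val[OF that, of x]] unfolding res_def by linarith
  qed
  have res_det: "det_by L U {x..x + int K} (res x)" for x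
    unfolding res_def
    by (rule det_by_comp2[where f = "\<lambda>p q. p - trunc_passage_cond a b \<rho> K q", OF F_det]) (auto intro: det_by_coord)
  have res_det': "det_by L U {r..t} (res x)" if "r \<le> x" "x + int K \<le> t" for r t x
    by (rule det_by_mono[OF res_det]) (use that in auto)
  have int_res: "integrable L (\<lambda>\<omega>. res x \<omega> * res y \<omega>)" for x y
    by (rule env_integrable[of "min x y" "max x y + int K"])
       (auto intro!: det_by_comp2[where f = "(*)"] res_det')
  have orth: "expectation (\<lambda>\<omega>. res x \<omega> * res y \<omega>) = 0" if "x + int K \<le> y" for x y
  proof -
    have d: "det_by L U {x..y} (res x)" by (rule res_det') (use that in auto)
    have "expectation (\<lambda>\<omega>. res x \<omega> * F K y \<omega>) = expectation (\<lambda>\<omega>. res x \<omega> * trunc_passage_cond a b \<rho> K (U y \<omega>))"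
      by (rule F_cond[OF _ d]) (use that in auto)
    moreover have "integrable L (\<lambda>\<omega>. res x \<omega> * F K y \<omega>)"
      by (rule env_integrable[of x "y + int K"])
         (use that in \<open>auto intro!: det_by_comp2[where f = "(*)"] res_det' det_by_mono[OF F_det]\<close>)
    moreover have "integrable L (\<lambda>\<omega>. res x \<omega> * trunc_passage_cond a b \<rho> K (U y \<omega>))"
      by (rule env_integrable[OF det_by_comp2[where f = "\<lambda>p q. p * trunc_passage_cond a b \<rho> K q", OF d det_by_coord]])
         (use that in auto)
    ultimately show ?thesis unfolding res_def[of y] by (simp add: right_diff_distrib)
  qed
  have cov: "expectation (\<lambda>\<omega>. res x \<omega> * res y \<omega>) \<le> (if \<bar>y - x\<bar> < int K then (R ^ K)\<^sup>2 else 0)" for x y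
  proof (cases "\<bar>y - x\<bar> < int K")
    case True
    have "expectation (\<lambda>\<omega>. res x \<omega> * res y \<omega>) \<le> expectation (\<lambda>\<omega>. (R ^ K)\<^sup>2)"
    proof (rule integral_mono[OF int_res])
      show "res x \<omega> * res y \<omega> \<le> (R ^ K)\<^sup>2" if "\<omega> \<in> space L" for \<omega>
      proof -
        have "res x \<omega> * res y \<omega> \<le> \<bar>res x \<omega>\<bar> * \<bar>res y \<omega>\<bar>" by (simp add: abs_mult[symmetric])
        also have "\<dots> \<le> R ^ K * R ^ K" using res_bound[OF that] RK by (intro mult_mono) auto
        finally show ?thesis by (simp add: power2_eq_square)
      qed
    qed simp
    with True show ?thesis by (simp add: prob_space)
  next
    case False
    then consider "x + int K \<le> y" | "y + int K \<le> x" by linarith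
    then have "expectation (\<lambda>\<omega>. res x \<omega> * res y \<omega>) = 0"
      by cases (use orth[of x y] orth[of y x] in \<open>simp_all add: mult.commute\<close>)
    with False show ?thesis by simp
  qed
  have Q2: "expectation (\<lambda>\<omega>. (Q \<omega>)\<^sup>2) \<le> (2 * real K + 1) * (R ^ K)\<^sup>2 * real n"
  proof -
    let ?I = "{c..<c + int n}"
    have "expectation (\<lambda>\<omega>. (Q \<omega>)\<^sup>2) = expectation (\<lambda>\<omega>. \<Sum>x\<in>?I. \<Sum>y\<in>?I. res x \<omega> * res y \<omega>)"
      by (simp add: Q_def power2_eq_square sum_product)
    also have "\<dots> = (\<Sum>x\<in>?I. \<Sum>y\<in>?I. expectation (\<lambda>\<omega>. res x \<omega> * res y \<omega>))"
      by (subst Bochner_Integration.integral_sum; (intro Bochner_Integration.integrable_sum int_res)?)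
         (intro sum.cong refl Bochner_Integration.integral_sum int_res)
    also have "\<dots> \<le> (\<Sum>x\<in>?I. (2 * real K + 1) * (R ^ K)\<^sup>2)"
    proof (rule sum_mono)
      fix x
      have "(\<Sum>y\<in>?I. expectation (\<lambda>\<omega>. res x \<omega> * res y \<omega>)) \<le> (\<Sum>y\<in>?I. if \<bar>y - x\<bar> < int K then (R ^ K)\<^sup>2 else 0)"
        by (intro sum_mono cov)
      also have "\<dots> = (\<Sum>y\<in>{y\<in>?I. \<bar>y - x\<bar> < int K}. (R ^ K)\<^sup>2)"
        by (rule sum.inter_filter[symmetric]) simp
      also have "\<dots> \<le> (\<Sum>y\<in>{x - int K..x + int K}. (R ^ K)\<^sup>2)"
        by (intro sum_mono2) auto
      also have "\<dots> = (2 * real K + 1) * (R ^ K)\<^sup>2" by simp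
      finally show "(\<Sum>y\<in>?I. expectation (\<lambda>\<omega>. res x \<omega> * res y \<omega>)) \<le> (2 * real K + 1) * (R ^ K)\<^sup>2" .
    qed
    also have "\<dots> = (2 * real K + 1) * (R ^ K)\<^sup>2 * real n" by simp
    finally show ?thesis .
  qed
  have Q_det: "det_by L U {c..c + int n + int K} Q"
    unfolding Q_def by (intro det_by_sum res_det') auto
  have T_det: "det_by L U {c..c + int n + int K} T"
    unfolding T_def
    by (intro det_by_sum det_by_comp[where f = "\<lambda>x. x - trunc_passage_mean a b \<rho> K"] det_by_mono[OF F_det]) auto
  have intQ: "integrable L (\<lambda>\<omega>. (Q \<omega>)\<^sup>2)"
    by (rule env_integrable[OF det_by_comp[where f = "\<lambda>x. x\<^sup>2", OF Q_det]]) measurable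
  have intT: "integrable L (\<lambda>\<omega>. (T \<omega>)\<^sup>2)"
    by (rule env_integrable[OF det_by_comp[where f = "\<lambda>x. x\<^sup>2", OF T_det]]) measurable
  then show "integrable L (\<lambda>\<omega>. (\<Sum>x\<in>{c..<c + int n}. F K x \<omega> - trunc_passage_mean a b \<rho> K)\<^sup>2)" by (simp add: T_def)
  have "expectation (\<lambda>\<omega>. (T \<omega>)\<^sup>2) \<le> expectation (\<lambda>\<omega>. 2 * (Q \<omega>)\<^sup>2 + 2 * (R ^ K)\<^sup>2 * (S c n \<omega>)\<^sup>2)"
  proof (rule integral_mono[OF intT])
    show "integrable L (\<lambda>\<omega>. 2 * (Q \<omega>)\<^sup>2 + 2 * (R ^ K)\<^sup>2 * (S c n \<omega>)\<^sup>2)" using intQ S_variance(1)[of c n] by simp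
    show "(T \<omega>)\<^sup>2 \<le> 2 * (Q \<omega>)\<^sup>2 + 2 * (R ^ K)\<^sup>2 * (S c n \<omega>)\<^sup>2" if "\<omega> \<in> space L" for \<omega>
    proof -
      have "sl\<^sup>2 \<le> (R ^ K)\<^sup>2" using sl RK power2_le_iff_abs_le by blast
      then have "sl\<^sup>2 * (S c n \<omega>)\<^sup>2 \<le> (R ^ K)\<^sup>2 * (S c n \<omega>)\<^sup>2" by (intro mult_right_mono) auto
      moreover have "(T \<omega>)\<^sup>2 \<le> 2 * (Q \<omega>)\<^sup>2 + 2 * (sl * S c n \<omega>)\<^sup>2"
        using zero_le_power2[of "Q \<omega> - sl * S c n \<omega>"] unfolding T_eq[OF that]
        by (simp add: power2_eq_square algebra_simps)
      ultimately show ?thesis by (simp add: power_mult_distrib)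
    qed
  qed
  also have "\<dots> = 2 * expectation (\<lambda>\<omega>. (Q \<omega>)\<^sup>2) + 2 * (R ^ K)\<^sup>2 * expectation (\<lambda>\<omega>. (S c n \<omega>)\<^sup>2)"
    using intQ S_variance(1)[of c n] by simp
  also have "\<dots> \<le> 2 * ((2 * real K + 1) * (R ^ K)\<^sup>2 * real n) + 2 * (R ^ K)\<^sup>2 * (S_var * real n)"
    by (intro add_mono mult_left_mono Q2 S_variance) auto
  also have "\<dots> = F_var K * real n" by (simp add: F_var_def algebra_simps)
  finally show "expectation (\<lambda>\<omega>. (\<Sum>x\<in>{c..<c + int n}. F K x \<omega> - trunc_passage_mean a b \<rho> K)\<^sup>2) \<le> F_var K * real n"
    by (simp add: T_def)
qed

end

section \<open>Oscillation of the environment sums in the symmetric case\<close>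

context markov_env
begin

definition V :: "nat \<Rightarrow> 'w \<Rightarrow> int" where "V n \<omega> = (\<Sum>x\<in>{1..int n}. U x \<omega>)"

lemma V_measurable [measurable]: "V n \<in> L \<rightarrow>\<^sub>M count_space UNIV"
proof (induction n)
  case 0
  show ?case by (simp add: V_def[abs_def])
next
  case (Suc n)
  note [measurable] = Suc
  have "{1..int (Suc n)} = insert (int n + 1) {1..int n}" by auto
  then have "V (Suc n) = (\<lambda>\<omega>. U (int n + 1) \<omega> + V n \<omega>)" by (auto simp: V_def)
  then show ?case by simp
qed

lemma V_Suc: "V (Suc n) \<omega> = V n \<omega> + U (int n + 1) \<omega>"
proof -
  have "{1..int (Suc n)} = insert (int n + 1) {1..int n}" by auto
  then show ?thesis by (simp add: V_def)
qed

lemma V_det: "j \<le> n \<Longrightarrow> det_by L U {0..int n} (V j)"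
  unfolding V_def by (intro det_by_sum det_by_coord) auto

definition above :: "nat \<Rightarrow> nat \<Rightarrow> 'w \<Rightarrow> bool" where
  "above k n \<omega> \<longleftrightarrow> (\<forall>j\<in>{0..n}. - int k < V j \<omega>)"

lemma above_measurable [measurable]: "Measurable.pred L (above k n)"
  unfolding above_def by measurable

lemma above_Suc: "above k (Suc n) \<omega> \<longleftrightarrow> above k n \<omega> \<and> - int k < V (Suc n) \<omega>"
  by (auto simp: above_def atLeastAtMostSuc_conv)

lemma above_lt: "above k n \<omega> \<Longrightarrow> - int k < V n \<omega>"
  by (simp add: above_def)

lemma above_det: "det_by L U {0..int n} (above k n)"
  unfolding above_def
  by (intro det_by_Ball det_by_comp[where f = "\<lambda>x. - int k < x"] V_det) auto

lemma above_term_det: "det_by L U {0..int n} (\<lambda>\<omega>. of_bool (above k n \<omega>) * f (U (int n) \<omega>) (V n \<omega>) :: real)"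
  by (intro det_by_comp2[where f = "\<lambda>p q. of_bool p * q"] det_by_comp2[where f = f] above_det V_det det_by_coord) auto

lemma above_integrable: "integrable L (\<lambda>\<omega>. of_bool (above k n \<omega>) * f (U (int n) \<omega>) (V n \<omega>) :: real)"
  by (rule env_integrable[OF above_term_det]) measurable

text \<open>The sum leaves the region above \<open>- int k\<close> only by a step -1 landing on
  \<open>- int k\<close>, and there \<open>\<phi>\<close> vanishes; so the survival indicator may
  stay at time \<open>n\<close>.\<close>

lemma above_step:
  fixes \<phi> :: "int \<Rightarrow> int \<Rightarrow> real"
  assumes "\<phi> (-1) (- int k) = 0"
  shows "expectation (\<lambda>\<omega>. of_bool (above k (Suc n) \<omega>) * \<phi> (U (int (Suc n)) \<omega>) (V (Suc n) \<omega>)) =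
    expectation (\<lambda>\<omega>. of_bool (above k n \<omega>) * env_op a b (\<lambda>y. \<phi> y (V n \<omega> + y)) (U (int n) \<omega>))"
proof -
  let ?G = "\<lambda>y \<omega>. of_bool (above k n \<omega>) * \<phi> y (V n \<omega> + y)"
  have "expectation (\<lambda>\<omega>. of_bool (above k (Suc n) \<omega>) * \<phi> (U (int (Suc n)) \<omega>) (V (Suc n) \<omega>)) =
      expectation (\<lambda>\<omega>. ?G (U (int n + 1) \<omega>) \<omega>)"
  proof (intro Bochner_Integration.integral_cong refl)
    fix \<omega> assume \<omega>: "\<omega> \<in> space L"
    have "\<phi> (U (int n + 1) \<omega>) (V n \<omega> + U (int n + 1) \<omega>) = 0"
      if "above k n \<omega>" "\<not> - int k < V (Suc n) \<omega>"
    proof -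
      have "U (int n + 1) \<omega> = -1" "V n \<omega> + U (int n + 1) \<omega> = - int k"
        using above_lt[OF that(1)] that(2) U_val[OF \<omega>, of "int n + 1"] by (auto simp: V_Suc)
      then show ?thesis using assms by simp
    qed
    then show "of_bool (above k (Suc n) \<omega>) * \<phi> (U (int (Suc n)) \<omega>) (V (Suc n) \<omega>) = ?G (U (int n + 1) \<omega>) \<omega>"
      by (auto simp: above_Suc V_Suc add.commute)
  qed
  also have "\<dots> = expectation (\<lambda>\<omega>. env_op a b (\<lambda>y. ?G y \<omega>) (U (int n) \<omega>))"
  proof (rule env_step2)
    show "det_by L U {0..int n} (?G y)" for y
      by (rule above_term_det[where f = "\<lambda>_ s. \<phi> y (s + y)"])
  qed auto
  finally show ?thesis by (simp add: env_op_scale)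
qed

text \<open>The scheme of \<open>unbounded_above\<close>, run for the Markov chain of pairs
  (environment value, partial sum): a conserved mean bounds survival at high sums, and a
  superharmonic truncation makes the visits to each single pair summable.\<close>

lemma V_unbounded_below:
  assumes eq: "a = b"
  shows "AE \<omega> in L. \<forall>k::nat. \<exists>n. V n \<omega> \<le> - int k"
proof -
  have "AE \<omega> in L. \<exists>n. V n \<omega> \<le> - int k" for k
  proof (cases "k = 0")
    case True
    then show ?thesis by (auto simp: V_def intro!: exI[of _ 0])
  next
    case k: False
    \<comment> \<open>Forced by harmonicity of \<open>H\<close> below: the term in \<open>v\<close>
      offsets the bias of the next step given the present value. The shift \<open>v + 1\<close>
      makes \<open>H\<close> vanish at the exit state \<open>(-1, - int k)\<close>.\<close>
    define c where "c = (1 - 2 * a) / (2 * a)"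
    have c: "2 * a * c = 1 - 2 * a" using ab by (simp add: c_def)
    have c2: "a * (1 + 2 * c) = 1 - a" using c by (simp add: algebra_simps)
    then have c3: "0 < 1 + 2 * c" using ab by (metis diff_gt_0_iff_gt zero_less_mult_pos)
    define H where "H v s = real_of_int s + real k + c * (real_of_int v + 1)" for v s :: int
    have harm: "env_op a b (\<lambda>y. H y (s + y)) v = H v s" if "v = -1 \<or> v = 1" for v s
    proof -
      have "b * H (-1) (s - 1) + (1 - b) * H 1 (s + 1) = H 1 s"
        using c unfolding H_def eq[symmetric] by (simp add: algebra_simps)
      moreover have "(1 - a) * H (-1) (s - 1) + a * H 1 (s + 1) = H (-1) s"
        using c unfolding H_def by (simp add: algebra_simps)
      ultimately show ?thesis using that by (auto simp: env_op_def)
    qed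
    have H_ge: "real_of_int s + real k - 1 \<le> H v s" if "v = -1 \<or> v = 1" for v s
      using that c3 by (auto simp: H_def)
    have H_nonneg: "0 \<le> H v s" if "v = -1 \<or> v = 1" "- int k < s" for v s
      using H_ge[OF that(1), of s] that(2) by linarith
    have H_kill: "H (-1) (- int k) = 0" by (simp add: H_def)
    define h0 where "h0 = expectation (\<lambda>\<omega>. of_bool (above k 0 \<omega>) * H (U (int 0) \<omega>) (V 0 \<omega>))"
    have exit: "expectation (\<lambda>\<omega>. of_bool (above k n \<omega>) * H (U (int n) \<omega>) (V n \<omega>)) = h0" for n
    proof (induction n)
      case (Suc n)
      have "expectation (\<lambda>\<omega>. of_bool (above k n \<omega>) * env_op a b (\<lambda>y. H y (V n \<omega> + y)) (U (int n) \<omega>)) =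
          expectation (\<lambda>\<omega>. of_bool (above k n \<omega>) * H (U (int n) \<omega>) (V n \<omega>))"
        by (intro Bochner_Integration.integral_cong refl) (use harm U_val in auto)
      then show ?case using above_step[of H, OF H_kill, of n] Suc by simp
    qed (simp add: h0_def)
    have h0: "0 \<le> h0" unfolding h0_def
      by (intro integral_nonneg_AE AE_I2) (use U_val H_nonneg above_lt in auto)
    have visit: "(\<lambda>n. prob {\<omega>\<in>space L. above k n \<omega> \<and> U (int n) \<omega> = v \<and> V n \<omega> = s}) \<longlonglongrightarrow> 0"
      if v: "v = -1 \<or> v = 1" and s: "- int k < s" for v s
    proof (rule summable_LIMSEQ_zero, rule bounded_imp_summable)
      define l where "l = H v s"
      \<comment> \<open>Cutting \<open>H\<close> at its own value in \<open>(v, s)\<close> leaves a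
        superharmonic function that loses a fixed amount at each visit to
        \<open>(v, s)\<close>.\<close>
      define \<phi> where "\<phi> v s = min (H v s) l" for v s
      define q where "q n = prob {\<omega>\<in>space L. above k n \<omega> \<and> U (int n) \<omega> = v \<and> V n \<omega> = s}" for n
      define e where "e n = expectation (\<lambda>\<omega>. of_bool (above k n \<omega>) * \<phi> (U (int n) \<omega>) (V n \<omega>))" for n
      have l: "0 \<le> l" unfolding l_def by (rule H_nonneg[OF v s])
      have super: "env_op a b (\<lambda>y. \<phi> y (s' + y)) v' \<le> \<phi> v' s' - (1 - a) * of_bool (v' = v \<and> s' = s)"
        if v': "v' = -1 \<or> v' = 1" for v' s'
      proof -
        define t where "t = (if v' = 1 then b else 1 - a)"
        have t: "0 \<le> t" "0 \<le> 1 - t" using ab by (auto simp: t_def)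
        have op: "env_op a b f v' = t * f (-1) + (1 - t) * f 1" for f
          by (auto simp: env_op_def t_def)
        have le_H: "env_op a b (\<lambda>y. \<phi> y (s' + y)) v' \<le> H v' s'"
          unfolding harm[OF v', of s', symmetric] op \<phi>_def using t by (intro add_mono mult_left_mono) auto
        have "env_op a b (\<lambda>y. \<phi> y (s' + y)) v' \<le> t * l + (1 - t) * l"
          unfolding op \<phi>_def using t by (intro add_mono mult_left_mono) auto
        then have le_l: "env_op a b (\<lambda>y. \<phi> y (s' + y)) v' \<le> l" by (simp add: algebra_simps)
        show ?thesis
        proof (cases "v' = v \<and> s' = s")
          case True
          \<comment> \<open>The loss comes from the upward move, which overshoots the cut. The
            overshoot is 1 with weight \<open>1 - a\<close> if \<open>v = 1\<close>, and
            \<open>1 + 2 * c\<close> with weight \<open>a\<close> if \<open>v = -1\<close>; both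
            averages are \<open>1 - a\<close>.\<close>
          have gap: "(1 - t) * (H 1 (s' + 1) - l) = 1 - a"
            using v' c2 True unfolding l_def H_def t_def eq[symmetric] by (auto simp: algebra_simps)
          have "env_op a b (\<lambda>y. \<phi> y (s' + y)) v' \<le> t * H (-1) (s' - 1) + (1 - t) * l"
            unfolding op \<phi>_def using t by (intro add_mono mult_left_mono) auto
          also have "\<dots> = env_op a b (\<lambda>y. H y (s' + y)) v' - (1 - t) * (H 1 (s' + 1) - l)"
            unfolding op by (simp add: algebra_simps)
          also have "\<dots> = \<phi> v' s' - (1 - a)" using harm[OF v'] gap True by (simp add: \<phi>_def l_def)
          finally show ?thesis using True by simp
        qed (use le_H le_l in \<open>auto simp: \<phi>_def\<close>)
      qed
      have dec: "e (Suc n) \<le> e n - (1 - a) * q n" for n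
      proof -
        have "e (Suc n) = expectation (\<lambda>\<omega>. of_bool (above k n \<omega>) * env_op a b (\<lambda>y. \<phi> y (V n \<omega> + y)) (U (int n) \<omega>))"
          unfolding e_def by (rule above_step) (use H_kill l in \<open>simp add: \<phi>_def\<close>)
        also have "\<dots> \<le> expectation (\<lambda>\<omega>. of_bool (above k n \<omega>) * \<phi> (U (int n) \<omega>) (V n \<omega>)
            - (1 - a) * indicator {\<omega>\<in>space L. above k n \<omega> \<and> U (int n) \<omega> = v \<and> V n \<omega> = s} \<omega>)"
        proof (rule integral_mono)
          show "integrable L (\<lambda>\<omega>. of_bool (above k n \<omega>) * env_op a b (\<lambda>y. \<phi> y (V n \<omega> + y)) (U (int n) \<omega>))"
            by (rule above_integrable[where f = "\<lambda>u s. env_op a b (\<lambda>y. \<phi> y (s + y)) u"])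
          show "integrable L (\<lambda>\<omega>. of_bool (above k n \<omega>) * \<phi> (U (int n) \<omega>) (V n \<omega>)
            - (1 - a) * indicator {\<omega>\<in>space L. above k n \<omega> \<and> U (int n) \<omega> = v \<and> V n \<omega> = s} \<omega>)"
            by (rule Bochner_Integration.integrable_diff above_integrable)+
               (simp add: emeasure_eq_measure)
          show "of_bool (above k n \<omega>) * env_op a b (\<lambda>y. \<phi> y (V n \<omega> + y)) (U (int n) \<omega>) \<le>
            of_bool (above k n \<omega>) * \<phi> (U (int n) \<omega>) (V n \<omega>)
            - (1 - a) * indicator {\<omega>\<in>space L. above k n \<omega> \<and> U (int n) \<omega> = v \<and> V n \<omega> = s} \<omega>"
            if "\<omega> \<in> space L" for \<omega>
            using super[OF U_val[OF that, of "int n"], of "V n \<omega>"] that by (auto simp: indicator_def)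
        qed
        also have "\<dots> = e n - (1 - a) * q n"
          unfolding e_def q_def by (subst Bochner_Integration.integral_diff) (auto intro: above_integrable simp: emeasure_eq_measure)
        finally show ?thesis .
      qed
      have tele: "(1 - a) * (\<Sum>j<n. q j) \<le> e 0 - e n" for n
      proof (induction n)
        case (Suc n)
        then show ?case using dec[of n] by (simp add: algebra_simps)
      qed simp
      have "0 \<le> e n" for n unfolding e_def
        by (intro integral_nonneg_AE AE_I2) (use U_val H_nonneg above_lt l in \<open>auto simp: \<phi>_def\<close>)
      with tele have q_bound: "(1 - a) * (\<Sum>j<n. q j) \<le> e 0" for n by (metis diff_ge_0_iff_ge diff_mono order_refl order_trans diff_zero)
      then show "(\<Sum>j\<le>n. prob {\<omega>\<in>space L. above k j \<omega> \<and> U (int j) \<omega> = v \<and> V j \<omega> = s}) \<le> e 0 / (1 - a)" for n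
        using ab q_bound[of "Suc n"] unfolding q_def lessThan_Suc_atMost[symmetric]
        by (subst pos_le_divide_eq) (simp_all only: diff_gt_0_iff_gt mult.commute[of _ "1 - a"])
    qed simp
    define A where "A n = {\<omega>\<in>space L. above k n \<omega>}" for n
    have [measurable]: "A n \<in> sets L" for n unfolding A_def by measurable
    have small: "\<exists>q. q \<longlonglongrightarrow> 0 \<and> (\<forall>n. prob (A n) \<le> q n + e)" if e: "0 < e" for e :: real
    proof -
      obtain m :: nat where m: "h0 / e < real m" using reals_Archimedean2 by blast
      define I :: "(int \<times> int) set" where "I = {-1, 1} \<times> {- int k<..<int m}"
      define q where "q n = (\<Sum>(v, s)\<in>I. prob {\<omega>\<in>space L. above k n \<omega> \<and> U (int n) \<omega> = v \<and> V n \<omega> = s})" for n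
      have "q \<longlonglongrightarrow> 0" unfolding q_def split_def
        by (intro tendsto_null_sum visit) (auto simp: I_def)
      moreover have "prob (A n) \<le> q n + e" for n
      proof -
        define B where "B = {\<omega>\<in>space L. above k n \<omega> \<and> int m \<le> V n \<omega>}"
        have [measurable]: "B \<in> sets L" unfolding B_def by measurable
        have "prob B * real m = expectation (\<lambda>\<omega>. indicator B \<omega> * real m)" by simp
        also have "\<dots> \<le> expectation (\<lambda>\<omega>. of_bool (above k n \<omega>) * H (U (int n) \<omega>) (V n \<omega>))"
        proof (rule integral_mono)
          show "integrable L (\<lambda>\<omega>. of_bool (above k n \<omega>) * H (U (int n) \<omega>) (V n \<omega>))" by (rule above_integrable)
          show "indicator B \<omega> * real m \<le> of_bool (above k n \<omega>) * H (U (int n) \<omega>) (V n \<omega>)"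
            if "\<omega> \<in> space L" for \<omega>
          proof (cases "\<omega> \<in> B")
            case True
            then have "real m \<le> real_of_int (V n \<omega>) + real k - 1" using k by (auto simp: B_def)
            also have "\<dots> \<le> H (U (int n) \<omega>) (V n \<omega>)" by (rule H_ge[OF U_val[OF that]])
            finally show ?thesis using True by (auto simp: B_def)
          next
            case False
            then show ?thesis using H_nonneg[OF U_val[OF that, of "int n"], of "V n \<omega>"] above_lt[of k n \<omega>] by auto
          qed
        qed (simp add: emeasure_eq_measure)
        also have "\<dots> = h0" by (rule exit)
        finally have "prob B * real m \<le> h0" .
        moreover have "0 < real m" using m h0 e by (smt (verit) divide_nonneg_pos)
        ultimately have "prob B \<le> h0 / real m" by (simp add: pos_le_divide_eq)
        also have "\<dots> \<le> e" using m e \<open>0 < real m\<close> by (simp add: field_simps)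
        finally have B: "prob B \<le> e" .
        let ?W = "\<Union>(v, s)\<in>I. {\<omega>\<in>space L. above k n \<omega> \<and> U (int n) \<omega> = v \<and> V n \<omega> = s}"
        have finI: "finite I" by (simp add: I_def)
        have [measurable]: "?W \<in> sets L" using finI by (intro sets.finite_UN) auto
        have "A n \<subseteq> ?W \<union> B"
        proof
          fix \<omega> assume "\<omega> \<in> A n"
          then have \<omega>: "\<omega> \<in> space L" "above k n \<omega>" by (auto simp: A_def)
          show "\<omega> \<in> ?W \<union> B"
          proof (cases "int m \<le> V n \<omega>")
            case False
            then have "(U (int n) \<omega>, V n \<omega>) \<in> I" using \<omega> U_val[OF \<omega>(1), of "int n"] above_lt[OF \<omega>(2)] by (auto simp: I_def)
            then show ?thesis using \<omega> by (intro UnI1 UN_I[of "(U (int n) \<omega>, V n \<omega>)"]) auto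
          qed (use \<omega> in \<open>simp add: B_def\<close>)
        qed
        then have "prob (A n) \<le> prob (?W \<union> B)" by (intro finite_measure_mono) measurable
        also have "\<dots> \<le> prob ?W + prob B" by (intro measure_Un_le) measurable
        also have "prob ?W \<le> q n"
          unfolding q_def split_def by (intro finite_measure_subadditive_finite finI) auto
        finally show ?thesis using B by linarith
      qed
      ultimately show ?thesis by blast
    qed
    have "AE \<omega> in L. \<exists>n. \<omega> \<notin> A n" by (rule AE_exists_notin) (use small in auto)
    then show ?thesis using AE_space by eventually_elim (auto simp: A_def above_def not_less)
  qed
  then show ?thesis by (simp add: AE_all_countable)
qed

lemma V_unbounded_above:
  assumes eq: "a = b"
  shows "AE \<omega> in L. \<forall>k::nat. \<exists>n. int k \<le> V n \<omega>"
proof -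
  interpret neg: markov_env L "\<lambda>i \<omega>. - U i \<omega>" b a by (rule env_negate)
  have "neg.V n \<omega> = - V n \<omega>" for n \<omega> by (simp add: V_def neg.V_def sum_negf)
  then show ?thesis using neg.V_unbounded_below[OF eq[symmetric]] by simp
qed

end

section \<open>Means of truncated passage times\<close>

definition rho :: "real \<Rightarrow> int \<Rightarrow> real" where
  "rho \<sigma> v = (if v = 1 then \<sigma> else 1 / \<sigma>)"

text \<open>Determinant of the two-by-two linear system
  \<open>m v = 1 + rho \<sigma> v + rho \<sigma> v * env_op a b m v\<close> for the limiting
  conditional means. Its sign decides whether the truncated means stay bounded.\<close>

definition ballistic_det :: "real \<Rightarrow> real \<Rightarrow> real \<Rightarrow> real" where
  "ballistic_det a b \<sigma> = (2 - a - b) - (1 - a) / \<sigma> - (1 - b) * \<sigma>"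

text \<open>Cramer's solution of that system, averaged over the stationary law.\<close>

definition passage_mean :: "real \<Rightarrow> real \<Rightarrow> real \<Rightarrow> real" where
  "passage_mean a b \<sigma> =
     (b * ((1 + 1 / \<sigma>) * (1 - (1 - b) * \<sigma>) + (1 + \<sigma>) * (a / \<sigma>)) +
      a * ((1 + \<sigma>) * (1 - (1 - a) / \<sigma>) + b * \<sigma> * (1 + 1 / \<sigma>))) / ((a + b) * ballistic_det a b \<sigma>)"

lemma env_op_diff: "env_op a b (\<lambda>v. f v - g v) v = env_op a b f v - env_op a b g v"
  by (simp add: env_op_def algebra_simps)

lemma env_op_mono:
  assumes "0 < a" "a < 1" "0 < b" "b < 1" "f 1 \<le> g 1" "f (-1) \<le> g (-1)"
  shows "env_op a b f v \<le> env_op a b g v"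
  using assms by (auto simp: env_op_def intro!: add_mono mult_left_mono)

text \<open>A positive determinant makes the fixed-point system solvable by a positive
  \<open>m\<close>. Then \<open>rho * env_op m = m - 1 - rho\<close> is at most \<open>l * m\<close>
  with \<open>l = 1 - 1 / max m\<close>, so the iteration contracts in the norm weighted by
  \<open>m\<close>.\<close>

lemma trunc_passage_mean_geometric:
  assumes ab: "0 < a" "a < 1" "0 < b" "b < 1" and \<sigma>: "0 < \<sigma>" and \<delta>: "0 < ballistic_det a b \<sigma>"
  obtains C l where "0 < l" "l < 1" "\<And>K. trunc_passage_mean a b (rho \<sigma>) K \<le> passage_mean a b \<sigma>"
    "\<And>K. passage_mean a b \<sigma> - trunc_passage_mean a b (rho \<sigma>) K \<le> C * l ^ K" "0 < passage_mean a b \<sigma>"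
proof -
  define \<delta> where "\<delta> = ballistic_det a b \<sigma>"
  define s where "s = (1 - a) / \<sigma>"
  define t where "t = (1 - b) * \<sigma>"
  have st: "s * t = (1 - a) * (1 - b)" using \<sigma> by (simp add: s_def t_def)
  have \<delta>_eq: "\<delta> = (1 - s) * (1 - t) - a * b"
  proof -
    have "(1 - s) * (1 - t) - a * b = 1 - s - t + s * t - a * b" by (simp add: algebra_simps)
    then show ?thesis unfolding st by (simp add: \<delta>_def ballistic_det_def s_def t_def algebra_simps)
  qed
  have pos: "0 < s" "0 < t" "0 < \<delta>" using ab \<sigma> assms(6) by (auto simp: s_def t_def \<delta>_def)
  have prod_pos: "0 < (1 - s) * (1 - t)"
    using pos(3) ab mult_pos_pos[of a b] unfolding \<delta>_eq by linarith
  \<comment> \<open>\<open>1 - s\<close> and \<open>1 - t\<close> have the same sign, and both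
    negative would give \<open>s * t > 1\<close>, against
    \<open>s * t = (1 - a) * (1 - b)\<close>.\<close>
  have st1: "s < 1" "t < 1"
  proof -
    have "\<not> (1 < s \<and> 1 < t)"
    proof
      assume "1 < s \<and> 1 < t"
      then have "1 < s * t" by (metis less_1_mult)
      moreover have "(1 - a) * (1 - b) < 1 * 1" using ab by (intro mult_strict_mono) auto
      ultimately show False using st by simp
    qed
    with prod_pos show "s < 1" "t < 1" by (auto simp: zero_less_mult_iff)
  qed
  define x where "x = 1 / \<sigma>"
  have x: "\<sigma> * x = 1" "0 < x" "a / \<sigma> = a * x" "1 / \<sigma> = x" using \<sigma> by (auto simp: x_def)
  define n1 where "n1 = (1 + x) * (1 - t) + (1 + \<sigma>) * (a * x)"
  define n2 where "n2 = (1 + \<sigma>) * (1 - s) + b * \<sigma> * (1 + x)"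
  have n_pos: "0 < n1" "0 < n2"
    unfolding n1_def n2_def using ab \<sigma> st1 x by (auto intro!: add_pos_pos mult_pos_pos)
  define m1 where "m1 = n1 / \<delta>"
  define m2 where "m2 = n2 / \<delta>"
  have m_pos: "0 < m1" "0 < m2"
    unfolding m1_def m2_def using n_pos pos by (auto intro: divide_pos_pos)
  define m where "m v = (if v = 1 then m2 else m1)" for v :: int
  have fix1: "m1 = 1 + x + s * m1 + a * x * m2"
  proof -
    have "(1 - s) * n1 - a * x * n2 = (1 + x) * \<delta>"
      using x(1) unfolding n1_def n2_def \<delta>_eq by algebra
    then have "((1 - s) * n1 - a * x * n2) / \<delta> = 1 + x" using pos(3) by simp
    then have "(1 - s) * m1 - a * x * m2 = 1 + x" by (simp add: m1_def m2_def diff_divide_distrib)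
    then show ?thesis by (simp add: algebra_simps)
  qed
  have fix2: "m2 = 1 + \<sigma> + b * \<sigma> * m1 + t * m2"
  proof -
    have "(1 - t) * n2 - b * \<sigma> * n1 = (1 + \<sigma>) * \<delta>"
      using x(1) unfolding n1_def n2_def \<delta>_eq by algebra
    then have "((1 - t) * n2 - b * \<sigma> * n1) / \<delta> = 1 + \<sigma>" using pos(3) by simp
    then have "(1 - t) * m2 - b * \<sigma> * m1 = 1 + \<sigma>" by (simp add: m1_def m2_def diff_divide_distrib)
    then show ?thesis by (simp add: algebra_simps)
  qed
  have rho_pos: "0 < rho \<sigma> v" for v using \<sigma> by (simp add: rho_def)
  have m_fix: "m v = 1 + rho \<sigma> v + rho \<sigma> v * env_op a b m v" for v
  proof (cases "v = 1")
    case True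
    have "\<sigma> * (b * m1 + (1 - b) * m2) = b * \<sigma> * m1 + t * m2" by (simp add: t_def algebra_simps)
    with True fix2 show ?thesis by (simp add: m_def rho_def env_op_def)
  next
    case False
    have "x * ((1 - a) * m1 + a * m2) = s * m1 + a * x * m2"
      using \<sigma> by (simp add: s_def x_def field_simps)
    with False fix1 x show ?thesis by (simp add: m_def rho_def env_op_def)
  qed
  define Mx where "Mx = max m1 m2"
  have "0 \<le> env_op a b m v" for v
    using m_pos ab by (auto simp: env_op_def m_def)
  then have m_gt1: "1 < m v" for v
    using m_fix[of v] rho_pos[of v] by (smt (verit) mult_nonneg_nonneg)
  have Mx: "m v \<le> Mx" for v by (auto simp: m_def Mx_def)
  have Mx1: "1 < Mx" using m_gt1[of 1] Mx[of 1] by linarith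
  define l where "l = 1 - 1 / Mx"
  have l: "0 < l" "l < 1" using Mx1 by (auto simp: l_def)
  have contract: "rho \<sigma> v * env_op a b m v \<le> l * m v" for v
  proof -
    have "m v / Mx \<le> 1" using Mx[of v] Mx1 by simp
    then have "m v - 1 \<le> l * m v" by (simp add: l_def algebra_simps)
    then show ?thesis using m_fix[of v] rho_pos[of v] by linarith
  qed
  have conv: "0 \<le> m v - trunc_passage_cond a b (rho \<sigma>) K v \<and> m v - trunc_passage_cond a b (rho \<sigma>) K v \<le> l ^ K * m v" for K v
  proof (induction K arbitrary: v)
    case 0
    show ?case using m_gt1[of v] by simp
  next
    case (Suc K)
    have eq: "m v - trunc_passage_cond a b (rho \<sigma>) (Suc K) v = rho \<sigma> v * env_op a b (\<lambda>v. m v - trunc_passage_cond a b (rho \<sigma>) K v) v"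
      using m_fix[of v] unfolding env_op_diff by (simp add: algebra_simps)
    have "env_op a b (\<lambda>_. 0) v \<le> env_op a b (\<lambda>v. m v - trunc_passage_cond a b (rho \<sigma>) K v) v"
      using Suc by (intro env_op_mono ab) auto
    moreover have "env_op a b (\<lambda>_. 0) v = 0" by (simp add: env_op_def)
    ultimately have lo: "0 \<le> env_op a b (\<lambda>v. m v - trunc_passage_cond a b (rho \<sigma>) K v) v" by linarith
    have "env_op a b (\<lambda>v. m v - trunc_passage_cond a b (rho \<sigma>) K v) v \<le> env_op a b (\<lambda>v. l ^ K * m v) v"
      using Suc by (intro env_op_mono ab) auto
    also have "\<dots> = l ^ K * env_op a b m v" by (rule env_op_scale)
    finally have "rho \<sigma> v * env_op a b (\<lambda>v. m v - trunc_passage_cond a b (rho \<sigma>) K v) v \<le> rho \<sigma> v * (l ^ K * env_op a b m v)"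
      using rho_pos[of v] by (intro mult_left_mono) auto
    also have "\<dots> = l ^ K * (rho \<sigma> v * env_op a b m v)" by simp
    also have "\<dots> \<le> l ^ K * (l * m v)" using contract l by (intro mult_left_mono) auto
    finally show ?case unfolding eq using lo rho_pos[of v] by (simp add: mult_ac)
  qed
  have D: "passage_mean a b \<sigma> = env_mean a b m"
    by (simp add: passage_mean_def env_mean_def m_def m1_def m2_def n1_def n2_def x_def s_def t_def \<delta>_def[symmetric]
        add_divide_distrib[symmetric])
  have mean_mono: "env_mean a b f \<le> env_mean a b g" if "f 1 \<le> g 1" "f (-1) \<le> g (-1)" for f g
    using that ab unfolding env_mean_def by (intro divide_right_mono add_mono mult_left_mono) auto
  have mean_diff: "env_mean a b f - env_mean a b g = env_mean a b (\<lambda>v. f v - g v)" for f g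
    by (simp add: env_mean_def diff_divide_distrib[symmetric] algebra_simps)
  show ?thesis
  proof (rule that[of l "env_mean a b m"])
    show "0 < l" "l < 1" by fact+
    show "trunc_passage_mean a b (rho \<sigma>) K \<le> passage_mean a b \<sigma>" for K
      unfolding D trunc_passage_mean_def using conv[of 1 K] conv[of "-1" K] by (intro mean_mono) auto
    show "passage_mean a b \<sigma> - trunc_passage_mean a b (rho \<sigma>) K \<le> env_mean a b m * l ^ K" for K
    proof -
      have "passage_mean a b \<sigma> - trunc_passage_mean a b (rho \<sigma>) K = env_mean a b (\<lambda>v. m v - trunc_passage_cond a b (rho \<sigma>) K v)"
        unfolding D trunc_passage_mean_def mean_diff ..
      also have "\<dots> \<le> env_mean a b (\<lambda>v. l ^ K * m v)"
        using conv[of 1 K] conv[of "-1" K] by (intro mean_mono) auto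
      also have "\<dots> = env_mean a b m * l ^ K" by (simp add: env_mean_def algebra_simps)
      finally show ?thesis .
    qed
    show "0 < passage_mean a b \<sigma>"
      unfolding D env_mean_def using m_gt1[of 1] m_gt1[of "-1"] ab by (intro divide_pos_pos add_pos_pos mult_pos_pos) auto
  qed
qed

text \<open>A nonzero \<open>g\<close> with \<open>0 \<le> g\<close>,
  \<open>g \<le> rho * env_op g\<close> and \<open>g \<le> 1 + rho\<close> is gained afresh at each
  iteration, so the conditional means dominate \<open>K * g\<close>.\<close>

lemma trunc_passage_mean_linear_growth:
  assumes ab: "0 < a" "a < 1" "0 < b" "b < 1" and \<sigma>: "0 < \<sigma>" and \<delta>: "ballistic_det a b \<sigma> \<le> 0"
  obtains c where "0 < c" "\<And>K. real K * c \<le> trunc_passage_mean a b (rho \<sigma>) K"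
proof -
  define s where "s = (1 - a) / \<sigma>"
  define t where "t = (1 - b) * \<sigma>"
  have st: "s * t = (1 - a) * (1 - b)" using \<sigma> by (simp add: s_def t_def)
  have le: "(1 - s) * (1 - t) \<le> a * b"
  proof -
    have "(1 - s) * (1 - t) = 1 - s - t + s * t" by (simp add: algebra_simps)
    then show ?thesis using \<delta> unfolding st by (simp add: ballistic_det_def s_def t_def algebra_simps)
  qed
  have rho_pos: "0 < rho \<sigma> v" for v using \<sigma> by (simp add: rho_def)
  \<comment> \<open>If a diagonal weight \<open>s\<close> or \<open>t\<close> is at least 1, a unit
    vector works. Otherwise \<open>(a / \<sigma>, 1 - s)\<close> satisfies the first row with
    equality, and the second row is the determinant condition \<open>le\<close>.\<close>
  obtain f1 f2 :: real where f: "0 \<le> f1" "0 \<le> f2" "0 < f1 + f2" "f1 \<le> 1 + 1 / \<sigma>" "f2 \<le> 1"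
    "f1 \<le> s * f1 + a / \<sigma> * f2" "f2 \<le> b * \<sigma> * f1 + t * f2"
  proof (cases "1 \<le> s \<or> 1 \<le> t")
    case True
    then show ?thesis
    proof
      assume "1 \<le> s"
      then show ?thesis using that[of 1 0] \<sigma> ab by auto
    next
      assume "1 \<le> t"
      then show ?thesis using that[of 0 1] \<sigma> ab by auto
    qed
  next
    case False
    show ?thesis
    proof (rule that[of "a / \<sigma>" "1 - s"])
      show "1 - s \<le> b * \<sigma> * (a / \<sigma>) + t * (1 - s)"
        using le \<sigma> by (simp add: algebra_simps)
    qed (use False \<sigma> ab in \<open>auto simp: s_def field_simps\<close>)
  qed
  define g where "g v = (if v = 1 then f2 else f1)" for v :: int
  have super: "g v \<le> rho \<sigma> v * env_op a b g v" for v
  proof (cases "v = 1")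
    case True
    have "\<sigma> * (b * f1 + (1 - b) * f2) = b * \<sigma> * f1 + t * f2" by (simp add: t_def algebra_simps)
    with True f(7) show ?thesis by (simp add: g_def rho_def env_op_def)
  next
    case False
    have "((1 - a) * f1 + a * f2) / \<sigma> = s * f1 + a / \<sigma> * f2" by (simp add: s_def add_divide_distrib)
    with False f(6) show ?thesis by (simp add: g_def rho_def env_op_def)
  qed
  have g_le: "g v \<le> 1 + rho \<sigma> v" for v using f \<sigma> by (auto simp: g_def rho_def)
  have lower: "real K * g v \<le> trunc_passage_cond a b (rho \<sigma>) K v" for K v
  proof (induction K arbitrary: v)
    case (Suc K)
    have "real K * g v \<le> real K * (rho \<sigma> v * env_op a b g v)" using super by (intro mult_left_mono) auto
    also have "\<dots> = rho \<sigma> v * env_op a b (\<lambda>v. real K * g v) v" unfolding env_op_scale by simp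
    also have "\<dots> \<le> rho \<sigma> v * env_op a b (trunc_passage_cond a b (rho \<sigma>) K) v"
      using rho_pos[of v] Suc by (intro mult_left_mono env_op_mono ab) auto
    finally show ?case using g_le[of v] by (simp add: algebra_simps)
  qed simp
  show ?thesis
  proof (rule that[of "env_mean a b g"])
    show "0 < env_mean a b g"
    proof (cases "f1 = 0")
      case True
      then show ?thesis using f ab by (simp add: env_mean_def g_def)
    next
      case False
      then show ?thesis using f ab by (auto simp: env_mean_def g_def intro!: divide_pos_pos add_pos_nonneg)
    qed
    show "real K * env_mean a b g \<le> trunc_passage_mean a b (rho \<sigma>) K" for K
    proof -
      have "real K * env_mean a b g = (b * (real K * g (-1)) + a * (real K * g 1)) / (a + b)"
        by (simp add: env_mean_def algebra_simps)
      also have "\<dots> \<le> trunc_passage_mean a b (rho \<sigma>) K"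
        unfolding trunc_passage_mean_def env_mean_def using lower[of K] ab by (intro divide_right_mono add_mono mult_left_mono) auto
      finally show ?thesis .
    qed
  qed
qed

text \<open>The zeros in \<open>p\<close> are \<open>1 / 2\<close> and
  \<open>(1 - b) / ((1 - a) + (1 - b))\<close>, the two ends of the ballistic range.\<close>

lemma ballistic_det_p:
  assumes "0 < p" "p < 1"
  shows "ballistic_det a b ((1 - p) / p) = (2 * p - 1) * ((1 - b) * (1 - p) - (1 - a) * p) / (p * (1 - p))"
  using assms by (simp add: ballistic_det_def field_simps)

lemma passage_mean_p:
  assumes ab: "0 < a" "a < 1" "0 < b" "b < 1" and p: "0 < p" "p < 1"
  shows "1 / passage_mean a b ((1 - p) / p) =
    (2 * p - 1) * (((1 - b) * (1 - p) - (1 - a) * p) /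
      ((b + (a - b) / (a + b)) * (1 - p) + (a - (a - b) / (a + b)) * p))"
proof -
  define \<sigma> where "\<sigma> = (1 - p) / p"
  \<comment> \<open>\<open>a + b\<close> times the denominator of the claimed formula. The identity
    \<open>N * (p * (1 - p)) = W\<close> is then polynomial, modulo the relations between
    \<open>\<sigma>\<close>, its inverse and \<open>p\<close>.\<close>
  define W where "W = (b * (a + b) + (a - b)) * (1 - p) + (a * (a + b) - (a - b)) * p"
  define N where "N = b * ((1 + 1 / \<sigma>) * (1 - (1 - b) * \<sigma>) + (1 + \<sigma>) * (a / \<sigma>)) +
      a * ((1 + \<sigma>) * (1 - (1 - a) / \<sigma>) + b * \<sigma> * (1 + 1 / \<sigma>))"
  have sp: "\<sigma> * p = 1 - p" "1 / \<sigma> * (1 - p) = p" "1 / \<sigma> * \<sigma> = 1" using p by (auto simp: \<sigma>_def)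
  define x where "x = 1 / \<sigma>"
  have x: "\<sigma> * p = 1 - p" "x * (1 - p) = p" "x * \<sigma> = 1" using sp by (auto simp: x_def)
  have "N = b * ((1 + x) * (1 - (1 - b) * \<sigma>) + (1 + \<sigma>) * (a * x)) + a * ((1 + \<sigma>) * (1 - (1 - a) * x) + b * \<sigma> * (1 + x))"
    by (simp add: N_def x_def)
  then have NW: "N * (p * (1 - p)) = W" unfolding W_def using x by algebra
  have W': "(b + (a - b) / (a + b)) * (1 - p) + (a - (a - b) / (a + b)) * p = W / (a + b)"
  proof -
    define X where "X = b * (a + b) + (a - b)"
    define Y where "Y = a * (a + b) - (a - b)"
    have "b + (a - b) / (a + b) = X / (a + b)" "a - (a - b) / (a + b) = Y / (a + b)"
      using ab by (simp_all add: X_def Y_def add_divide_distrib diff_divide_distrib)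
    moreover have "W = X * (1 - p) + Y * p" by (simp add: W_def X_def Y_def)
    ultimately show ?thesis by (simp add: add_divide_distrib)
  qed
  have "1 / passage_mean a b \<sigma> = (a + b) * ballistic_det a b \<sigma> / N"
    by (simp add: passage_mean_def N_def)
  also have "\<dots> = (a + b) * ((2 * p - 1) * ((1 - b) * (1 - p) - (1 - a) * p)) / (N * (p * (1 - p)))"
    unfolding \<sigma>_def ballistic_det_p[OF p] by simp
  also have "\<dots> = (2 * p - 1) * (((1 - b) * (1 - p) - (1 - a) * p) / (W / (a + b)))"
    unfolding NW by simp
  finally show ?thesis unfolding W' \<sigma>_def .
qed

text \<open>Levels proportional to the binary logarithm of \<open>j\<close>: errors geometric in the
  level decay like \<open>j^-4\<close>, while factors \<open>R ^ \<kappa> j\<close> grow only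
  polynomially.\<close>

lemma truncation_levels:
  fixes l R :: real
  assumes l: "0 < l" "l < 1" and R: "1 \<le> R"
  obtains \<kappa> :: "nat \<Rightarrow> nat" and r :: nat where "\<And>j. 1 \<le> j \<Longrightarrow> R ^ \<kappa> j \<le> real j ^ r"
    "\<And>j. 1 \<le> j \<Longrightarrow> l ^ \<kappa> j \<le> 16 / real j ^ 4"
proof -
  have "\<forall>j::nat. 1 \<le> j \<longrightarrow> (\<exists>L::nat. 2 ^ L \<le> j \<and> j < 2 ^ (L + 1))"
    using ex_power_ivl1[of 2] by auto
  then obtain L :: "nat \<Rightarrow> nat" where L: "\<And>j. 1 \<le> j \<Longrightarrow> 2 ^ L j \<le> j \<and> j < 2 ^ (L j + 1)"
    by metis
  \<comment> \<open>\<open>1 / 16 = 2^-4\<close> produces the fourth power. The constant 16 in the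
    conclusion pays for rounding \<open>j\<close> down to a power of two, which loses at most a
    factor 2.\<close>
  obtain q where q: "l ^ q < 1 / 16" using real_arch_pow_inv[of "1/16" l] l by auto
  obtain r where r: "R ^ q < 2 ^ r" using real_arch_pow[of 2 "R ^ q"] by auto
  show ?thesis
  proof (rule that[of "\<lambda>j. q * L j" r])
    fix j :: nat assume j: "1 \<le> j"
    have L1: "real (2 ^ L j) \<le> real j" and L2: "real j \<le> 2 * real (2 ^ L j)"
    proof -
      show "real (2 ^ L j) \<le> real j" using L[OF j] by (simp only: of_nat_le_iff)
      have "j \<le> 2 * 2 ^ L j" using L[OF j] by simp
      then have "real j \<le> real (2 * 2 ^ L j)" by (simp only: of_nat_le_iff)
      then show "real j \<le> 2 * real (2 ^ L j)" by simp
    qed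
    have "R ^ (q * L j) = (R ^ q) ^ L j" by (simp add: power_mult)
    also have "\<dots> \<le> (2 ^ r) ^ L j" using r R by (intro power_mono) auto
    also have "\<dots> = real (2 ^ L j) ^ r" by (simp add: power_mult[symmetric] mult.commute)
    also have "\<dots> \<le> real j ^ r" using L1 by (intro power_mono) auto
    finally show "R ^ (q * L j) \<le> real j ^ r" .
    have "l ^ (q * L j) = (l ^ q) ^ L j" by (simp add: power_mult)
    also have "\<dots> \<le> (1 / 16) ^ L j" using q l by (intro power_mono) auto
    also have "\<dots> = 1 / real (2 ^ L j) ^ 4"
    proof -
      have "(2 ^ L j) ^ 4 = (2 ^ 4 :: real) ^ L j" by (simp only: power_mult[symmetric] mult.commute)
      then show ?thesis by (simp add: power_one_over)
    qed
    also have "\<dots> \<le> 16 / real j ^ 4"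
    proof -
      have "real j ^ 4 \<le> (2 * real (2 ^ L j)) ^ 4" using L2 by (intro power_mono) auto
      also have "\<dots> = 16 * real (2 ^ L j) ^ 4" by (simp add: power_mult_distrib)
      finally show ?thesis using j by (simp add: field_simps)
    qed
    finally show "l ^ (q * L j) \<le> 16 / real j ^ 4" .
  qed
qed

section \<open>Quenched speed bounds\<close>

text \<open>Expressed by the forward recursion in the reflected environment, so that the moments
  computed for the reversed chain carry over directly.\<close>

definition trunc_passage :: "(int \<Rightarrow> real) \<Rightarrow> nat \<Rightarrow> int \<Rightarrow> real" where
  "trunc_passage r K x = trunc_passage_fwd (\<lambda>y. r (- y)) K (- x)"

lemma trunc_passage_0 [simp]: "trunc_passage r 0 x = 0"
  by (simp add: trunc_passage_def)

lemma trunc_passage_Suc: "trunc_passage r (Suc K) x = 1 + r x + r x * trunc_passage r K (x - 1)"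
  by (simp add: trunc_passage_def algebra_simps)

definition trunc_passage_inc :: "(int \<Rightarrow> real) \<Rightarrow> nat \<Rightarrow> int \<Rightarrow> real" where
  "trunc_passage_inc r K x = trunc_passage r (Suc K) x - trunc_passage r K x"

text \<open>Subtracting two consecutive recursions removes the inhomogeneous term
  \<open>1 + r x\<close>. The increments thus pick up the factor \<open>r x\<close> from one site to
  the next, exactly as \<open>scale\<close> does.\<close>

lemma trunc_passage_inc_Suc: "trunc_passage_inc r (Suc K) x = r x * trunc_passage_inc r K (x - 1)"
  unfolding trunc_passage_inc_def trunc_passage_Suc[of r "Suc K" x] trunc_passage_Suc[of r K x] by (simp add: algebra_simps)

lemma trunc_passage_inc_0: "trunc_passage_inc r 0 x = 1 + r x"
  by (simp add: trunc_passage_inc_def trunc_passage_Suc)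

lemma trunc_passage_inc_pos: "(\<And>x. 0 < r x) \<Longrightarrow> 0 < trunc_passage_inc r K x"
  by (induction K arbitrary: x) (auto simp: trunc_passage_inc_0 trunc_passage_inc_Suc add_pos_pos)

lemma trunc_passage_nonneg: "(\<And>x. 0 < r x) \<Longrightarrow> 0 \<le> trunc_passage r K x"
  by (induction K arbitrary: x) (auto simp: trunc_passage_Suc add_nonneg_nonneg less_imp_le)

text \<open>The discrete primitive of \<open>g\<close> that vanishes at \<open>c\<close>, with the
  right sign on both sides of \<open>c\<close>.\<close>

definition signed_sum :: "(int \<Rightarrow> real) \<Rightarrow> int \<Rightarrow> int \<Rightarrow> real" where
  "signed_sum g c y = (\<Sum>x\<in>{c..<y}. g x) - (\<Sum>x\<in>{y..<c}. g x)"

lemma signed_sum_step: "signed_sum g c (y + 1) - signed_sum g c y = g y"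
proof (cases "c \<le> y")
  case True
  then have "{c..<y+1} = insert y {c..<y}" "{y+1..<c} = {}" "{y..<c} = {}" by auto
  then show ?thesis by (simp add: signed_sum_def)
next
  case False
  then have "{y..<c} = insert y {y+1..<c}" "{c..<y+1} = {}" "{c..<y} = {}" by auto
  then show ?thesis by (simp add: signed_sum_def)
qed

lemma signed_sum_ge: "c \<le> y \<Longrightarrow> signed_sum g c y = (\<Sum>x\<in>{c..<y}. g x)"
  by (simp add: signed_sum_def)

lemma signed_sum_mono:
  assumes g: "\<And>x. 0 \<le> g x" and "y \<le> y'"
  shows "signed_sum g c y \<le> signed_sum g c y'"
  using assms(2)
proof (induction y' rule: int_ge_induct)
  case (step i)
  then show ?case using signed_sum_step[of g c i] g[of i] by linarith
qed simp

text \<open>The increment of the walk's harmonic function. Normalising at \<open>-1\<close> makes its values on either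
  half-line exponentials of partial sums of the environment from \<open>1\<close> or \<open>-1\<close> outwards.\<close>

definition scale :: "(int \<Rightarrow> real) \<Rightarrow> int \<Rightarrow> real" where
  "scale r x = (\<Prod>i\<in>{0..x}. r i) / (\<Prod>i\<in>{x+1..-1}. r i)"

lemma scale_pos: "(\<And>x. 0 < r x) \<Longrightarrow> 0 < scale r x"
  unfolding scale_def by (intro divide_pos_pos prod_pos) auto

lemma scale_rec:
  assumes r: "\<And>x. 0 < r x"
  shows "scale r x = r x * scale r (x - 1)"
proof (cases "0 \<le> x")
  case True
  then have "{0..x} = insert x {0..x-1}" "{x+1..-1} = {}" "{x..-1} = {}" by auto
  then show ?thesis by (simp add: scale_def)
next
  case False
  then have "{x..-1} = insert x {x+1..-1}" "{0..x} = {}" "{0..x-1} = {}" by auto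
  then show ?thesis using r[of x] by (simp add: scale_def)
qed

section \<open>The passage-time martingale in a fixed environment\<close>

locale bd_ratio = bd_walk +
  fixes r :: "int \<Rightarrow> real"
  assumes r_eq: "r x = (1 - w x) / w x"
begin

lemma r_pos: "0 < r x"
  using w_pos[of x] w_lt1[of x] by (simp add: r_eq)

lemma w_r: "w x * r x = 1 - w x" "w x * (1 + r x) = 1"
  using w_pos[of x] by (auto simp: r_eq field_simps)

sublocale bd_scale N Y w x0 "scale r"
proof
  show "0 < scale r x" for x by (rule scale_pos) (rule r_pos)
  show "w x * scale r x = (1 - w x) * scale r (x - 1)" for x
    using scale_rec[of r x, OF r_pos] w_r(1)[of x] by (metis mult.assoc)
qed

text \<open>For an exact passage time the primitive would have drift 1. Truncation replaces
  \<open>trunc_passage r (Suc (Suc K)) x\<close> by the smaller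
  \<open>trunc_passage r (Suc K) x\<close>, which lowers the drift by \<open>w x\<close> times the
  increment.\<close>

lemma drift: "w x * trunc_passage r (Suc K) x - (1 - w x) * trunc_passage r (Suc K) (x - 1) = 1 - w x * trunc_passage_inc r (Suc K) x"
proof -
  have "w x * trunc_passage r (Suc K) x - (1 - w x) * trunc_passage r (Suc K) (x - 1) =
      w x * trunc_passage r (Suc K) x - w x * (trunc_passage r (Suc (Suc K)) x - (1 + r x))"
    unfolding trunc_passage_Suc[of r "Suc K" x] w_r(1)[of x, symmetric] by (simp add: algebra_simps)
  also have "\<dots> = w x * (1 + r x) - w x * trunc_passage_inc r (Suc K) x"
    by (simp add: trunc_passage_inc_def algebra_simps)
  finally show ?thesis unfolding w_r(2) .
qed

text \<open>One site to the right, increments and \<open>scale\<close> acquire the same factor. The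
  ratio \<open>scale r (x + i) / scale r x\<close> in the Green bound thereby turns into an
  increment at a shifted site, leaving no denominator.\<close>

lemma trunc_passage_inc_scale: "trunc_passage_inc r K x * scale r (x + int i) = scale r x * trunc_passage_inc r (K + i) (x + int i)"
proof (induction i)
  case (Suc i)
  have "scale r (x + int (Suc i)) = r (x + int (Suc i)) * scale r (x + int i)"
    using scale_rec[of r "x + int (Suc i)", OF r_pos] by (simp add: add_ac)
  moreover have "trunc_passage_inc r (K + Suc i) (x + int (Suc i)) = r (x + int (Suc i)) * trunc_passage_inc r (K + i) (x + int i)"
    using trunc_passage_inc_Suc[of r "K + i" "x + int (Suc i)"] by (simp add: add_ac)
  ultimately show ?case using Suc by (simp add: mult_ac)
qed simp

text \<open>Depends on the environment only and is linear in the increments, so its annealed mean is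
  computable. The walk stays within \<open>n\<close> of \<open>x0\<close>, and shifts up to
  \<open>2 * n\<close> from any such \<open>x\<close> cover the range appearing in
  \<open>green\<close>.\<close>

definition slack_bound :: "nat \<Rightarrow> nat \<Rightarrow> real" where
  "slack_bound K n = (\<Sum>x\<in>{x0 - int n..x0 + int n}. \<Sum>i\<le>2 * n. trunc_passage_inc r (Suc K + i) (x + int i))"

lemma expected_slack:
  shows "integrable N (\<lambda>\<omega>. \<Sum>k<n. w (Y k \<omega>) * trunc_passage_inc r (Suc K) (Y k \<omega>))"
    and "expectation (\<lambda>\<omega>. \<Sum>k<n. w (Y k \<omega>) * trunc_passage_inc r (Suc K) (Y k \<omega>)) \<le> slack_bound K n"
proof -
  define s where "s x = w x * trunc_passage_inc r (Suc K) x" for x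
  let ?I = "{x0 - int n..x0 + int n}"
  have int_s: "integrable N (\<lambda>\<omega>. s (Y k \<omega>))" for k
    by (rule past_integrable[OF det_by_comp[where f = s, OF det_by_coord]]) auto
  then show "integrable N (\<lambda>\<omega>. \<Sum>k<n. w (Y k \<omega>) * trunc_passage_inc r (Suc K) (Y k \<omega>))"
    by (simp add: s_def)
  have s_exp: "expectation (\<lambda>\<omega>. s (Y k \<omega>)) = (\<Sum>x\<in>?I. s x * prob {\<omega>\<in>space N. Y k \<omega> = x})" if "k < n" for k
  proof -
    have "expectation (\<lambda>\<omega>. s (Y k \<omega>)) = expectation (\<lambda>\<omega>. \<Sum>x\<in>?I. s x * indicator {\<omega>\<in>space N. Y k \<omega> = x} \<omega>)"
    proof (rule integral_cong_AE)
      show "AE \<omega> in N. s (Y k \<omega>) = (\<Sum>x\<in>?I. s x * indicator {\<omega>\<in>space N. Y k \<omega> = x} \<omega>)"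
        using range AE_space
      proof eventually_elim
        case (elim \<omega>)
        then have "\<bar>Y k \<omega> - x0\<bar> \<le> int k" by blast
        with that have "Y k \<omega> \<in> ?I" by auto
        then have "(\<Sum>x\<in>?I. s x * indicator {\<omega>\<in>space N. Y k \<omega> = x} \<omega>) =
            (\<Sum>x\<in>{Y k \<omega>}. s x * indicator {\<omega>\<in>space N. Y k \<omega> = x} \<omega>)"
          by (intro sum.mono_neutral_right) auto
        with elim show ?case by simp
      qed
    qed measurable
    also have "\<dots> = (\<Sum>x\<in>?I. s x * prob {\<omega>\<in>space N. Y k \<omega> = x})"
      by (subst Bochner_Integration.integral_sum) (auto simp: emeasure_eq_measure)
    finally show ?thesis .
  qed
  have "expectation (\<lambda>\<omega>. \<Sum>k<n. s (Y k \<omega>)) = (\<Sum>k<n. \<Sum>x\<in>?I. s x * prob {\<omega>\<in>space N. Y k \<omega> = x})"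
    using int_s s_exp by (subst Bochner_Integration.integral_sum) auto
  also have "\<dots> = (\<Sum>x\<in>?I. s x * (\<Sum>k<n. prob {\<omega>\<in>space N. Y k \<omega> = x}))"
    by (subst sum.swap) (simp add: sum_distrib_left)
  also have "\<dots> \<le> (\<Sum>x\<in>?I. \<Sum>i\<le>2 * n. trunc_passage_inc r (Suc K + i) (x + int i))"
  proof (rule sum_mono)
    fix x assume x: "x \<in> ?I"
    define G where "G = (\<Sum>k<n. prob {\<omega>\<in>space N. Y k \<omega> = x})"
    have P0: "0 < scale r x" by (rule P_pos)
    have e0: "0 < trunc_passage_inc r (Suc K) x" by (rule trunc_passage_inc_pos) (rule r_pos)
    have "G * (w x * scale r x) \<le> (\<Sum>z\<in>{x..max x x0 + int n}. scale r z)"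
      unfolding G_def by (rule green)
    also have "\<dots> \<le> (\<Sum>z\<in>(\<lambda>i. x + int i) ` {..2 * n}. scale r z)"
    proof (rule sum_mono2)
      show "{x..max x x0 + int n} \<subseteq> (\<lambda>i. x + int i) ` {..2 * n}"
      proof
        fix z assume z: "z \<in> {x..max x x0 + int n}"
        then have "z = x + int (nat (z - x))" "nat (z - x) \<in> {..2 * n}" using x by auto
        then show "z \<in> (\<lambda>i. x + int i) ` {..2 * n}" by blast
      qed
    qed (auto intro: less_imp_le P_pos)
    also have "\<dots> = (\<Sum>i\<le>2 * n. scale r (x + int i))"
      by (subst sum.reindex) (auto intro: inj_onI)
    finally have "trunc_passage_inc r (Suc K) x * (G * (w x * scale r x)) \<le> trunc_passage_inc r (Suc K) x * (\<Sum>i\<le>2 * n. scale r (x + int i))"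
      using e0 by (intro mult_left_mono) auto
    also have "\<dots> = scale r x * (\<Sum>i\<le>2 * n. trunc_passage_inc r (Suc K + i) (x + int i))"
      unfolding sum_distrib_left by (intro sum.cong refl trunc_passage_inc_scale)
    finally have "scale r x * (s x * G) \<le> scale r x * (\<Sum>i\<le>2 * n. trunc_passage_inc r (Suc K + i) (x + int i))"
      by (simp add: s_def mult_ac)
    then show "s x * G \<le> (\<Sum>i\<le>2 * n. trunc_passage_inc r (Suc K + i) (x + int i))" using P0 by simp
  qed
  finally show "expectation (\<lambda>\<omega>. \<Sum>k<n. w (Y k \<omega>) * trunc_passage_inc r (Suc K) (Y k \<omega>)) \<le> slack_bound K n"
    by (simp add: s_def slack_bound_def)
qed

definition corr :: "nat \<Rightarrow> nat \<Rightarrow> 'a \<Rightarrow> real" where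
  "corr K n \<omega> = signed_sum (trunc_passage r (Suc K)) x0 (Y n \<omega>) - real n
     + (\<Sum>k<n. w (Y k \<omega>) * trunc_passage_inc r (Suc K) (Y k \<omega>))"

lemma corr_measurable [measurable]: "corr K n \<in> borel_measurable N"
  unfolding corr_def by measurable

lemma corr_L2:
  assumes bdd: "\<And>x. \<bar>trunc_passage r (Suc K) x\<bar> \<le> B"
  shows "integrable N (\<lambda>\<omega>. (corr K n \<omega>)\<^sup>2)"
    and "expectation (\<lambda>\<omega>. (corr K n \<omega>)\<^sup>2) \<le> 4 * B\<^sup>2 * real n"
    and "AE \<omega> in N. \<forall>n. \<bar>corr K (Suc n) \<omega> - corr K n \<omega>\<bar> \<le> 2 * B"
proof -
  have eq: "corr K n \<omega> = signed_sum (trunc_passage r (Suc K)) x0 (Y n \<omega>) - signed_sum (trunc_passage r (Suc K)) x0 x0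
      - (\<Sum>k<n. 1 - w (Y k \<omega>) * trunc_passage_inc r (Suc K) (Y k \<omega>))" for n \<omega>
    by (simp add: corr_def signed_sum_def sum_subtractf)
  note L2 = corrector_L2[of "trunc_passage r (Suc K)" B "signed_sum (trunc_passage r (Suc K)) x0" "\<lambda>x. 1 - w x * trunc_passage_inc r (Suc K) x",
      OF bdd signed_sum_step drift[symmetric]]
  show "integrable N (\<lambda>\<omega>. (corr K n \<omega>)\<^sup>2)" unfolding eq by (rule L2)
  show "expectation (\<lambda>\<omega>. (corr K n \<omega>)\<^sup>2) \<le> 4 * B\<^sup>2 * real n" unfolding eq by (rule L2)
  show "AE \<omega> in N. \<forall>n. \<bar>corr K (Suc n) \<omega> - corr K n \<omega>\<bar> \<le> 2 * B" unfolding eq by (rule L2)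
qed

text \<open>The compensator in \<open>corr\<close> is nonnegative, so dropping it still gives
  \<open>signed_sum\<close> at \<open>Y n\<close> at most \<open>(1 + \<eta>) * n\<close>. As the
  primitive grows at rate \<open>d\<close> to the right, the walk cannot have gone much beyond
  \<open>n / d\<close>.\<close>

theorem speed_upper:
  assumes bdd: "\<And>x. \<bar>trunc_passage r (Suc K) x\<bar> \<le> B"
    and avg: "(\<lambda>n. (\<Sum>x\<in>{x0..<x0 + int n}. trunc_passage r (Suc K) x) / real n) \<longlonglongrightarrow> d" and d: "0 < d"
  shows "AE \<omega> in N. \<forall>e>0. eventually (\<lambda>n. real_of_int (Y n \<omega>) \<le> (1 / d + e) * real n) sequentially"
proof -
  let ?h = "signed_sum (trunc_passage r (Suc K)) x0"
  have "AE \<omega> in N. (\<lambda>n. corr K n \<omega> / real n) \<longlonglongrightarrow> 0"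
    by (rule lipschitz_lln[OF _ corr_L2(1,2,3)[OF bdd]]) measurable
  then show ?thesis
  proof eventually_elim
    case (elim \<omega>)
    show ?case
    proof (intro allI impI)
      fix e :: real assume e: "0 < e"
      \<comment> \<open>The first bound keeps \<open>d - \<eta>\<close> at least
        \<open>d / 2\<close>; the second makes \<open>(1 + \<eta>) / (d - \<eta>)\<close> exceed
        \<open>1 / d\<close> by at most \<open>e / 2\<close>.\<close>
      define \<eta> where "\<eta> = min (d / 2) (e * d\<^sup>2 / (4 * (1 + d)))"
      have \<eta>: "0 < \<eta>" "\<eta> \<le> d / 2" "\<eta> \<le> e * d\<^sup>2 / (4 * (1 + d))"
      proof -
        show "0 < \<eta>" using d e by (simp add: \<eta>_def)
        show "\<eta> \<le> d / 2" unfolding \<eta>_def by (rule min.cobounded1)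
        show "\<eta> \<le> e * d\<^sup>2 / (4 * (1 + d))" unfolding \<eta>_def by (rule min.cobounded2)
      qed
      have ratio: "(1 + \<eta>) / (d - \<eta>) \<le> 1 / d + e / 2"
      proof -
        have cancel: "y / (4 * z) * z = y / 4" if "0 < z" for y z :: real using that by simp
        have "(1 + \<eta>) / (d - \<eta>) - 1 / d = \<eta> * (1 + d) / (d * (d - \<eta>))"
          using d \<eta> by (simp add: field_simps)
        also have "\<dots> \<le> \<eta> * (1 + d) / (d * (d / 2))"
          using d \<eta> by (intro divide_left_mono mult_left_mono mult_pos_pos) auto
        also have "\<dots> \<le> (e * d\<^sup>2 / (4 * (1 + d))) * (1 + d) / (d * (d / 2))"
          using d \<eta> by (intro divide_right_mono mult_right_mono) auto
        also have "(e * d\<^sup>2 / (4 * (1 + d))) * (1 + d) = e * d\<^sup>2 / 4"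
          by (rule cancel) (use d in simp)
        also have "e * d\<^sup>2 / 4 / (d * (d / 2)) = e / 2" using d by (simp add: power2_eq_square)
        finally show ?thesis by linarith
      qed
      have "eventually (\<lambda>n. d - \<eta> < (\<Sum>x\<in>{x0..<x0 + int n}. trunc_passage r (Suc K) x) / real n) sequentially"
        using order_tendstoD(1)[OF avg, of "d - \<eta>"] \<eta> by simp
      then obtain m0 where m0: "\<And>m. m0 \<le> m \<Longrightarrow> d - \<eta> < (\<Sum>x\<in>{x0..<x0 + int m}. trunc_passage r (Suc K) x) / real m"
        by (auto simp: eventually_sequentially)
      have lower: "(d - \<eta>) * real m \<le> ?h (x0 + int m)" if "max 1 m0 \<le> m" for m
        using m0[of m] that by (simp add: signed_sum_ge pos_less_divide_eq)
      have "eventually (\<lambda>n. corr K n \<omega> / real n < \<eta>) sequentially"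
        using order_tendstoD(2)[OF elim] \<eta> by blast
      moreover have "eventually (\<lambda>n. \<bar>real_of_int x0\<bar> + real (max 1 m0) \<le> e / 2 * real n) sequentially"
      proof -
        obtain n0 :: nat where n0: "(\<bar>real_of_int x0\<bar> + real (max 1 m0)) / (e / 2) \<le> real n0"
          using real_arch_simple by blast
        have "\<bar>real_of_int x0\<bar> + real (max 1 m0) \<le> e / 2 * real n" if "n0 \<le> n" for n
        proof -
          have "(\<bar>real_of_int x0\<bar> + real (max 1 m0)) / (e / 2) \<le> real n" using n0 that by linarith
          then show ?thesis using e by (simp add: pos_divide_le_eq mult.commute)
        qed
        then show ?thesis by (auto simp: eventually_sequentially)
      qed
      ultimately show "eventually (\<lambda>n. real_of_int (Y n \<omega>) \<le> (1 / d + e) * real n) sequentially"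
        using eventually_gt_at_top[of 0]
      proof eventually_elim
        case (elim n)
        have Dn: "corr K n \<omega> \<le> \<eta> * real n" using elim by (simp add: pos_divide_less_eq)
        have "0 \<le> (\<Sum>k<n. w (Y k \<omega>) * trunc_passage_inc r (Suc K) (Y k \<omega>))"
          by (intro sum_nonneg mult_nonneg_nonneg less_imp_le w_pos trunc_passage_inc_pos r_pos)
        with Dn have h: "?h (Y n \<omega>) \<le> (1 + \<eta>) * real n" by (simp add: corr_def algebra_simps)
        define m where "m = nat (Y n \<omega> - x0)"
        have "real_of_int (Y n \<omega>) - real_of_int x0 \<le> real (max 1 m0) + (1 / d + e / 2) * real n"
        proof (cases "max 1 m0 \<le> m")
          case True
          then have Y: "Y n \<omega> = x0 + int m" by (auto simp: m_def)
          have "(d - \<eta>) * real m \<le> (1 + \<eta>) * real n" using lower[OF True] h Y by simp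
          then have "real m \<le> (1 + \<eta>) / (d - \<eta>) * real n"
            using \<eta> d by (simp add: pos_le_divide_eq mult.commute)
          also have "\<dots> \<le> (1 / d + e / 2) * real n" using ratio by (intro mult_right_mono) auto
          finally show ?thesis using Y by simp
        next
          case False
          then have "Y n \<omega> - x0 \<le> int (max 1 m0)" by (auto simp: m_def)
          then have "real_of_int (Y n \<omega>) - real_of_int x0 \<le> real (max 1 m0)"
            by (metis of_int_diff of_int_le_iff of_int_of_nat_eq)
          moreover have "0 \<le> (1 / d + e / 2) * real n" using d e by simp
          ultimately show ?thesis by linarith
        qed
        then show ?case using elim(2) by (simp add: algebra_simps)
      qed
    qed
  qed
qed

text \<open>Of the three units of \<open>\<eta>\<close>, one covers the martingale, one the
  compensator, and one is a strict gap. A walk still to the left of \<open>x0 + m j\<close> at time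
  \<open>t j\<close> would, the primitive being monotone, have value at most
  \<open>(1 - 3 * \<eta>) * t j\<close>, although the value exceeds
  \<open>(1 - 2 * \<eta>) * t j\<close>.\<close>

theorem speed_lower:
  fixes \<kappa> t m :: "nat \<Rightarrow> nat"
  assumes bdd: "\<And>j x. \<bar>trunc_passage r (Suc (\<kappa> j)) x\<bar> \<le> B j"
    and \<eta>: "0 < \<eta>"
    and t: "eventually (\<lambda>j. 0 < t j) sequentially"
    and B: "summable (\<lambda>j. (B j)\<^sup>2 / real (t j))"
    and c: "summable c" "eventually (\<lambda>j. slack_bound (\<kappa> j) (t j) \<le> c j * real (t j)) sequentially"
    and sum: "eventually (\<lambda>j. (\<Sum>x\<in>{x0..<x0 + int (m j)}. trunc_passage r (Suc (\<kappa> j)) x) \<le> (1 - 3 * \<eta>) * real (t j)) sequentially"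
  shows "AE \<omega> in N. eventually (\<lambda>j. x0 + int (m j) \<le> Y (t j) \<omega>) sequentially"
proof -
  have "AE \<omega> in N. eventually (\<lambda>j. \<not> \<eta> * real (t j) \<le> \<bar>corr (\<kappa> j) (t j) \<omega>\<bar>) sequentially"
  proof (rule borel_cantelli_eventually)
    show "summable (\<lambda>j. 4 / \<eta>\<^sup>2 * ((B j)\<^sup>2 / real (t j)))" by (rule summable_mult[OF B])
    show "eventually (\<lambda>j. prob {\<omega>\<in>space N. \<eta> * real (t j) \<le> \<bar>corr (\<kappa> j) (t j) \<omega>\<bar>} \<le> 4 / \<eta>\<^sup>2 * ((B j)\<^sup>2 / real (t j))) sequentially"
      using t
    proof eventually_elim
      case (elim j)
      have "prob {\<omega>\<in>space N. \<eta> * real (t j) \<le> \<bar>corr (\<kappa> j) (t j) \<omega>\<bar>}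
          \<le> expectation (\<lambda>\<omega>. (corr (\<kappa> j) (t j) \<omega>)\<^sup>2) / (\<eta> * real (t j))\<^sup>2"
        using elim \<eta> by (intro chebyshev_abs corr_L2(1)[OF bdd]) auto
      also have "\<dots> \<le> (4 * (B j)\<^sup>2 * real (t j)) / (\<eta> * real (t j))\<^sup>2"
        by (intro divide_right_mono corr_L2(2)[OF bdd]) auto
      also have "\<dots> = 4 / \<eta>\<^sup>2 * ((B j)\<^sup>2 / real (t j))"
        using elim by (simp add: power2_eq_square)
      finally show ?case .
    qed
  qed measurable
  moreover have "AE \<omega> in N. eventually (\<lambda>j. \<not> \<eta> * real (t j) \<le>
      (\<Sum>k<t j. w (Y k \<omega>) * trunc_passage_inc r (Suc (\<kappa> j)) (Y k \<omega>))) sequentially"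
  proof (rule borel_cantelli_eventually)
    show "summable (\<lambda>j. c j / \<eta>)" by (rule summable_divide[OF c(1)])
    show "eventually (\<lambda>j. prob {\<omega>\<in>space N. \<eta> * real (t j) \<le>
      (\<Sum>k<t j. w (Y k \<omega>) * trunc_passage_inc r (Suc (\<kappa> j)) (Y k \<omega>))} \<le> c j / \<eta>) sequentially"
      using t c(2)
    proof eventually_elim
      case (elim j)
      have "prob {\<omega>\<in>space N. \<eta> * real (t j) \<le> (\<Sum>k<t j. w (Y k \<omega>) * trunc_passage_inc r (Suc (\<kappa> j)) (Y k \<omega>))}
          \<le> expectation (\<lambda>\<omega>. \<Sum>k<t j. w (Y k \<omega>) * trunc_passage_inc r (Suc (\<kappa> j)) (Y k \<omega>)) / (\<eta> * real (t j))"
        using elim \<eta>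
        by (intro integral_Markov_inequality_measure[where A = "{}"] expected_slack AE_I2 sum_nonneg
            mult_nonneg_nonneg less_imp_le[OF w_pos] less_imp_le[OF trunc_passage_inc_pos] r_pos) auto
      also have "\<dots> \<le> (c j * real (t j)) / (\<eta> * real (t j))"
        using elim \<eta> by (intro divide_right_mono order_trans[OF expected_slack(2)]) auto
      also have "\<dots> = c j / \<eta>" using elim by simp
      finally show ?case .
    qed
  qed measurable
  ultimately show ?thesis
  proof eventually_elim
    case (elim \<omega>)
    from elim sum t show ?case
    proof eventually_elim
      case (elim j)
      let ?h = "signed_sum (trunc_passage r (Suc (\<kappa> j))) x0"
      have h: "(1 - 2 * \<eta>) * real (t j) < ?h (Y (t j) \<omega>)"
        using elim(1,2) unfolding corr_def not_le by (simp add: algebra_simps abs_less_iff)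
      show ?case
      proof (rule ccontr)
        assume "\<not> x0 + int (m j) \<le> Y (t j) \<omega>"
        then have "?h (Y (t j) \<omega>) \<le> ?h (x0 + int (m j))"
          by (intro signed_sum_mono trunc_passage_nonneg r_pos) auto
        also have "\<dots> \<le> (1 - 3 * \<eta>) * real (t j)" using elim(3) by (simp add: signed_sum_ge)
        finally have "(1 - 2 * \<eta>) * real (t j) < (1 - 3 * \<eta>) * real (t j)" using h by linarith
        then show False using elim(4) \<eta> by simp
      qed
    qed
  qed
qed

end

section \<open>Speed bounds for almost every environment\<close>

definition step_prob :: "real \<Rightarrow> (int \<Rightarrow> int) \<Rightarrow> int \<Rightarrow> real" where
  "step_prob p u x = (if u x = 1 then p else 1 - p)"

definition odds :: "real \<Rightarrow> real" where
  "odds p = (1 - p) / p"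

text \<open>One-sided speed to the right, zero when the truncated mean passage times diverge. The
  drift will be its difference with the value at \<open>1 - p\<close>.\<close>

definition speed :: "real \<Rightarrow> real \<Rightarrow> real \<Rightarrow> real" where
  "speed a b p = (if ballistic_det a b (odds p) \<le> 0 then 0 else 1 / passage_mean a b (odds p))"

lemma scale_exp:
  assumes \<sigma>: "0 < \<sigma>" and u: "\<And>x. u x = -1 \<or> u x = (1::int)"
  shows "scale (\<lambda>x. rho \<sigma> (u x)) (int n) = rho \<sigma> (u 0) * exp (ln \<sigma> * of_int (\<Sum>x\<in>{1..int n}. u x))"
    and "scale (\<lambda>x. rho \<sigma> (u x)) (- int n - 1) = exp (- ln \<sigma> * of_int (\<Sum>x\<in>{1..int n}. u (- x)))"
proof -
  have rho: "rho \<sigma> (u x) = exp (ln \<sigma> * of_int (u x))" for x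
    using u[of x] \<sigma> by (auto simp: rho_def exp_minus divide_inverse)
  have "{0..int n} = insert 0 {1..int n}" "{int n + 1..-1} = {}" by auto
  then show "scale (\<lambda>x. rho \<sigma> (u x)) (int n) = rho \<sigma> (u 0) * exp (ln \<sigma> * of_int (\<Sum>x\<in>{1..int n}. u x))"
    by (simp add: scale_def rho exp_sum[symmetric] sum_distrib_left[symmetric] distrib_left exp_add)
  have "(\<Sum>i\<in>{- int n..-1}. real_of_int (u i)) = (\<Sum>x\<in>{1..int n}. real_of_int (u (- x)))"
    by (rule sum.reindex_bij_witness[of _ uminus uminus]) auto
  moreover have "{0..- int n - 1} = {}" by auto
  ultimately show "scale (\<lambda>x. rho \<sigma> (u x)) (- int n - 1) = exp (- ln \<sigma> * of_int (\<Sum>x\<in>{1..int n}. u (- x)))"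
    by (simp add: scale_def rho exp_sum[symmetric] sum_distrib_left[symmetric] exp_minus divide_inverse)
qed

lemma left_sums_unbounded:
  fixes P :: "int \<Rightarrow> real"
  assumes pos: "\<And>x. 0 < P x" and inf: "\<And>n0. \<exists>n\<ge>n0. 1 \<le> P (- int n - 1)"
  shows "\<exists>l. C < (\<Sum>z\<in>{l..<0}. P z)"
proof -
  have "\<exists>l\<le>0. real k \<le> (\<Sum>z\<in>{l..<0}. P z)" for k :: nat
  proof (induction k)
    case 0
    show ?case by (intro exI[of _ 0]) simp
  next
    case (Suc k)
    then obtain l where l: "l \<le> 0" "real k \<le> (\<Sum>z\<in>{l..<0}. P z)" by blast
    obtain n where n: "nat (- l) \<le> n" "1 \<le> P (- int n - 1)" using inf by blast
    define l' where "l' = - int n - 1"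
    have "real k + 1 \<le> (\<Sum>z\<in>{l..<0}. P z) + P l'" using l n by (simp add: l'_def)
    also have "\<dots> = (\<Sum>z\<in>insert l' {l..<0}. P z)" using n by (subst sum.insert) (auto simp: l'_def)
    also have "\<dots> \<le> (\<Sum>z\<in>{l'..<0}. P z)" using n l by (intro sum_mono2) (auto simp: l'_def less_imp_le[OF pos])
    finally show ?case using l n by (intro exI[of _ l']) (auto simp: l'_def)
  qed
  moreover obtain k where "C < real k" using reals_Archimedean2 by blast
  ultimately show ?thesis by (meson less_le_trans)
qed

lemma right_sums_bounded:
  fixes P :: "int \<Rightarrow> real"
  assumes pos: "\<And>x. 0 < P x" and sm: "summable (\<lambda>n. P (int n))"
  shows "\<exists>C. \<forall>m. (\<Sum>z\<in>{x..m}. P z) \<le> C"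
proof (intro exI allI)
  fix m
  have "(\<Sum>z\<in>{x..m}. P z) \<le> (\<Sum>z\<in>{x..<0} \<union> int ` {..nat m}. P z)"
  proof (rule sum_mono2)
    show "{x..m} \<subseteq> {x..<0} \<union> int ` {..nat m}"
    proof
      fix z assume z: "z \<in> {x..m}"
      show "z \<in> {x..<0} \<union> int ` {..nat m}"
      proof (cases "z < 0")
        case False
        then have "z = int (nat z)" "nat z \<in> {..nat m}" using z by auto
        then show ?thesis by blast
      qed (use z in auto)
    qed
  qed (auto intro: less_imp_le[OF pos])
  also have "\<dots> = (\<Sum>z\<in>{x..<0}. P z) + (\<Sum>z\<in>int ` {..nat m}. P z)"
    by (rule sum.union_disjoint) auto
  also have "(\<Sum>z\<in>int ` {..nat m}. P z) = (\<Sum>n\<le>nat m. P (int n))"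
    by (subst sum.reindex) (auto intro: inj_onI)
  also have "\<dots> \<le> (\<Sum>n. P (int n))"
    by (rule sum_le_suminf[OF sm]) (auto intro: less_imp_le[OF pos])
  finally show "(\<Sum>z\<in>{x..m}. P z) \<le> (\<Sum>z\<in>{x..<0}. P z) + (\<Sum>n. P (int n))" by simp
qed

lemma ceiling_ratio_tendsto_1:
  fixes \<theta> :: real
  assumes \<theta>: "0 < \<theta>" and q: "0 < q"
  defines "t \<equiv> \<lambda>j::nat. nat \<lceil>\<theta> * real (j ^ q)\<rceil>"
  shows "filterlim t at_top sequentially"
    and "(\<lambda>j. real (t (Suc j)) / real (t j)) \<longlonglongrightarrow> 1"
proof -
  define z where "z j = \<theta> * real (j ^ q)" for j
  have t: "z j \<le> real (t j)" "real (t j) \<le> z j + 1" for j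
  proof -
    have "0 \<le> z j" using \<theta> by (simp add: z_def)
    then have "real (t j) = of_int \<lceil>z j\<rceil>" by (simp add: t_def z_def)
    then show "z j \<le> real (t j)" "real (t j) \<le> z j + 1" by linarith+
  qed
  have pow: "filterlim (\<lambda>j. real (j ^ q)) at_top sequentially"
    by (rule filterlim_compose[OF filterlim_real_sequentially filterlim_power_nat[OF q]])
  have z_top: "filterlim z at_top sequentially"
    unfolding z_def by (rule filterlim_tendsto_pos_mult_at_top[OF tendsto_const \<theta> pow])
  have "filterlim (\<lambda>j. real (t j)) at_top sequentially"
    by (rule filterlim_at_top_mono[OF z_top]) (use t in simp)
  then show "filterlim t at_top sequentially" by (simp add: filterlim_sequentially_iff_filterlim_real)
  have z_pos: "0 < z j" if "0 < j" for j using that \<theta> by (simp add: z_def)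
  have tz: "(\<lambda>j. real (t j) / z j) \<longlonglongrightarrow> 1"
  proof (rule real_tendsto_sandwich[where f = "\<lambda>_. 1" and h = "\<lambda>j. 1 + inverse (z j)"])
    have "(\<lambda>j. 1 + inverse (z j)) \<longlonglongrightarrow> 1 + 0"
      by (intro tendsto_add tendsto_const tendsto_inverse_0_at_top z_top)
    then show "(\<lambda>j. 1 + inverse (z j)) \<longlonglongrightarrow> 1" by simp
    show "eventually (\<lambda>j. 1 \<le> real (t j) / z j) sequentially"
      using eventually_gt_at_top[of 0]
      by eventually_elim (use t z_pos in \<open>simp add: pos_le_divide_eq\<close>)
    show "eventually (\<lambda>j. real (t j) / z j \<le> 1 + inverse (z j)) sequentially"
      using eventually_gt_at_top[of 0]
    proof eventually_elim
      case (elim j)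
      have "real (t j) / z j \<le> (z j + 1) / z j" using t z_pos[OF elim] by (intro divide_right_mono) auto
      also have "\<dots> = 1 + inverse (z j)" using z_pos[OF elim] by (simp add: field_simps)
      finally show ?case .
    qed
  qed simp
  have zz: "(\<lambda>j. z (Suc j) / z j) \<longlonglongrightarrow> 1"
    using power_ratio_tendsto_1[of q] \<theta> by (simp add: z_def)
  have "(\<lambda>j. (real (t (Suc j)) / z (Suc j)) * (z (Suc j) / z j) / (real (t j) / z j)) \<longlonglongrightarrow> 1 * 1 / 1"
    by (intro tendsto_divide tendsto_mult LIMSEQ_Suc[OF tz] zz tz) simp
  then have "(\<lambda>j. (real (t (Suc j)) / z (Suc j)) * (z (Suc j) / z j) / (real (t j) / z j)) \<longlonglongrightarrow> 1" by simp
  then show "(\<lambda>j. real (t (Suc j)) / real (t j)) \<longlonglongrightarrow> 1"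
  proof (rule Lim_transform_eventually)
    show "eventually (\<lambda>j. (real (t (Suc j)) / z (Suc j)) * (z (Suc j) / z j) / (real (t j) / z j) =
        real (t (Suc j)) / real (t j)) sequentially"
      using eventually_gt_at_top[of 0]
      by eventually_elim (use z_pos in \<open>simp add: less_imp_neq[THEN not_sym]\<close>)
  qed
qed

lemma (in bd_walk) step_prob_reflect:
  assumes "w = step_prob p u"
  shows "bd_walk N (\<lambda>n \<omega>. - Y n \<omega>) (step_prob (1 - p) (\<lambda>x. u (- x))) (- x0)"
proof -
  have "(\<lambda>x. 1 - w (- x)) = step_prob (1 - p) (\<lambda>x. u (- x))"
    unfolding assms by (auto simp: step_prob_def)
  with reflect show ?thesis by simp
qed

locale swap_env = markov_env L U a b for L :: "'w measure" and U a b +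
  fixes p :: real
  assumes p: "0 < p" "p < 1"
begin

abbreviation "\<sigma> \<equiv> odds p"
abbreviation "r \<omega> \<equiv> (\<lambda>x. rho \<sigma> (U x \<omega>))"
definition R :: real where "R = \<sigma> + 1 / \<sigma> + 2"

lemma sigma_pos: "0 < \<sigma>"
  using p by (simp add: odds_def)

text \<open>Reversal preserves \<open>a\<close> and \<open>b\<close>, so the truncated passage times
  of the walk have the moments of \<open>F\<close> for these same parameters.\<close>

sublocale rev: env_rho L "\<lambda>i. U (- i)" a b "rho \<sigma>" R
proof -
  interpret rv: markov_env L "\<lambda>i. U (- i)" a b by (rule env_reverse)
  show "env_rho L (\<lambda>i. U (- i)) a b (rho \<sigma>) R"
    by unfold_locales (use sigma_pos in \<open>auto simp: rho_def R_def\<close>)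
qed

lemma swap_reverse: "swap_env L (\<lambda>i. U (- i)) a b (1 - p)"
proof -
  interpret rv: markov_env L "\<lambda>i. U (- i)" a b by (rule env_reverse)
  show ?thesis by unfold_locales (use p in auto)
qed

lemma bd_ratio_swap:
  assumes "bd_walk N Y (step_prob p (\<lambda>i. U i \<omega>)) x0"
  shows "bd_ratio N Y (step_prob p (\<lambda>i. U i \<omega>)) x0 (r \<omega>)"
proof -
  interpret W: bd_walk N Y "step_prob p (\<lambda>i. U i \<omega>)" x0 by fact
  show ?thesis by unfold_locales (use p in \<open>simp add: rho_def step_prob_def odds_def\<close>)
qed

lemma trunc_passage_rev: "trunc_passage (r \<omega>) K x = rev.F K (- x) \<omega>"
  by (simp add: trunc_passage_def rev.F_def)

lemma trunc_passage_bound: "\<omega> \<in> space L \<Longrightarrow> \<bar>trunc_passage (r \<omega>) K x\<bar> \<le> R ^ K"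
  using rev.F_bounds[where K = K and x = "- x" and \<omega> = \<omega>] unfolding trunc_passage_rev by simp

abbreviation "d K \<equiv> trunc_passage_mean a b (rho \<sigma>) K"

text \<open>Reflection sends the \<open>n\<close> sites from \<open>x0\<close> on to a block
  starting at \<open>1 - x0 - n\<close>; its upper end is left unsimplified to match
  \<open>F_variance\<close>.\<close>

lemma sum_trunc_passage: "(\<Sum>x\<in>{x0..<x0 + int n}. trunc_passage (r \<omega>) K x - d K) =
    (\<Sum>y\<in>{1 - x0 - int n..<1 - x0 - int n + int n}. rev.F K y \<omega> - d K)"
  unfolding trunc_passage_rev by (rule sum.reindex_bij_witness[of _ uminus uminus]) auto

lemma d_ge_1: "1 \<le> d (Suc K)"
proof -
  have "1 \<le> trunc_passage_cond a b (rho \<sigma>) (Suc K) v" if "v = -1 \<or> v = 1" for v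
  proof -
    have "0 \<le> env_op a b (trunc_passage_cond a b (rho \<sigma>) K) v"
      using rev.env_op_mono_bounds[of 0 "trunc_passage_cond a b (rho \<sigma>) K" "R ^ K - 1"] rev.trunc_passage_cond_bounds[of _ K] by blast
    then show ?thesis using rev.rho_pos[of v] by (simp add: add_nonneg_nonneg)
  qed
  from this[of 1] this[of "-1"] have "(b * 1 + a * 1) / (a + b) \<le> d (Suc K)"
    unfolding trunc_passage_mean_def env_mean_def using ab by (intro divide_right_mono add_mono mult_left_mono) auto
  then show ?thesis using ab by (simp add: add.commute)
qed

lemma passage_average:
  "AE \<omega> in L. \<forall>K. (\<lambda>n. (\<Sum>x\<in>{x0..<x0 + int n}. trunc_passage (r \<omega>) K x) / real n) \<longlonglongrightarrow> d K"
  unfolding AE_all_countable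
proof
  fix K
  define Z where "Z n \<omega> = (\<Sum>x\<in>{x0..<x0 + int n}. trunc_passage (r \<omega>) K x - d K)" for n \<omega>
  have Z: "Z n = (\<lambda>\<omega>. \<Sum>y\<in>{1 - x0 - int n..<1 - x0 - int n + int n}. rev.F K y \<omega> - d K)" for n
    unfolding Z_def by (intro ext sum_trunc_passage)
  have "AE \<omega> in L. (\<lambda>n. Z n \<omega> / real n) \<longlonglongrightarrow> 0"
  proof (rule lipschitz_lln)
    show "Z n \<in> borel_measurable L" for n unfolding Z by measurable
    show "integrable L (\<lambda>\<omega>. (Z n \<omega>)\<^sup>2)" for n unfolding Z by (rule rev.F_variance)
    show "expectation (\<lambda>\<omega>. (Z n \<omega>)\<^sup>2) \<le> rev.F_var K * real n" for n unfolding Z by (rule rev.F_variance)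
    show "AE \<omega> in L. \<forall>n. \<bar>Z (Suc n) \<omega> - Z n \<omega>\<bar> \<le> R ^ K + \<bar>d K\<bar>"
      using AE_space
    proof eventually_elim
      case (elim \<omega>)
      have "Z (Suc n) \<omega> - Z n \<omega> = trunc_passage (r \<omega>) K (x0 + int n) - d K" for n
      proof -
        have "{x0..<x0 + int (Suc n)} = insert (x0 + int n) {x0..<x0 + int n}" by auto
        then show ?thesis by (simp add: Z_def)
      qed
      then show ?case using trunc_passage_bound[OF elim, of K] by (auto intro!: order_trans[OF abs_triangle_ineq4] add_right_mono)
    qed
  qed
  then show "AE \<omega> in L. (\<lambda>n. (\<Sum>x\<in>{x0..<x0 + int n}. trunc_passage (r \<omega>) K x) / real n) \<longlonglongrightarrow> d K"
  proof eventually_elim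
    case (elim \<omega>)
    have eq: "Z n \<omega> / real n + d K = (\<Sum>x\<in>{x0..<x0 + int n}. trunc_passage (r \<omega>) K x) / real n" if "0 < n" for n
      using that by (simp add: Z_def sum_subtractf field_simps)
    have "(\<lambda>n. Z n \<omega> / real n + d K) \<longlonglongrightarrow> 0 + d K" by (intro tendsto_add elim tendsto_const)
    then have "(\<lambda>n. Z n \<omega> / real n + d K) \<longlonglongrightarrow> d K" by simp
    then show ?case
      by (rule Lim_transform_eventually) (use eventually_gt_at_top[of 0] in \<open>eventually_elim, use eq in auto\<close>)
  qed
qed

text \<open>Both regimes at once: \<open>d\<close> either grows linearly, giving the limit 0, or
  converges to \<open>passage_mean\<close>. So the upper bounds by \<open>1 / d (Suc K)\<close>
  improve to \<open>speed\<close>.\<close>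

lemma inverse_passage_tendsto: "(\<lambda>K. 1 / d (Suc K)) \<longlonglongrightarrow> speed a b p"
proof (cases "ballistic_det a b \<sigma> \<le> 0")
  case True
  obtain c where c: "0 < c" "\<And>K. real K * c \<le> d K"
    by (rule trunc_passage_mean_linear_growth[OF ab sigma_pos True]) blast
  have "filterlim (\<lambda>K. real (Suc K) * c) at_top sequentially"
    by (rule filterlim_at_top_mult_tendsto_pos[OF tendsto_const c(1)])
       (rule filterlim_compose[OF filterlim_real_sequentially filterlim_Suc])
  then have "filterlim (\<lambda>K. d (Suc K)) at_top sequentially"
    by (rule filterlim_at_top_mono) (intro always_eventually allI c(2))
  from tendsto_inverse_0_at_top[OF this] True show ?thesis by (simp add: speed_def inverse_eq_divide)
next
  case False
  then obtain C l where l: "0 < l" "l < 1" "\<And>K. d K \<le> passage_mean a b \<sigma>"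
    "\<And>K. passage_mean a b \<sigma> - d K \<le> C * l ^ K" "0 < passage_mean a b \<sigma>"
    using trunc_passage_mean_geometric[OF ab sigma_pos] by (metis not_le)
  have "(\<lambda>K. passage_mean a b \<sigma> - C * l ^ K) \<longlonglongrightarrow> passage_mean a b \<sigma> - C * 0"
    using l by (intro tendsto_intros LIMSEQ_realpow_zero) auto
  then have "d \<longlonglongrightarrow> passage_mean a b \<sigma>"
    by (intro real_tendsto_sandwich[of "\<lambda>K. passage_mean a b \<sigma> - C * l ^ K" d _ "\<lambda>_. passage_mean a b \<sigma>"] always_eventually allI)
       (use l in \<open>auto simp: diff_le_eq algebra_simps\<close>)
  then have "(\<lambda>K. 1 / d (Suc K)) \<longlonglongrightarrow> 1 / passage_mean a b \<sigma>"
    using l(5) by (intro tendsto_divide tendsto_const LIMSEQ_Suc) auto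
  with False show ?thesis by (simp add: speed_def)
qed

text \<open>The exceptional environments are fixed before any walk is given. With all walks
  quantified inside the almost sure statement, it applies to the kernel \<open>Q u\<close> at each
  \<open>u\<close> and also to the reflected walk.\<close>

theorem walk_speed_upper:
  "AE \<omega> in L. \<forall>(N :: 'n measure) Y. bd_walk N Y (step_prob p (\<lambda>i. U i \<omega>)) x0 \<longrightarrow>
     (AE x in N. \<forall>e>0. eventually (\<lambda>n. real_of_int (Y n x) \<le> (speed a b p + e) * real n) sequentially)"
  using passage_average[of x0] AE_space
proof eventually_elim
  case (elim \<omega>)
  show ?case
  proof (intro allI impI)
    fix N :: "'n measure" and Y
    assume "bd_walk N Y (step_prob p (\<lambda>i. U i \<omega>)) x0"
    then interpret W: bd_ratio N Y "step_prob p (\<lambda>i. U i \<omega>)" x0 "r \<omega>" by (rule bd_ratio_swap)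
    have "AE x in N. \<forall>e>0. eventually (\<lambda>n. real_of_int (Y n x) \<le> (1 / d (Suc K) + e) * real n) sequentially" for K
      using elim(1) d_ge_1[of K] by (intro W.speed_upper[OF trunc_passage_bound[OF elim(2)]]) auto
    then have "AE x in N. \<forall>K. \<forall>e>0. eventually (\<lambda>n. real_of_int (Y n x) \<le> (1 / d (Suc K) + e) * real n) sequentially"
      unfolding AE_all_countable by blast
    then show "AE x in N. \<forall>e>0. eventually (\<lambda>n. real_of_int (Y n x) \<le> (speed a b p + e) * real n) sequentially"
    proof eventually_elim
      case (elim x)
      show ?case
      proof (intro allI impI)
        fix e :: real assume e: "0 < e"
        have "eventually (\<lambda>K. 1 / d (Suc K) < speed a b p + e / 2) sequentially"
          using order_tendstoD(2)[OF inverse_passage_tendsto] e by simp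
        then obtain K where K: "1 / d (Suc K) < speed a b p + e / 2"
          by (meson eventually_happens sequentially_bot)
        have "eventually (\<lambda>n. real_of_int (Y n x) \<le> (1 / d (Suc K) + e / 2) * real n) sequentially"
          using elim e by simp
        then show "eventually (\<lambda>n. real_of_int (Y n x) \<le> (speed a b p + e) * real n) sequentially"
        proof eventually_elim
          case (elim n)
          have "(1 / d (Suc K) + e / 2) * real n \<le> (speed a b p + e) * real n"
            using K by (intro mult_right_mono) auto
          with elim show ?case by linarith
        qed
      qed
    qed
  qed
qed

text \<open>The mean of an increment does not depend on the site, so the diagonal sum over shifts
  telescopes.\<close>

lemma slack_expectation:
  shows "integrable L (\<lambda>\<omega>. \<Sum>x\<in>A. \<Sum>i\<le>n. trunc_passage_inc (r \<omega>) (K + i) (x + int i))"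
    and "expectation (\<lambda>\<omega>. \<Sum>x\<in>A. \<Sum>i\<le>n. trunc_passage_inc (r \<omega>) (K + i) (x + int i)) =
      real (card A) * (d (Suc (K + n)) - d K)"
proof -
  have inc: "trunc_passage_inc (r \<omega>) K x = rev.F (Suc K) (- x) \<omega> - rev.F K (- x) \<omega>" for K x \<omega>
    unfolding trunc_passage_inc_def trunc_passage_rev ..
  have int: "integrable L (\<lambda>\<omega>. trunc_passage_inc (r \<omega>) K x)" for K x
    unfolding inc by (intro Bochner_Integration.integrable_diff rev.F_integrable)
  then show "integrable L (\<lambda>\<omega>. \<Sum>x\<in>A. \<Sum>i\<le>n. trunc_passage_inc (r \<omega>) (K + i) (x + int i))"
    by (intro Bochner_Integration.integrable_sum)
  have ex: "expectation (\<lambda>\<omega>. trunc_passage_inc (r \<omega>) K x) = d (Suc K) - d K" for K x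
    unfolding inc by (simp only: Bochner_Integration.integral_diff[OF rev.F_integrable rev.F_integrable] rev.F_mean)
  have tele: "(\<Sum>i\<le>n. d (Suc (K + i)) - d (K + i)) = d (Suc (K + n)) - d K"
    by (induction n) auto
  have "expectation (\<lambda>\<omega>. \<Sum>x\<in>A. \<Sum>i\<le>n. trunc_passage_inc (r \<omega>) (K + i) (x + int i)) =
      (\<Sum>x\<in>A. \<Sum>i\<le>n. expectation (\<lambda>\<omega>. trunc_passage_inc (r \<omega>) (K + i) (x + int i)))"
    using int by (simp add: Bochner_Integration.integral_sum Bochner_Integration.integrable_sum)
  also have "\<dots> = real (card A) * (d (Suc (K + n)) - d K)" unfolding ex tele by simp
  finally show "expectation (\<lambda>\<omega>. \<Sum>x\<in>A. \<Sum>i\<le>n. trunc_passage_inc (r \<omega>) (K + i) (x + int i)) =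
      real (card A) * (d (Suc (K + n)) - d K)" .
qed

lemma trunc_passage_inc_measurable [measurable]: "(\<lambda>\<omega>. trunc_passage_inc (r \<omega>) K x) \<in> borel_measurable L"
  unfolding trunc_passage_inc_def trunc_passage_rev by measurable

text \<open>The factor linear in \<open>K\<close> is absorbed by one more \<open>R ^ K\<close>, as
  \<open>K + 1 \<le> 2 ^ K\<close> and \<open>R\<close> is at least 2. Hence a third power, which is
  polynomial in \<open>j\<close> at level \<open>\<kappa> j\<close>.\<close>

lemma F_var_le: "rev.F_var (Suc K) \<le> (6 + 2 * rev.S_var) * R\<^sup>2 * (R ^ K) ^ 3"
proof -
  define A where "A = R ^ K"
  have "real (Suc K) \<le> 2 ^ K" by (metis Suc_leI less_exp of_nat_le_iff of_nat_numeral of_nat_power)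
  also have "\<dots> \<le> A" unfolding A_def using rev.R_ge by (intro power_mono) auto
  finally have KA: "real K + 1 \<le> A" by simp
  have A1: "1 \<le> A" using KA by simp
  have S: "0 \<le> rev.S_var"
  proof -
    have "\<bar>1 - a - b\<bar> < 1" using ab by (simp add: abs_less_iff)
    then show ?thesis by (simp add: rev.S_var_def)
  qed
  have "2 * (2 * real (Suc K) + 1) + 2 * rev.S_var \<le> 6 * A + 2 * rev.S_var * A"
    using KA A1 S mult_left_mono[of 1 A "2 * rev.S_var"] by simp
  then have "rev.F_var (Suc K) \<le> (6 * A + 2 * rev.S_var * A) * (R ^ Suc K)\<^sup>2"
    unfolding rev.F_var_def by (rule mult_right_mono) simp
  also have "\<dots> = (6 + 2 * rev.S_var) * R\<^sup>2 * A ^ 3"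
    by (simp add: A_def power2_eq_square power3_eq_cube algebra_simps)
  finally show ?thesis by (simp add: A_def)
qed

text \<open>With \<open>\<theta>\<close> above the mean passage time, the walk should have passed
  \<open>x0 + j ^ q\<close> by time about \<open>\<theta> * j ^ q\<close>. As the truncation level
  moves with \<open>j\<close>, the environment averages and the slack are controlled anew for each
  \<open>j\<close>, by Borel-Cantelli.\<close>

lemma walk_speed_lower_theta:
  assumes bal: "0 < ballistic_det a b \<sigma>" and \<theta>: "passage_mean a b \<sigma> < \<theta>"
  shows "AE \<omega> in L. \<forall>(N :: 'n measure) Y. bd_walk N Y (step_prob p (\<lambda>i. U i \<omega>)) x0 \<longrightarrow>
     (AE x in N. \<forall>e>0. eventually (\<lambda>n. (1 / \<theta> - e) * real n \<le> real_of_int (Y n x)) sequentially)"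
proof -
  define D where "D = passage_mean a b \<sigma>"
  obtain C l where l: "0 < l" "l < 1" and dD: "\<And>K. d K \<le> D" "\<And>K. D - d K \<le> C * l ^ K" "0 < D"
    unfolding D_def by (rule trunc_passage_mean_geometric[OF ab sigma_pos bal]) metis
  have \<theta>D: "D < \<theta>" "0 < \<theta>" using \<theta> dD(3) by (auto simp: D_def)
  have C: "0 \<le> C" using dD(1,2)[of 0] by simp
  have R1: "1 \<le> R" using rev.R_ge by simp
  obtain \<kappa> rr where \<kappa>: "\<And>j. 1 \<le> j \<Longrightarrow> R ^ \<kappa> j \<le> real j ^ rr" "\<And>j. 1 \<le> j \<Longrightarrow> l ^ \<kappa> j \<le> 16 / real j ^ 4"
    by (rule truncation_levels[OF l R1]) metis
  \<comment> \<open>\<open>3 * rr\<close> cancels the cube of \<open>R ^ \<kappa> j\<close> in the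
    variance; the extra 2 leaves the summable \<open>1 / j^2\<close>.\<close>
  define q where "q = 3 * rr + 2"
  define m where "m j = j ^ q" for j :: nat
  define t where "t j = nat \<lceil>\<theta> * real (j ^ q)\<rceil>" for j :: nat
  have q: "0 < q" by (simp add: q_def)
  have t_lim: "filterlim t at_top sequentially" and t_ratio: "(\<lambda>j. real (t (Suc j)) / real (t j)) \<longlonglongrightarrow> 1"
    using ceiling_ratio_tendsto_1[OF \<theta>D(2) q] unfolding t_def by auto
  have t_ge: "\<theta> * real (m j) \<le> real (t j)" for j
    using \<theta>D(2) unfolding t_def m_def by (simp add: of_nat_nat)
  have t_le: "real (t j) \<le> \<theta> * real (m j) + 1" for j
  proof -
    have "0 \<le> \<theta> * real (j ^ q)" using \<theta>D by simp
    then have "real (t j) = of_int \<lceil>\<theta> * real (j ^ q)\<rceil>" by (simp add: t_def)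
    then show ?thesis unfolding m_def by linarith
  qed
  have m_pos: "0 < m j" if "1 \<le> j" for j using that by (simp add: m_def)
  have t_pos: "0 < t j" if "1 \<le> j" for j
  proof -
    have "0 < \<theta> * real (m j)" using \<theta>D m_pos[OF that] by simp
    then show ?thesis using t_ge[of j] by (metis less_le_trans of_nat_0_less_iff)
  qed
  have m_split: "real (m j) = real j ^ (3 * rr) * real j ^ 2" for j
    by (simp add: m_def q_def power_add power2_eq_square)
  \<comment> \<open>Half of the margin \<open>\<theta> - D\<close> is left to the fluctuation of the
    environment average, the other half to the walk as \<open>3 * \<eta> * \<theta>\<close>; hence
    \<open>(1 - 3 * \<eta>) * \<theta> = D + \<eta>'\<close>.\<close>
  define \<eta>' where "\<eta>' = (\<theta> - D) / 2"
  define \<eta> where "\<eta> = (\<theta> - D) / (6 * \<theta>)"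
  have \<eta>: "0 < \<eta>" "0 < \<eta>'" "(1 - 3 * \<eta>) * \<theta> = D + \<eta>'" "0 \<le> 1 - 3 * \<eta>"
    using \<theta>D dD(3) by (auto simp: \<eta>_def \<eta>'_def field_simps)
  define C1 where "C1 = (6 + 2 * rev.S_var) * R\<^sup>2 / \<eta>'\<^sup>2"
  have inv2: "summable (\<lambda>j. c * inverse (real j ^ 2))" for c :: real
    by (intro summable_mult inverse_power_summable) simp
  define dev where "dev j \<omega> =
    (\<Sum>y\<in>{1 - x0 - int (m j)..<1 - x0 - int (m j) + int (m j)}. rev.F (Suc (\<kappa> j)) y \<omega> - d (Suc (\<kappa> j)))" for j \<omega>
  have [measurable]: "dev j \<in> borel_measurable L" for j unfolding dev_def by measurable
  note dev_var = rev.F_variance[where c = "1 - x0 - int (m j)" and n = "m j" and K = "Suc (\<kappa> j)" for j, folded dev_def]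
  have E1: "AE \<omega> in L. eventually (\<lambda>j. \<not> \<eta>' * real (m j) \<le>
      \<bar>dev j \<omega>\<bar>) sequentially"
  proof (rule borel_cantelli_eventually[OF _ inv2[of C1]])
    show "eventually (\<lambda>j. prob {\<omega>\<in>space L. \<eta>' * real (m j) \<le>
      \<bar>dev j \<omega>\<bar>}
        \<le> C1 * inverse (real j ^ 2)) sequentially"
      using eventually_ge_at_top[of 1]
    proof eventually_elim
      case (elim j)
      have S6: "0 \<le> (6 + 2 * rev.S_var) * R\<^sup>2"
      proof -
        have "\<bar>1 - a - b\<bar> < 1" using ab by (simp add: abs_less_iff)
        then show ?thesis by (simp add: rev.S_var_def)
      qed
      have "prob {\<omega>\<in>space L. \<eta>' * real (m j) \<le>
        \<bar>dev j \<omega>\<bar>}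
        \<le> expectation (\<lambda>\<omega>. (dev j \<omega>)\<^sup>2) / (\<eta>' * real (m j))\<^sup>2"
        using \<eta> m_pos[OF elim] by (intro chebyshev_abs dev_var) auto
      also have "\<dots> \<le> (rev.F_var (Suc (\<kappa> j)) * real (m j)) / (\<eta>' * real (m j))\<^sup>2"
        by (intro divide_right_mono dev_var) auto
      also have "\<dots> = rev.F_var (Suc (\<kappa> j)) / (\<eta>'\<^sup>2 * real (m j))"
        using m_pos[OF elim] by (simp add: power2_eq_square)
      also have "\<dots> \<le> ((6 + 2 * rev.S_var) * R\<^sup>2 * (real j ^ (3 * rr))) / (\<eta>'\<^sup>2 * real (m j))"
      proof (rule divide_right_mono)
        have "(R ^ \<kappa> j) ^ 3 \<le> (real j ^ rr) ^ 3" using \<kappa>(1)[OF elim] R1 by (intro power_mono) auto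
        also have "\<dots> = real j ^ (3 * rr)" by (simp add: power_mult[symmetric] mult.commute)
        finally show "rev.F_var (Suc (\<kappa> j)) \<le> (6 + 2 * rev.S_var) * R\<^sup>2 * (real j ^ (3 * rr))"
          using S6 by (intro order_trans[OF F_var_le] mult_left_mono)
      qed simp
      also have "\<dots> = C1 * inverse (real j ^ 2)"
      proof -
        have cancel: "c * y / (h * (y * z)) = c / h * inverse z" if "y \<noteq> 0" for c y h z :: real
          using that by (simp add: divide_inverse)
        show ?thesis unfolding m_split C1_def by (rule cancel) (use elim in simp)
      qed
      finally show ?case .
    qed
  qed measurable
  define sl where "sl j \<omega> = (\<Sum>x\<in>{x0 - int (t j)..x0 + int (t j)}. \<Sum>i\<le>2 * t j. trunc_passage_inc (r \<omega>) (Suc (\<kappa> j) + i) (x + int i))" for j \<omega>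
  have [measurable]: "sl j \<in> borel_measurable L" for j unfolding sl_def by measurable
  have sl_int: "integrable L (sl j)" for j unfolding sl_def[abs_def] by (rule slack_expectation)
  have sl_nonneg: "0 \<le> sl j \<omega>" for j \<omega>
    unfolding sl_def by (intro sum_nonneg less_imp_le trunc_passage_inc_pos rev.rho_pos)
  \<comment> \<open>The mean slack is of order \<open>t j / j^4\<close>. Two powers of
    \<open>j\<close> make the slack negligible against \<open>t j\<close>, the other two make the
    Markov bounds summable.\<close>
  have E2: "AE \<omega> in L. eventually (\<lambda>j. \<not> inverse (real j ^ 2) * real (t j) \<le> sl j \<omega>) sequentially"
  proof (rule borel_cantelli_eventually[OF _ inv2[of "48 * C"]])
    show "eventually (\<lambda>j. prob {\<omega>\<in>space L. inverse (real j ^ 2) * real (t j) \<le> sl j \<omega>} \<le> 48 * C * inverse (real j ^ 2)) sequentially"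
      using eventually_ge_at_top[of 1]
    proof eventually_elim
      case (elim j)
      have "prob {\<omega>\<in>space L. inverse (real j ^ 2) * real (t j) \<le> sl j \<omega>}
          \<le> expectation (sl j) / (inverse (real j ^ 2) * real (t j))"
        using elim t_pos[OF elim]
        by (intro integral_Markov_inequality_measure[where A = "{}"] AE_I2 sl_nonneg)
           (use sl_int in auto)
      also have "expectation (sl j) = real (2 * t j + 1) * (d (Suc (Suc (\<kappa> j) + 2 * t j)) - d (Suc (\<kappa> j)))"
        unfolding sl_def slack_expectation by (simp add: nat_add_distrib)
      also have "\<dots> \<le> (3 * real (t j)) * (16 * C / real j ^ 4)"
      proof (rule mult_mono)
        have "d (Suc (Suc (\<kappa> j) + 2 * t j)) - d (Suc (\<kappa> j)) \<le> C * l ^ Suc (\<kappa> j)"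
          using dD(1)[of "Suc (Suc (\<kappa> j) + 2 * t j)"] dD(2)[of "Suc (\<kappa> j)"] by linarith
        also have "\<dots> \<le> C * l ^ \<kappa> j" using C l by (intro mult_left_mono power_decreasing) auto
        also have "\<dots> \<le> C * (16 / real j ^ 4)" using C \<kappa>(2)[OF elim] by (intro mult_left_mono)
        finally show "d (Suc (Suc (\<kappa> j) + 2 * t j)) - d (Suc (\<kappa> j)) \<le> 16 * C / real j ^ 4" by (simp add: mult.commute)
        \<comment> \<open>The order of the two values of \<open>d\<close> is read off from the
          nonnegative mean of \<open>sl j\<close>.\<close>
        have "0 \<le> real (2 * t j + 1) * (d (Suc (Suc (\<kappa> j) + 2 * t j)) - d (Suc (\<kappa> j)))"
        proof -
          have "0 \<le> expectation (sl j)" by (intro integral_nonneg_AE AE_I2 sl_nonneg)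
          then show ?thesis unfolding sl_def slack_expectation by (simp add: nat_add_distrib)
        qed
        then show "0 \<le> d (Suc (Suc (\<kappa> j) + 2 * t j)) - d (Suc (\<kappa> j))"
          by (simp add: zero_le_mult_iff)
      qed (use t_pos[OF elim] in auto)
      then have "real (2 * t j + 1) * (d (Suc (Suc (\<kappa> j) + 2 * t j)) - d (Suc (\<kappa> j))) / (inverse (real j ^ 2) * real (t j))
          \<le> (3 * real (t j)) * (16 * C / real j ^ 4) / (inverse (real j ^ 2) * real (t j))"
        by (intro divide_right_mono) auto
      also have "\<dots> = 48 * C * inverse (real j ^ 2)"
        using elim t_pos[OF elim] by (simp add: field_simps power2_eq_square power4_eq_xxxx)
      finally show ?case by linarith
    qed
  qed measurable
  from E1 E2 AE_space show ?thesis
  proof eventually_elim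
    case (elim \<omega>)
    show ?case
    proof (intro allI impI)
      fix N :: "'n measure" and Y
      assume "bd_walk N Y (step_prob p (\<lambda>i. U i \<omega>)) x0"
      then interpret W: bd_ratio N Y "step_prob p (\<lambda>i. U i \<omega>)" x0 "r \<omega>" by (rule bd_ratio_swap)
      have "AE x in N. eventually (\<lambda>j. x0 + int (m j) \<le> Y (t j) x) sequentially"
      proof (rule W.speed_lower[where \<kappa> = \<kappa> and B = "\<lambda>j. R ^ Suc (\<kappa> j)" and \<eta> = \<eta> and c = "\<lambda>j. inverse (real j ^ 2)"])
        show "\<bar>trunc_passage (r \<omega>) (Suc (\<kappa> j)) x\<bar> \<le> R ^ Suc (\<kappa> j)" for j x by (rule trunc_passage_bound[OF elim(3)])
        show "0 < \<eta>" by fact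
        show "eventually (\<lambda>j. 0 < t j) sequentially"
          using eventually_ge_at_top[of 1] by eventually_elim (rule t_pos)
        show "summable (\<lambda>j. inverse (real j ^ 2))" by (rule inverse_power_summable) simp
        show "summable (\<lambda>j. (R ^ Suc (\<kappa> j))\<^sup>2 / real (t j))"
        proof (rule summable_comparison_test_ev[OF _ inv2[of "R\<^sup>2 / \<theta>"]])
          show "eventually (\<lambda>j. norm ((R ^ Suc (\<kappa> j))\<^sup>2 / real (t j)) \<le> R\<^sup>2 / \<theta> * inverse (real j ^ 2)) sequentially"
            using eventually_ge_at_top[of 1]
          proof eventually_elim
            case (elim j)
            have "(R ^ Suc (\<kappa> j))\<^sup>2 = R\<^sup>2 * (R ^ \<kappa> j)\<^sup>2" by (simp add: power_mult_distrib)
            also have "\<dots> \<le> R\<^sup>2 * (real j ^ rr)\<^sup>2" using \<kappa>(1)[OF elim] R1 by (intro mult_left_mono power_mono) auto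
            also have "(real j ^ rr)\<^sup>2 = real j ^ (2 * rr)" by (simp add: power_mult[symmetric] mult.commute)
            also have "R\<^sup>2 * real j ^ (2 * rr) \<le> R\<^sup>2 * real j ^ (3 * rr)"
              using elim by (intro mult_left_mono power_increasing) auto
            finally have "(R ^ Suc (\<kappa> j))\<^sup>2 / real (t j) \<le> R\<^sup>2 * real j ^ (3 * rr) / (\<theta> * real (m j))"
              using t_ge[of j] m_pos[OF elim] \<theta>D by (intro frac_le) auto
            also have "\<dots> = R\<^sup>2 / \<theta> * inverse (real j ^ 2)"
              using elim \<theta>D unfolding m_split by (simp add: field_simps)
            finally show ?case by simp
          qed
        qed
        show "eventually (\<lambda>j. W.slack_bound (\<kappa> j) (t j) \<le> inverse (real j ^ 2) * real (t j)) sequentially"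
          using elim(2) by eventually_elim (simp add: sl_def W.slack_bound_def)
        show "eventually (\<lambda>j. (\<Sum>x\<in>{x0..<x0 + int (m j)}. trunc_passage (r \<omega>) (Suc (\<kappa> j)) x) \<le> (1 - 3 * \<eta>) * real (t j)) sequentially"
          using elim(1)
        proof eventually_elim
          case (elim j)
          then have "(\<Sum>x\<in>{x0..<x0 + int (m j)}. trunc_passage (r \<omega>) (Suc (\<kappa> j)) x - d (Suc (\<kappa> j))) \<le> \<eta>' * real (m j)"
            unfolding sum_trunc_passage dev_def by linarith
          then have "(\<Sum>x\<in>{x0..<x0 + int (m j)}. trunc_passage (r \<omega>) (Suc (\<kappa> j)) x) \<le> real (m j) * d (Suc (\<kappa> j)) + \<eta>' * real (m j)"
            by (simp add: sum_subtractf)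
          also have "\<dots> \<le> real (m j) * D + \<eta>' * real (m j)" using dD(1) by (intro add_right_mono mult_left_mono) auto
          also have "\<dots> = (1 - 3 * \<eta>) * (\<theta> * real (m j))" unfolding mult.assoc[symmetric] \<eta>(3) by (simp add: algebra_simps)
          also have "\<dots> \<le> (1 - 3 * \<eta>) * real (t j)" using t_ge \<eta>(4) by (intro mult_left_mono)
          finally show ?case .
        qed
      qed
      then show "AE x in N. \<forall>e>0. eventually (\<lambda>n. (1 / \<theta> - e) * real n \<le> real_of_int (Y n x)) sequentially"
        using W.nearest_neighbour
      proof eventually_elim
        case (elim x)
        show ?case
        proof (intro allI impI)
          fix e :: real assume e: "0 < e"
          have "eventually (\<lambda>j. (1 / \<theta> - real_of_int x0) / (e / 2) \<le> real (t j)) sequentially"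
            using filterlim_compose[OF filterlim_real_sequentially t_lim] by (simp add: filterlim_at_top)
          with elim(1) have low: "eventually (\<lambda>j. (1 / \<theta> - e / 2) * real (t j) \<le> real_of_int (Y (t j) x)) sequentially"
          proof eventually_elim
            case (elim j)
            have "1 / \<theta> - real_of_int x0 \<le> e / 2 * real (t j)" using elim(2) e by (simp add: pos_divide_le_eq mult.commute)
            moreover have "real (t j) / \<theta> \<le> real (m j) + 1 / \<theta>"
              using t_le[of j] \<theta>D by (simp add: field_simps)
            moreover have "real_of_int x0 + real (m j) \<le> real_of_int (Y (t j) x)"
              using elim(1) by (metis of_int_add of_int_le_iff of_int_of_nat_eq)
            ultimately show ?case by (simp add: left_diff_distrib)
          qed
          have "eventually (\<lambda>n. (1 / \<theta> - e / 2 - e / 2) * real n \<le> real_of_int (Y n x)) sequentially"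
          proof (rule lipschitz_subsequence_lower_bound[where B = 1 and y = "\<lambda>n. real_of_int (Y n x)", OF _ t_lim t_ratio low])
            show "\<bar>real_of_int (Y (Suc n) x) - real_of_int (Y n x)\<bar> \<le> 1" for n
              using elim(2)[rule_format, of n] by auto
          qed (use e in simp)
          then show "eventually (\<lambda>n. (1 / \<theta> - e) * real n \<le> real_of_int (Y n x)) sequentially" by simp
        qed
      qed
    qed
  qed
qed

end

section \<open>Transience, recurrence and the environment law\<close>

context swap_env
begin

theorem walk_speed_lower:
  assumes bal: "0 < ballistic_det a b \<sigma>"
  shows "AE \<omega> in L. \<forall>(N :: 'n measure) Y. bd_walk N Y (step_prob p (\<lambda>i. U i \<omega>)) x0 \<longrightarrow>
     (AE x in N. \<forall>e>0. eventually (\<lambda>n. (speed a b p - e) * real n \<le> real_of_int (Y n x)) sequentially)"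
proof -
  define D where "D = passage_mean a b \<sigma>"
  have D: "0 < D" unfolding D_def by (rule trunc_passage_mean_geometric[OF ab sigma_pos bal])
  have sp: "speed a b p = 1 / D" using bal by (simp add: speed_def D_def)
  \<comment> \<open>Countably many values decreasing to \<open>D\<close> suffice, so a single null
    set of environments serves for all of them.\<close>
  define \<theta> where "\<theta> i = D + inverse (real (Suc i))" for i
  have "(\<lambda>i. 1 / \<theta> i) \<longlonglongrightarrow> 1 / (D + 0)"
    unfolding \<theta>_def using D by (intro tendsto_divide tendsto_add tendsto_const LIMSEQ_inverse_real_of_nat) auto
  then have lim: "(\<lambda>i. 1 / \<theta> i) \<longlonglongrightarrow> speed a b p" by (simp add: sp)
  have "AE \<omega> in L. \<forall>i. \<forall>(N :: 'n measure) Y. bd_walk N Y (step_prob p (\<lambda>i. U i \<omega>)) x0 \<longrightarrow>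
     (AE x in N. \<forall>e>0. eventually (\<lambda>n. (1 / \<theta> i - e) * real n \<le> real_of_int (Y n x)) sequentially)"
    unfolding AE_all_countable
  proof
    fix i
    have "passage_mean a b \<sigma> < \<theta> i" by (simp add: \<theta>_def D_def)
    then show "AE \<omega> in L. \<forall>(N :: 'n measure) Y. bd_walk N Y (step_prob p (\<lambda>i. U i \<omega>)) x0 \<longrightarrow>
       (AE x in N. \<forall>e>0. eventually (\<lambda>n. (1 / \<theta> i - e) * real n \<le> real_of_int (Y n x)) sequentially)"
      by (rule walk_speed_lower_theta[OF bal])
  qed
  then show ?thesis
  proof eventually_elim
    case (elim \<omega>)
    show ?case
    proof (intro allI impI)
      fix N :: "'n measure" and Y
      assume "bd_walk N Y (step_prob p (\<lambda>i. U i \<omega>)) x0"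
      with elim have "AE x in N. \<forall>i. \<forall>e>0. eventually (\<lambda>n. (1 / \<theta> i - e) * real n \<le> real_of_int (Y n x)) sequentially"
        unfolding AE_all_countable by blast
      then show "AE x in N. \<forall>e>0. eventually (\<lambda>n. (speed a b p - e) * real n \<le> real_of_int (Y n x)) sequentially"
      proof eventually_elim
        case (elim x)
        show ?case
        proof (intro allI impI)
          fix e :: real assume e: "0 < e"
          have "eventually (\<lambda>i. speed a b p - e / 2 < 1 / \<theta> i) sequentially"
            using order_tendstoD(1)[OF lim] e by simp
          then obtain i where i: "speed a b p - e / 2 < 1 / \<theta> i"
            by (meson eventually_happens sequentially_bot)
          have "eventually (\<lambda>n. (1 / \<theta> i - e / 2) * real n \<le> real_of_int (Y n x)) sequentially"
            using elim e by simp
          then show "eventually (\<lambda>n. (speed a b p - e) * real n \<le> real_of_int (Y n x)) sequentially"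
          proof eventually_elim
            case (elim n)
            have "(speed a b p - e) * real n \<le> (1 / \<theta> i - e / 2) * real n"
              using i by (intro mult_right_mono) auto
            with elim show ?case by linarith
          qed
        qed
      qed
    qed
  qed
qed

lemma r_values: "\<omega> \<in> space L \<Longrightarrow> scale (r \<omega>) (int n) = rho \<sigma> (U 0 \<omega>) * exp (ln \<sigma> * of_int (V n \<omega>))"
  "\<omega> \<in> space L \<Longrightarrow> scale (r \<omega>) (- int n - 1) = exp (- ln \<sigma> * of_int (rev.V n \<omega>))"
  using scale_exp[OF sigma_pos, of "\<lambda>x. U x \<omega>" n] U_val by (simp_all add: V_def rev.V_def)

lemma left_scale_unbounded:
  assumes \<omega>: "\<omega> \<in> space L" and inf: "\<And>n0. \<exists>n\<ge>n0. 0 \<le> - ln \<sigma> * of_int (rev.V n \<omega>)"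
  shows "\<exists>l. C < (\<Sum>z\<in>{l..<0}. scale (r \<omega>) z)"
proof (rule left_sums_unbounded)
  show "0 < scale (r \<omega>) x" for x by (rule scale_pos) (rule rev.rho_pos)
  show "\<exists>n\<ge>n0. 1 \<le> scale (r \<omega>) (- int n - 1)" for n0
    using inf[of n0] unfolding r_values(2)[OF \<omega>] one_le_exp_iff .
qed

lemma reverse_lln: "AE \<omega> in L. (\<lambda>n. of_int (rev.V n \<omega>) / real n) \<longlonglongrightarrow> \<mu>"
proof -
  have "rev.\<mu> = \<mu>" by (simp add: rev.\<mu>_def \<mu>_def)
  with rev.env_lln show ?thesis by (simp add: rev.V_def)
qed

text \<open>On both half-lines the environment sums grow like \<open>\<mu> * n\<close>. With a
  negative product \<open>ln \<sigma> * \<mu>\<close> the scale increments decay geometrically to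
  the right and are eventually at least 1 to the left, as \<open>transient_right\<close>
  requires.\<close>

theorem walk_transient_right:
  assumes drift: "ln \<sigma> * \<mu> < 0"
  shows "AE \<omega> in L. \<forall>(N :: 'n measure) Y. bd_walk N Y (step_prob p (\<lambda>i. U i \<omega>)) x0 \<longrightarrow>
     (AE x in N. \<forall>k. eventually (\<lambda>n. k \<le> Y n x) sequentially)"
  using env_lln reverse_lln AE_space
proof eventually_elim
  case (elim \<omega>)
  have V_lim: "(\<lambda>n. of_int (V n \<omega>) / real n) \<longlonglongrightarrow> \<mu>" using elim(1) by (simp add: V_def)
  define g where "g = - (ln \<sigma> * \<mu>) / 2"
  have g: "0 < g" "ln \<sigma> * \<mu> < - g" using drift unfolding g_def by linarith+
  have neg: "eventually (\<lambda>n. ln \<sigma> * of_int (v n) \<le> - g * real n) sequentially"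
    if v: "(\<lambda>n. of_int (v n) / real n) \<longlonglongrightarrow> \<mu>" for v :: "nat \<Rightarrow> int"
  proof -
    have "(\<lambda>n. ln \<sigma> * (of_int (v n) / real n)) \<longlonglongrightarrow> ln \<sigma> * \<mu>" by (intro tendsto_mult tendsto_const v)
    then have "eventually (\<lambda>n. ln \<sigma> * (of_int (v n) / real n) < - g) sequentially"
      using order_tendstoD(2) g by blast
    then show ?thesis using eventually_gt_at_top[of 0]
    proof eventually_elim
      case (elim n)
      then have "ln \<sigma> * of_int (v n) / real n < - g" by simp
      then show ?case using elim(2) by (simp only: pos_divide_less_eq of_nat_0_less_iff less_imp_le)
    qed
  qed
  have unb: "\<exists>l. C < (\<Sum>z\<in>{l..<0}. scale (r \<omega>) z)" for C
  proof (rule left_scale_unbounded[OF elim(3)])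
    obtain n1 where n1: "\<And>n. n1 \<le> n \<Longrightarrow> ln \<sigma> * of_int (rev.V n \<omega>) \<le> - g * real n"
      using neg[OF elim(2)] by (auto simp: eventually_sequentially)
    show "\<exists>n\<ge>n0. 0 \<le> - ln \<sigma> * of_int (rev.V n \<omega>)" for n0
    proof (intro exI[of _ "max n0 n1"] conjI)
      have "- g * real (max n0 n1) \<le> 0" using g by simp
      then show "0 \<le> - ln \<sigma> * of_int (rev.V (max n0 n1) \<omega>)" using n1[of "max n0 n1"] by simp
    qed simp
  qed
  have bdd: "\<exists>C. \<forall>m. (\<Sum>z\<in>{x..m}. scale (r \<omega>) z) \<le> C" for x
  proof (rule right_sums_bounded)
    show "0 < scale (r \<omega>) x" for x by (rule scale_pos) (rule rev.rho_pos)
    have geo: "summable (\<lambda>n. rho \<sigma> (U 0 \<omega>) * exp (- g) ^ n)"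
      using g by (intro summable_mult summable_geometric) simp
    show "summable (\<lambda>n. scale (r \<omega>) (int n))"
    proof (rule summable_comparison_test_ev[OF _ geo])
      show "eventually (\<lambda>n. norm (scale (r \<omega>) (int n)) \<le> rho \<sigma> (U 0 \<omega>) * exp (- g) ^ n) sequentially"
        using neg[OF V_lim]
      proof eventually_elim
        case (elim n)
        have "exp (ln \<sigma> * of_int (V n \<omega>)) \<le> exp (real n * (- g))" using elim by (simp add: mult.commute)
        also have "\<dots> = exp (- g) ^ n" by (rule exp_of_nat_mult)
        finally show ?case unfolding r_values(1)[OF \<open>\<omega> \<in> space L\<close>]
          using rev.rho_pos[of "U 0 \<omega>"] by (simp add: abs_mult)
      qed
    qed
  qed
  show ?case
  proof (intro allI impI)
    fix N :: "'n measure" and Y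
    assume "bd_walk N Y (step_prob p (\<lambda>i. U i \<omega>)) x0"
    then interpret W: bd_ratio N Y "step_prob p (\<lambda>i. U i \<omega>)" x0 "r \<omega>" by (rule bd_ratio_swap)
    show "AE x in N. \<forall>k. eventually (\<lambda>n. k \<le> Y n x) sequentially"
      by (rule W.transient_right[OF unb bdd])
  qed
qed

text \<open>Reaching every level on the right only requires infinitely many scale increments of size
  at least 1 on the left half-line. For \<open>p = 1 / 2\<close> the exponent
  \<open>ln \<sigma>\<close> is zero; for \<open>a = b\<close> the sums oscillate. Recurrence
  follows by applying this to the reflected walk too.\<close>

theorem walk_unbounded_above:
  assumes "a = b \<or> p = 1 / 2"
  shows "AE \<omega> in L. \<forall>(N :: 'n measure) Y. bd_walk N Y (step_prob p (\<lambda>i. U i \<omega>)) x0 \<longrightarrow>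
     (AE x in N. \<forall>k. \<exists>n. k \<le> Y n x)"
proof -
  have V_abs: "\<bar>rev.V n \<omega>\<bar> \<le> int n" if "\<omega> \<in> space L" for n \<omega>
  proof (induction n)
    case (Suc n)
    then show ?case using U_val[OF that, of "- (int n + 1)"] by (auto simp: rev.V_Suc)
  qed (simp add: rev.V_def)
  have "AE \<omega> in L. \<forall>n0. \<exists>n\<ge>n0. 0 \<le> - ln \<sigma> * of_int (rev.V n \<omega>)"
  proof (cases "p = 1 / 2")
    case True
    then have "ln \<sigma> = 0" by (simp add: odds_def)
    then show ?thesis by auto
  next
    case False
    then have eq: "a = b" using assms by simp
    from rev.V_unbounded_below[OF eq] rev.V_unbounded_above[OF eq] AE_space show ?thesis
    proof eventually_elim
      case (elim \<omega>)
      show ?case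
      proof
        fix n0
        obtain n1 where n1: "rev.V n1 \<omega> \<le> - int n0" using elim(1) by blast
        obtain n2 where n2: "int n0 \<le> rev.V n2 \<omega>" using elim(2) by blast
        \<comment> \<open>A sum of \<open>n\<close> signs has modulus at most \<open>n\<close>, so a
          level of size \<open>n0\<close> is reached no earlier than \<open>n0\<close>: the
          oscillation occurs arbitrarily late.\<close>
        have "n0 \<le> n1" "n0 \<le> n2" using n1 n2 V_abs[OF elim(3), of n1] V_abs[OF elim(3), of n2] by auto
        then show "\<exists>n\<ge>n0. 0 \<le> - ln \<sigma> * of_int (rev.V n \<omega>)"
        proof (cases "0 \<le> ln \<sigma>")
          case True
          then have "0 \<le> - ln \<sigma> * of_int (rev.V n1 \<omega>)" using n1 by (simp add: mult_le_0_iff)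
          then show ?thesis using \<open>n0 \<le> n1\<close> by blast
        next
          case False
          then have "0 \<le> - ln \<sigma> * of_int (rev.V n2 \<omega>)" using n2 by (simp add: mult_le_0_iff)
          then show ?thesis using \<open>n0 \<le> n2\<close> by blast
        qed
      qed
    qed
  qed
  then show ?thesis using AE_space
  proof eventually_elim
    case (elim \<omega>)
    show ?case
    proof (intro allI impI)
      fix N :: "'n measure" and Y
      assume "bd_walk N Y (step_prob p (\<lambda>i. U i \<omega>)) x0"
      then interpret W: bd_ratio N Y "step_prob p (\<lambda>i. U i \<omega>)" x0 "r \<omega>" by (rule bd_ratio_swap)
      show "AE x in N. \<forall>k. \<exists>n. k \<le> Y n x"
        by (rule W.unbounded_above, rule left_scale_unbounded) (use elim in auto)
    qed
  qed
qed

end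

section \<open>From the given model to canonical environment and path laws\<close>

lemma swap_trans_bd: "swap_trans p u = bd_trans (step_prob p u)"
  by (intro ext) (simp add: swap_trans_def bd_trans_def step_prob_def)

lemma space_env: "space env_space = {u. \<forall>i. u i = -1 \<or> u i = 1}"
  by (auto simp: env_space_def space_PiM PiE_def Pi_def)

lemma space_path [simp]: "space path_space = UNIV"
  by (simp add: path_space_def space_PiM)

lemma env_coord_measurable: "(\<lambda>u. u i) \<in> env_space \<rightarrow>\<^sub>M count_space UNIV"
proof -
  have "(\<lambda>u. u i) \<in> env_space \<rightarrow>\<^sub>M count_space {-1, 1}"
    unfolding env_space_def by (rule measurable_component_singleton) simp
  moreover have "(\<lambda>x. x) \<in> count_space {-1, 1 :: int} \<rightarrow>\<^sub>M count_space UNIV" by simp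
  ultimately show ?thesis by (rule measurable_compose)
qed

lemma path_coord_measurable [measurable]: "(\<lambda>x. x n) \<in> path_space \<rightarrow>\<^sub>M count_space UNIV"
  unfolding path_space_def by (rule measurable_component_singleton) simp

text \<open>Moves the environment to its law on \<open>env_space\<close>, the domain of the kernel
  of the walk. Stationarity makes the one-site probability of 1 a solution of
  \<open>\<pi> = (1 - b) * \<pi> + a * (1 - \<pi>)\<close>.\<close>

lemma markov_environment_law:
  assumes M: "prob_space M" and ab: "a \<in> {0<..<1}" "b \<in> {0<..<1}" and env: "markov_environment M U a b"
  shows "markov_env (distr M env_space (\<lambda>\<omega> i. U i \<omega>)) (\<lambda>i u. u i) a b"
proof -
  interpret prob_space M by fact
  define L where "L = distr M env_space (\<lambda>\<omega> i. U i \<omega>)"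
  have U: "U i \<in> M \<rightarrow>\<^sub>M count_space {-1, 1}" for i using env by (simp add: markov_environment_def)
  have U_val: "U i \<omega> = -1 \<or> U i \<omega> = 1" if "\<omega> \<in> space M" for i \<omega>
    using measurable_space[OF U that, of i] by simp
  have U_env: "(\<lambda>\<omega> i. U i \<omega>) \<in> M \<rightarrow>\<^sub>M env_space"
    unfolding env_space_def by (rule measurable_PiM_single') (use U U_val in auto)
  have U': "U i \<in> M \<rightarrow>\<^sub>M count_space UNIV" for i
    using measurable_compose[OF U_env env_coord_measurable] .
  interpret L: prob_space L unfolding L_def by (rule prob_space_distr[OF U_env])
  have coord: "(\<lambda>u. u i) \<in> L \<rightarrow>\<^sub>M count_space UNIV" for i
    unfolding L_def by (simp add: env_coord_measurable)
  have law: "L.prob {u\<in>space L. \<phi> u} = prob {\<omega>\<in>space M. \<phi> (\<lambda>i. U i \<omega>)}" if "{u\<in>space L. \<phi> u} \<in> sets L" for \<phi>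
  proof -
    have "L.prob {u\<in>space L. \<phi> u} = prob ((\<lambda>\<omega> i. U i \<omega>) -` {u\<in>space L. \<phi> u} \<inter> space M)"
      using that unfolding L_def by (intro measure_distr[OF U_env]) simp
    also have "(\<lambda>\<omega> i. U i \<omega>) -` {u\<in>space L. \<phi> u} \<inter> space M = {\<omega>\<in>space M. \<phi> (\<lambda>i. U i \<omega>)}"
      using measurable_space[OF U_env] by (auto simp: L_def)
    finally show ?thesis .
  qed
  have cyl: "{u\<in>space L. \<forall>j\<in>{s..t}. u j = v j} \<in> sets L" for s t :: int and v
    by (rule L.agree_event[where X = "\<lambda>j u. u j"]) (use coord in auto)
  have one: "{u\<in>space L. u i = v} \<in> sets L" for i v
    using L.agree_event[of "{i}" "\<lambda>i u. u i" "\<lambda>_. v"] coord by simp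
  have chain: "is_markov_chain M U (env_trans a b)" using env by (simp add: markov_environment_def)
  have stat: "prob {\<omega>\<in>space M. U (i + 1) \<omega> = 1} = prob {\<omega>\<in>space M. U i \<omega> = 1}" for i
  proof -
    have eq: "distr M env_space (\<lambda>\<omega> i. U (i + 1) \<omega>) = L"
      using env unfolding markov_environment_def stationary_env_def L_def by blast
    have U1: "(\<lambda>\<omega> i. U (i + 1) \<omega>) \<in> M \<rightarrow>\<^sub>M env_space"
      unfolding env_space_def by (rule measurable_PiM_single') (use U U_val in auto)
    have "prob {\<omega>\<in>space M. U i \<omega> = 1} = L.prob {u\<in>space L. u i = 1}"
      by (rule law[symmetric]) (rule one)
    also have "\<dots> = measure (distr M env_space (\<lambda>\<omega> i. U (i + 1) \<omega>)) {u\<in>space L. u i = 1}" unfolding eq ..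
    also have "\<dots> = prob ((\<lambda>\<omega> i. U (i + 1) \<omega>) -` {u\<in>space L. u i = 1} \<inter> space M)"
      by (rule measure_distr[OF U1]) (use one[of i 1] in \<open>simp add: L_def\<close>)
    also have "(\<lambda>\<omega> i. U (i + 1) \<omega>) -` {u\<in>space L. u i = 1} \<inter> space M = {\<omega>\<in>space M. U (i + 1) \<omega> = 1}"
      using measurable_space[OF U1] by (auto simp: L_def)
    finally show ?thesis by simp
  qed
  have marg: "prob {\<omega>\<in>space M. U i \<omega> = 1} = a / (a + b)" for i
  proof -
    define \<pi> where "\<pi> = prob {\<omega>\<in>space M. U i \<omega> = 1}"
    have ev: "{\<omega>\<in>space M. U i \<omega> = v} \<in> sets M" for i v
      using agree_event[of "{i}" U "\<lambda>_. v"] U' by simp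
    have joint: "prob {\<omega>\<in>space M. U (i + 1) \<omega> = 1 \<and> U i \<omega> = v} = env_trans a b v 1 * prob {\<omega>\<in>space M. U i \<omega> = v}" for v
      using markov_joint[OF chain, of i i 1 "\<lambda>_. v"] U' by simp
    have "{\<omega>\<in>space M. U i \<omega> = -1} = space M - {\<omega>\<in>space M. U i \<omega> = 1}"
      using measurable_space[OF U[of i]] by force
    then have minus: "prob {\<omega>\<in>space M. U i \<omega> = -1} = 1 - \<pi>"
      using prob_compl[OF ev[of i 1]] by (simp add: \<pi>_def)
    have "\<pi> = prob {\<omega>\<in>space M. U (i + 1) \<omega> = 1}" unfolding \<pi>_def stat ..
    also have "{\<omega>\<in>space M. U (i + 1) \<omega> = 1} =
        {\<omega>\<in>space M. U (i + 1) \<omega> = 1 \<and> U i \<omega> = 1} \<union> {\<omega>\<in>space M. U (i + 1) \<omega> = 1 \<and> U i \<omega> = -1}"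
      using measurable_space[OF U[of i]] by force
    also have "prob \<dots> = prob {\<omega>\<in>space M. U (i + 1) \<omega> = 1 \<and> U i \<omega> = 1} + prob {\<omega>\<in>space M. U (i + 1) \<omega> = 1 \<and> U i \<omega> = -1}"
      by (rule finite_measure_Union) (use sets.sets_Collect_conj[OF ev ev] in auto)
    also have "\<dots> = (1 - b) * \<pi> + a * (1 - \<pi>)" unfolding joint minus by (simp add: env_trans_def \<pi>_def)
    finally have "\<pi> * (a + b) = a" by (simp add: algebra_simps)
    then show ?thesis unfolding \<pi>_def[symmetric] using ab by (simp add: eq_divide_eq)
  qed
  have "markov_env L (\<lambda>i u. u i) a b"
  proof
    show "0 < a" "a < 1" "0 < b" "b < 1" using ab by auto
    show "(\<lambda>u. u i) \<in> L \<rightarrow>\<^sub>M count_space UNIV" for i by (rule coord)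
    show "u i = -1 \<or> u i = 1" if "u \<in> space L" for u i using that by (simp add: L_def space_env)
    show "L.prob {u \<in> space L. u i = 1} = a / (a + b)" for i
      using law[OF one[of i 1]] marg[of i] by simp
    show "is_markov_chain L (\<lambda>i u. u i) (env_trans a b)"
      unfolding is_markov_chain_def
    proof (intro allI impI)
      fix s t :: int and v y
      assume st: "s \<le> t" and pos: "0 < L.prob {u\<in>space L. \<forall>j\<in>{s..t}. u j = v j}"
      have 1: "L.prob {u\<in>space L. \<forall>j\<in>{s..t}. u j = v j} = prob {\<omega>\<in>space M. \<forall>j\<in>{s..t}. U j \<omega> = v j}"
        by (rule law[OF cyl])
      have 2: "L.prob {u\<in>space L. u (t + 1) = y \<and> (\<forall>j\<in>{s..t}. u j = v j)} =
          prob {\<omega>\<in>space M. U (t + 1) \<omega> = y \<and> (\<forall>j\<in>{s..t}. U j \<omega> = v j)}"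
        by (rule law) (use sets.sets_Collect_conj[OF cyl[of s t v] one[of "t + 1" y]] in simp)
      have "cond_prob M (\<lambda>\<omega>. U (t + 1) \<omega> = y) (\<lambda>\<omega>. \<forall>j\<in>{s..t}. U j \<omega> = v j) = env_trans a b (v t) y"
        by (rule chain[unfolded is_markov_chain_def, rule_format, OF st]) (use pos in \<open>simp only: 1\<close>)
      then show "cond_prob L (\<lambda>u. u (t + 1) = y) (\<lambda>u. \<forall>j\<in>{s..t}. u j = v j) = env_trans a b (v t) y"
        unfolding cond_prob_def 1 2 .
    qed
  qed
  then show ?thesis by (simp add: L_def)
qed

section \<open>Parameter regimes and the main theorem\<close>

text \<open>Clearing denominators turns the position of \<open>p\<close> relative to a threshold
  into the sign of a factor of \<open>ballistic_det\<close>, at \<open>p\<close> or at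
  \<open>1 - p\<close>.\<close>

lemma zero_speed_threshold:
  fixes a b p :: real
  assumes "a < 1" "b < 1"
  shows "p < (1 - b) / ((1 - a) + (1 - b)) \<longleftrightarrow> 0 < (1 - b) * (1 - p) - (1 - a) * p"
    and "(1 - b) / ((1 - a) + (1 - b)) < p \<longleftrightarrow> (1 - b) * (1 - p) - (1 - a) * p < 0"
    and "(1 - a) / ((1 - a) + (1 - b)) < p \<longleftrightarrow> 0 < (1 - b) * p - (1 - a) * (1 - p)"
    and "p < (1 - a) / ((1 - a) + (1 - b)) \<longleftrightarrow> (1 - b) * p - (1 - a) * (1 - p) < 0"
proof -
  have T: "0 < (1 - a) + (1 - b)" using assms by simp
  show "p < (1 - b) / ((1 - a) + (1 - b)) \<longleftrightarrow> 0 < (1 - b) * (1 - p) - (1 - a) * p"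
    unfolding pos_less_divide_eq[OF T] by (simp add: algebra_simps)
  show "(1 - b) / ((1 - a) + (1 - b)) < p \<longleftrightarrow> (1 - b) * (1 - p) - (1 - a) * p < 0"
    unfolding pos_divide_less_eq[OF T] by (simp add: algebra_simps)
  show "(1 - a) / ((1 - a) + (1 - b)) < p \<longleftrightarrow> 0 < (1 - b) * p - (1 - a) * (1 - p)"
    unfolding pos_divide_less_eq[OF T] by (simp add: algebra_simps)
  show "p < (1 - a) / ((1 - a) + (1 - b)) \<longleftrightarrow> (1 - b) * p - (1 - a) * (1 - p) < 0"
    unfolding pos_less_divide_eq[OF T] by (simp add: algebra_simps)
qed

lemma threshold_order:
  fixes a b :: real
  assumes "a < 1" "b < 1"
  shows "b < a \<Longrightarrow> 1 / 2 < (1 - b) / ((1 - a) + (1 - b)) \<and> (1 - a) / ((1 - a) + (1 - b)) < 1 / 2"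
    and "a < b \<Longrightarrow> (1 - b) / ((1 - a) + (1 - b)) < 1 / 2 \<and> 1 / 2 < (1 - a) / ((1 - a) + (1 - b))"
proof -
  have T: "0 < (1 - a) + (1 - b)" using assms by simp
  show "b < a \<Longrightarrow> 1 / 2 < (1 - b) / ((1 - a) + (1 - b)) \<and> (1 - a) / ((1 - a) + (1 - b)) < 1 / 2"
    unfolding pos_less_divide_eq[OF T] pos_divide_less_eq[OF T] by simp
  show "a < b \<Longrightarrow> (1 - b) / ((1 - a) + (1 - b)) < 1 / 2 \<and> 1 / 2 < (1 - a) / ((1 - a) + (1 - b))"
    unfolding pos_less_divide_eq[OF T] pos_divide_less_eq[OF T] by simp
qed

text \<open>Direction only, regardless of speed: \<open>ln (odds p)\<close> and the environment mean
  have opposite signs. The determinant then separates positive from zero speed.\<close>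

definition drifts_right :: "real \<Rightarrow> real \<Rightarrow> real \<Rightarrow> bool" where
  "drifts_right a b p \<longleftrightarrow> b < a \<and> 1 / 2 < p \<or> a < b \<and> p < 1 / 2"

context
  fixes a b p :: real
  assumes ab: "0 < a" "a < 1" "0 < b" "b < 1" and p: "0 < p" "p < 1"
begin

lemma det_sign: "0 < ballistic_det a b (odds p) \<longleftrightarrow> 0 < (2 * p - 1) * ((1 - b) * (1 - p) - (1 - a) * p)"
proof -
  have "0 < p * (1 - p)" using p by simp
  then show ?thesis unfolding odds_def ballistic_det_p[OF p] by (simp add: zero_less_divide_iff)
qed

lemma ballistic_right_iff: "ballistic_right a b p \<longleftrightarrow> drifts_right a b p \<and> 0 < ballistic_det a b (odds p)"
proof -
  define c where "c = (1 - b) / ((1 - a) + (1 - b))"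
  show ?thesis
    using zero_speed_threshold(1,2)[OF ab(2,4), of p] threshold_order[OF ab(2,4)]
    unfolding det_sign ballistic_right_def drifts_right_def zero_less_mult_iff c_def[symmetric] by auto
qed

lemma zero_speed_right_iff: "zero_speed_right a b p \<longleftrightarrow> drifts_right a b p \<and> ballistic_det a b (odds p) \<le> 0"
proof -
  define c where "c = (1 - b) / ((1 - a) + (1 - b))"
  have "ballistic_det a b (odds p) \<le> 0 \<longleftrightarrow> \<not> 0 < ballistic_det a b (odds p)" by auto
  then show ?thesis
    using zero_speed_threshold(1,2)[OF ab(2,4), of p] threshold_order[OF ab(2,4)] p
    unfolding det_sign zero_speed_right_def drifts_right_def zero_less_mult_iff c_def[symmetric] by auto
qed

lemma drifts_right_ln: "drifts_right a b p \<Longrightarrow> ln (odds p) * ((a - b) / (a + b)) < 0"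
proof -
  assume d: "drifts_right a b p"
  have ln_neg: "ln (odds p) < 0" if "1 / 2 < p"
    using that p by (simp add: odds_def)
  have ln_pos: "0 < ln (odds p)" if "p < 1 / 2"
    using that p by (simp add: odds_def)
  from d ab show ?thesis
    unfolding drifts_right_def using ln_neg ln_pos by (auto simp: mult_less_0_iff divide_less_0_iff zero_less_divide_iff)
qed

end

lemma drifts_left_iff: "drifts_right a b (1 - p) \<longleftrightarrow> b < a \<and> p < 1 / 2 \<or> a < b \<and> 1 / 2 < p"
  by (auto simp: drifts_right_def)

context
  fixes a b p :: real
  assumes ab: "0 < a" "a < 1" "0 < b" "b < 1" and p: "0 < p" "p < 1"
begin

lemma complement_bounds: "0 < 1 - p" "1 - p < 1"
  using p by auto

lemma ballistic_left_iff: "ballistic_left a b p \<longleftrightarrow> ballistic_right a b (1 - p)"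
  unfolding ballistic_left_def ballistic_right_def
  using zero_speed_threshold[OF ab(2,4)] by (auto simp: mult.commute)

lemma zero_speed_left_iff: "zero_speed_left a b p \<longleftrightarrow> zero_speed_right a b (1 - p)"
proof -
  have "p \<le> (1 - a) / ((1 - a) + (1 - b)) \<longleftrightarrow> (1 - b) / ((1 - a) + (1 - b)) \<le> 1 - p"
    "(1 - a) / ((1 - a) + (1 - b)) \<le> p \<longleftrightarrow> 1 - p \<le> (1 - b) / ((1 - a) + (1 - b))"
    unfolding not_less[symmetric] zero_speed_threshold[OF ab(2,4)] by (auto simp: mult.commute)
  then show ?thesis unfolding zero_speed_left_def zero_speed_right_def using p by auto
qed

text \<open>Positivity on both sides fixes the signs of \<open>s\<close> and \<open>t\<close>
  through that of \<open>2 * p - 1\<close>, so that \<open>t - s\<close> and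
  \<open>2 * p - 1\<close> have opposite signs; but \<open>t - s\<close> is a positive multiple of
  \<open>2 * p - 1\<close>.\<close>

lemma not_both_ballistic: "\<not> (0 < ballistic_det a b (odds p) \<and> 0 < ballistic_det a b (odds (1 - p)))"
proof
  assume A: "0 < ballistic_det a b (odds p) \<and> 0 < ballistic_det a b (odds (1 - p))"
  define s where "s = (1 - b) * (1 - p) - (1 - a) * p"
  define t where "t = (1 - b) * p - (1 - a) * (1 - p)"
  have "0 < (2 * p - 1) * s" "0 < (1 - 2 * p) * t"
    using A unfolding det_sign[OF ab p] det_sign[OF ab complement_bounds] by (simp_all add: s_def t_def algebra_simps)
  moreover have "t - s = (2 * p - 1) * ((1 - b) + (1 - a))" by (simp add: s_def t_def algebra_simps)
  ultimately show False
    using ab by (auto simp: zero_less_mult_iff) (smt (verit) mult_pos_pos mult_neg_pos)+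
qed

lemma drift_det:
  assumes "drifts_right a b p"
  shows "ballistic_det a b (odds (1 - p)) \<le> 0"
proof -
  have "(1 - 2 * p) * ((1 - b) * p - (1 - a) * (1 - p)) \<le> 0"
  proof -
    consider "b < a" "1 / 2 < p" | "a < b" "p < 1 / 2" using assms by (auto simp: drifts_right_def)
    then show ?thesis
    proof cases
      case 1
      then have "(1 - a) * (1 - p) \<le> (1 - b) * p" using ab p by (intro mult_mono) auto
      with 1 show ?thesis by (simp add: mult_le_0_iff)
    next
      case 2
      then have "(1 - b) * p \<le> (1 - a) * (1 - p)" using ab p by (intro mult_mono) auto
      with 2 show ?thesis by (simp add: mult_le_0_iff)
    qed
  qed
  then show ?thesis unfolding not_less[symmetric] det_sign[OF ab complement_bounds] by (simp add: algebra_simps)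
qed

lemma recurrent_det:
  assumes "a = b \<or> p = 1 / 2"
  shows "ballistic_det a b (odds p) \<le> 0"
proof -
  have "(2 * p - 1) * ((1 - b) * (1 - p) - (1 - a) * p) \<le> 0"
  proof (cases "p = 1 / 2")
    case True
    then have "2 * p - 1 = 0" by simp
    then show ?thesis by simp
  next
    case False
    then have "a = b" using assms by simp
    then have "(2 * p - 1) * ((1 - b) * (1 - p) - (1 - a) * p) = - ((1 - a) * (2 * p - 1)\<^sup>2)"
      by (simp add: power2_eq_square algebra_simps)
    then show ?thesis using ab by simp
  qed
  then show ?thesis unfolding not_less[symmetric] det_sign[OF ab p] .
qed

lemma cases_exhaustive:
  "\<not> (ballistic_right a b p \<or> ballistic_left a b p \<or> zero_speed_right a b p \<or> zero_speed_left a b p) \<longleftrightarrow>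
    a = b \<or> p = 1 / 2"
  unfolding ballistic_left_iff zero_speed_left_iff ballistic_right_iff[OF ab p] ballistic_right_iff[OF ab complement_bounds]
    zero_speed_right_iff[OF ab p] zero_speed_right_iff[OF ab complement_bounds] drifts_left_iff drifts_right_def
  by (auto simp: not_less[symmetric])

end

text \<open>A path that is eventually bounded below is bounded below altogether, since only finitely
  many earlier values remain.\<close>

lemma liminf_minus_infinity:
  fixes x :: "nat \<Rightarrow> int"
  assumes "\<And>k::nat. \<exists>n. x n \<le> - int k"
  shows "liminf (\<lambda>n. ereal (real_of_int (x n))) = - \<infinity>"
proof (rule ccontr)
  assume "liminf (\<lambda>n. ereal (real_of_int (x n))) \<noteq> - \<infinity>"
  then have "- \<infinity> < liminf (\<lambda>n. ereal (real_of_int (x n)))" by (simp add: less_le)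
  then obtain c :: real where "ereal c < liminf (\<lambda>n. ereal (real_of_int (x n)))"
    using ereal_dense2[of "- \<infinity>"] by auto
  then have "eventually (\<lambda>n. ereal c < ereal (real_of_int (x n))) sequentially" by (rule less_LiminfD)
  then obtain n0 where n0: "\<And>n. n0 \<le> n \<Longrightarrow> c < real_of_int (x n)" by (auto simp: eventually_sequentially)
  define y where "y = Min (insert \<lfloor>c\<rfloor> (x ` {..n0}))"
  have y: "y \<le> x n" for n
  proof (cases "n \<le> n0")
    case True
    then show ?thesis unfolding y_def by (intro Min_le) auto
  next
    case False
    then have "\<lfloor>c\<rfloor> \<le> x n" using n0[of n] by linarith
    moreover have "y \<le> \<lfloor>c\<rfloor>" unfolding y_def by (intro Min_le) auto
    ultimately show ?thesis by simp
  qed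
  obtain n where "x n \<le> - int (nat (\<bar>y\<bar> + 1))" using assms by blast
  with y[of n] show False by linarith
qed

lemma limsup_infinity:
  fixes x :: "nat \<Rightarrow> int"
  assumes "\<And>k::nat. \<exists>n. int k \<le> x n"
  shows "limsup (\<lambda>n. ereal (real_of_int (x n))) = \<infinity>"
proof -
  have "liminf (\<lambda>n. ereal (real_of_int (- x n))) = - \<infinity>"
    by (rule liminf_minus_infinity) (use assms in simp)
  then show ?thesis
    using ereal_Liminf_uminus[of sequentially "\<lambda>n. ereal (real_of_int (x n))"] by simp
qed

text \<open>The exceptional paths have mass zero under almost every \<open>Q u\<close>, hence zero
  mass in the mixture. \<open>\<Phi>\<close> must be measurable on path space, so limit statements
  are first put in a form with countable quantifiers.\<close>

lemma walk_law_transfer: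
  assumes U: "(\<lambda>\<omega> i. U i \<omega>) \<in> M \<rightarrow>\<^sub>M env_space"
    and X: "\<And>n. X n \<in> M \<rightarrow>\<^sub>M count_space UNIV"
    and mix: "\<forall>A \<in> sets env_space. \<forall>B \<in> sets path_space.
           emeasure M {\<omega> \<in> space M. (\<lambda>i. U i \<omega>) \<in> A \<and> (\<lambda>n. X n \<omega>) \<in> B} =
           (\<integral>\<^sup>+ u \<in> A. emeasure (Q u) B \<partial>distr M env_space (\<lambda>\<omega> i. U i \<omega>))"
    and Q: "Q \<in> env_space \<rightarrow>\<^sub>M prob_algebra path_space"
    and \<Phi> [measurable]: "Measurable.pred path_space \<Phi>"
    and ae: "AE u in distr M env_space (\<lambda>\<omega> i. U i \<omega>). AE x in Q u. \<Phi> x"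
  shows "AE \<omega> in M. \<Phi> (\<lambda>n. X n \<omega>)"
proof -
  define L where "L = distr M env_space (\<lambda>\<omega> i. U i \<omega>)"
  define B where "B = {x\<in>space path_space. \<not> \<Phi> x}"
  have B [measurable]: "B \<in> sets path_space" unfolding B_def by measurable
  have X_path: "(\<lambda>\<omega> n. X n \<omega>) \<in> M \<rightarrow>\<^sub>M path_space"
    unfolding path_space_def by (rule measurable_PiM_single') (use X in auto)
  have null: "emeasure (Q u) B = 0" if "AE x in Q u. \<Phi> x" "u \<in> space L" for u
  proof -
    have "Q u \<in> space (prob_algebra path_space)"
      using measurable_space[OF Q] that(2) by (simp add: L_def)
    then have s: "sets (Q u) = sets path_space" by (simp add: space_prob_algebra)
    then have "space (Q u) = space path_space" by (rule sets_eq_imp_space_eq)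
    with that(1) s B show ?thesis
      by (subst (asm) AE_iff_measurable[of B]) (auto simp: B_def)
  qed
  have "emeasure M {\<omega> \<in> space M. (\<lambda>i. U i \<omega>) \<in> space env_space \<and> (\<lambda>n. X n \<omega>) \<in> B} =
      (\<integral>\<^sup>+ u \<in> space env_space. emeasure (Q u) B \<partial>L)"
    using mix B unfolding L_def by blast
  also have "\<dots> = (\<integral>\<^sup>+ u. 0 \<partial>L)"
  proof (rule nn_integral_cong_AE)
    show "AE u in L. emeasure (Q u) B * indicator (space env_space) u = 0"
      using ae[folded L_def] AE_space by eventually_elim (simp add: null)
  qed
  finally have zero: "emeasure M {\<omega> \<in> space M. (\<lambda>i. U i \<omega>) \<in> space env_space \<and> (\<lambda>n. X n \<omega>) \<in> B} = 0" by simp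
  have eq: "{\<omega> \<in> space M. (\<lambda>i. U i \<omega>) \<in> space env_space \<and> (\<lambda>n. X n \<omega>) \<in> B} = (\<lambda>\<omega> n. X n \<omega>) -` B \<inter> space M"
    using measurable_space[OF U] by auto
  have "(\<lambda>\<omega> n. X n \<omega>) -` B \<inter> space M \<in> null_sets M"
    by (rule null_setsI) (use zero eq measurable_sets[OF X_path B] in auto)
  from AE_not_in[OF this] show ?thesis using AE_space by eventually_elim (auto simp: B_def)
qed

theorem theorem3p2:
  fixes M :: "'w measure"
    and U :: "int \<Rightarrow> 'w \<Rightarrow> int"
    and X :: "nat \<Rightarrow> 'w \<Rightarrow> int"
    and a b p :: real
    and x0 :: int
  assumes "prob_space M"
    and "a \<in> {0<..<1}" and "b \<in> {0<..<1}" and "p \<in> {0<..<1}"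
    and "markov_environment M U a b"
    and "swap_walk M U X p x0"
  shows "\<exists>V::real.
    (AE \<omega> in M. (\<lambda>n. real_of_int (X n \<omega>) / real n) \<longlonglongrightarrow> V) \<and>
    (ballistic_right a b p \<longrightarrow>
       (AE \<omega> in M. filterlim (\<lambda>n. X n \<omega>) at_top sequentially) \<and>
       V = (2 * p - 1) * (((1 - b) * (1 - p) - (1 - a) * p) /
             ((b + (a - b) / (a + b)) * (1 - p) + (a - (a - b) / (a + b)) * p)) \<and>
       V > 0) \<and>
    (ballistic_left a b p \<longrightarrow>
       (AE \<omega> in M. filterlim (\<lambda>n. X n \<omega>) at_bot sequentially) \<and>
       V = - (1 - 2 * p) * (((1 - b) * p - (1 - a) * (1 - p)) /
             ((b + (a - b) / (a + b)) * p + (a - (a - b) / (a + b)) * (1 - p))) \<and>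
       V < 0) \<and>
    (zero_speed_right a b p \<longrightarrow>
       (AE \<omega> in M. filterlim (\<lambda>n. X n \<omega>) at_top sequentially) \<and> V = 0) \<and>
    (zero_speed_left a b p \<longrightarrow>
       (AE \<omega> in M. filterlim (\<lambda>n. X n \<omega>) at_bot sequentially) \<and> V = 0) \<and>
    (\<not> (ballistic_right a b p \<or> ballistic_left a b p \<or>
        zero_speed_right a b p \<or> zero_speed_left a b p) \<longleftrightarrow> a = b \<or> p = 1/2) \<and>
    (a = b \<or> p = 1/2 \<longrightarrow>
       (AE \<omega> in M. liminf (\<lambda>n. ereal (real_of_int (X n \<omega>))) = - \<infinity> \<and>
                   limsup (\<lambda>n. ereal (real_of_int (X n \<omega>))) = \<infinity>) \<and> V = 0)"
proof -
  have ab: "0 < a" "a < 1" "0 < b" "b < 1" and p: "0 < p" "p < 1" using assms by auto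
  have q: "0 < 1 - p" "1 - p < 1" using p by auto
  define L where "L = distr M env_space (\<lambda>\<omega> i. U i \<omega>)"
  have env: "U i \<in> M \<rightarrow>\<^sub>M count_space {-1, 1}" for i
    using assms(5) by (simp add: markov_environment_def)
  have U_val: "U i \<omega> = -1 \<or> U i \<omega> = 1" if "\<omega> \<in> space M" for i \<omega>
    using measurable_space[OF env that, of i] by simp
  have U_env: "(\<lambda>\<omega> i. U i \<omega>) \<in> M \<rightarrow>\<^sub>M env_space"
    unfolding env_space_def by (rule measurable_PiM_single') (use env U_val in auto)
  interpret env: markov_env L "\<lambda>i u. u i" a b
    unfolding L_def by (rule markov_environment_law) (use assms in auto)
  interpret E: swap_env L "\<lambda>i u. u i" a b p
    by unfold_locales (use p in auto)
  interpret R: swap_env L "\<lambda>i u. u (- i)" a b "1 - p"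
    by (rule E.swap_reverse)
  from assms(6) obtain Q where X: "\<And>n. X n \<in> M \<rightarrow>\<^sub>M count_space UNIV"
    and Q: "Q \<in> env_space \<rightarrow>\<^sub>M prob_algebra path_space"
    and walk: "\<And>u. u \<in> space env_space \<Longrightarrow> (AE x in Q u. x 0 = x0) \<and> is_markov_chain (Q u) (\<lambda>n x. x n) (swap_trans p u)"
    and mix: "\<forall>A \<in> sets env_space. \<forall>B \<in> sets path_space.
           emeasure M {\<omega> \<in> space M. (\<lambda>i. U i \<omega>) \<in> A \<and> (\<lambda>n. X n \<omega>) \<in> B} =
           (\<integral>\<^sup>+ u \<in> A. emeasure (Q u) B \<partial>distr M env_space (\<lambda>\<omega> i. U i \<omega>))"
    unfolding swap_walk_def by blast
  have bd: "bd_walk (Q u) (\<lambda>n x. x n) (step_prob p u) x0" if u: "u \<in> space L" for u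
  proof -
    have u': "u \<in> space env_space" using u by (simp add: L_def)
    then have Qu: "Q u \<in> space (prob_algebra path_space)" by (rule measurable_space[OF Q])
    then interpret Q: prob_space "Q u" by (simp add: space_prob_algebra)
    have s: "sets (Q u) = sets path_space" using Qu by (simp add: space_prob_algebra)
    show ?thesis
    proof
      show "(\<lambda>x. x n) \<in> Q u \<rightarrow>\<^sub>M count_space UNIV" for n
        unfolding measurable_cong_sets[OF s refl] by (rule path_coord_measurable)
      show "0 < step_prob p u x" "step_prob p u x < 1" for x using p by (auto simp: step_prob_def)
      show "AE x in Q u. x 0 = x0" using walk[OF u'] by blast
      show "is_markov_chain (Q u) (\<lambda>n x. x n) (bd_trans (step_prob p u))"
        using walk[OF u'] by (simp add: swap_trans_bd)
    qed
  qed
  have bd': "bd_walk (Q u) (\<lambda>n x. - x n) (step_prob (1 - p) (\<lambda>i. u (- i))) (- x0)" if "u \<in> space L" for u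
    by (rule bd_walk.step_prob_reflect[OF bd[OF that] refl])
  have transfer: "AE \<omega> in M. \<Phi> (\<lambda>n. X n \<omega>)"
    if "Measurable.pred path_space \<Phi>" "AE u in L. AE x in Q u. \<Phi> x" for \<Phi>
    by (rule walk_law_transfer[OF U_env X mix Q that(1)]) (rule that(2)[unfolded L_def])
  \<comment> \<open>At most one of the two terms is nonzero, by
    \<open>not_both_ballistic\<close>.\<close>
  define V where "V = speed a b p - speed a b (1 - p)"

  have neg: "real_of_int (- y) \<le> (v + e) * z \<longleftrightarrow> (- v - e) * z \<le> real_of_int y"
    "(v - e) * z \<le> real_of_int (- y) \<longleftrightarrow> real_of_int y \<le> (- v + e) * z" for y :: int and v e z :: real
    by (auto simp: algebra_simps)
  have up: "AE u in L. AE x in Q u. \<forall>e>0. eventually (\<lambda>n. real_of_int (x n) \<le> (speed a b p + e) * real n) sequentially"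
    using E.walk_speed_upper[where 'n = "nat \<Rightarrow> int", of x0] AE_space
    by eventually_elim (use bd in blast)
  have "AE u in L. AE x in Q u. \<forall>e>0. eventually (\<lambda>n. real_of_int (- x n) \<le> (speed a b (1 - p) + e) * real n) sequentially"
    using R.walk_speed_upper[where 'n = "nat \<Rightarrow> int", of "- x0"] AE_space
    by eventually_elim (use bd' in blast)
  then have down: "AE u in L. AE x in Q u. \<forall>e>0. eventually (\<lambda>n. (- speed a b (1 - p) - e) * real n \<le> real_of_int (x n)) sequentially"
    unfolding neg .
  \<comment> \<open>If the leftward speed is zero, this is the upper bound for the walk itself;
    otherwise it is the lower bound for the reflected walk. The bound from below is obtained
    symmetrically.\<close>
  have upper: "AE u in L. AE x in Q u. \<forall>e>0. eventually (\<lambda>n. real_of_int (x n) \<le> (V + e) * real n) sequentially"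
  proof (cases "ballistic_det a b (odds (1 - p)) \<le> 0")
    case True
    then show ?thesis using up by (simp add: V_def speed_def[of a b "1 - p"])
  next
    case False
    then have "V = - speed a b (1 - p)" using not_both_ballistic[OF ab p] by (simp add: V_def speed_def)
    moreover have "0 < ballistic_det a b (odds (1 - p))" using False by simp
    from R.walk_speed_lower[where 'n = "nat \<Rightarrow> int", OF this, of "- x0"] AE_space
    have "AE u in L. AE x in Q u. \<forall>e>0. eventually (\<lambda>n. (speed a b (1 - p) - e) * real n \<le> real_of_int (- x n)) sequentially"
      by eventually_elim (use bd' in blast)
    ultimately show ?thesis unfolding neg by simp
  qed
  have lower: "AE u in L. AE x in Q u. \<forall>e>0. eventually (\<lambda>n. (V - e) * real n \<le> real_of_int (x n)) sequentially"
  proof (cases "ballistic_det a b (odds p) \<le> 0")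
    case True
    then show ?thesis using down by (simp add: V_def speed_def[of a b p])
  next
    case False
    then have pos: "0 < ballistic_det a b (odds p)" by simp
    then have V: "V = speed a b p" using not_both_ballistic[OF ab p] by (simp add: V_def speed_def)
    show ?thesis unfolding V
      using E.walk_speed_lower[where 'n = "nat \<Rightarrow> int", OF pos, of x0] AE_space
      by eventually_elim (use bd in blast)
  qed
  from upper lower
  have "AE u in L. AE x in Q u. \<forall>e>0. eventually (\<lambda>n. \<bar>real_of_int (x n) - V * real n\<bar> \<le> e * real n) sequentially"
  proof eventually_elim
    case (elim u)
    from elim show ?case
    proof eventually_elim
      case (elim x)
      show ?case
      proof (intro allI impI)
        fix e :: real assume "0 < e"
        with elim have "eventually (\<lambda>n. real_of_int (x n) \<le> (V + e) * real n) sequentially"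
          "eventually (\<lambda>n. (V - e) * real n \<le> real_of_int (x n)) sequentially" by blast+
        then show "eventually (\<lambda>n. \<bar>real_of_int (x n) - V * real n\<bar> \<le> e * real n) sequentially"
          by eventually_elim (simp add: abs_le_iff algebra_simps)
      qed
    qed
  qed
  \<comment> \<open>Tolerances are restricted to inverses of positive integers, so that the path
    event becomes measurable and \<open>transfer\<close> applies.\<close>
  then have "AE u in L. AE x in Q u. \<forall>k::nat. \<exists>n0. \<forall>n\<ge>n0. \<bar>real_of_int (x n) - V * real n\<bar> \<le> inverse (real (Suc k)) * real n"
  proof eventually_elim
    case (elim u)
    then show ?case
      by eventually_elim (simp add: eventually_sequentially del: of_nat_Suc)
  qed
  then have "AE \<omega> in M. \<forall>k::nat. \<exists>n0. \<forall>n\<ge>n0. \<bar>real_of_int (X n \<omega>) - V * real n\<bar> \<le> inverse (real (Suc k)) * real n"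
    by (rule transfer[rotated]) measurable
  then have speed: "AE \<omega> in M. (\<lambda>n. real_of_int (X n \<omega>) / real n) \<longlonglongrightarrow> V"
  proof eventually_elim
    case (elim \<omega>)
    show ?case
    proof (rule LIMSEQ_I)
      fix e :: real assume "0 < e"
      then obtain k where k: "inverse (real (Suc k)) < e" using reals_Archimedean by blast
      obtain n0 where n0: "\<And>n. n0 \<le> n \<Longrightarrow> \<bar>real_of_int (X n \<omega>) - V * real n\<bar> \<le> inverse (real (Suc k)) * real n"
        using elim by blast
      have "norm (real_of_int (X n \<omega>) / real n - V) < e" if "max 1 n0 \<le> n" for n
      proof -
        have n: "0 < real n" using that by simp
        have "\<bar>real_of_int (X n \<omega>) - V * real n\<bar> / real n \<le> inverse (real (Suc k))"
          using n0[of n] that n by (simp only: pos_divide_le_eq max.bounded_iff)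
        moreover have "real_of_int (X n \<omega>) / real n - V = (real_of_int (X n \<omega>) - V * real n) / real n"
          using n by (simp add: field_simps)
        ultimately show ?thesis using k by (simp only: real_norm_def abs_divide abs_of_nat)
      qed
      then show "\<exists>no. \<forall>n\<ge>no. norm (real_of_int (X n \<omega>) / real n - V) < e" by blast
    qed
  qed

  have right: "AE \<omega> in M. filterlim (\<lambda>n. X n \<omega>) at_top sequentially" if d: "drifts_right a b p"
  proof -
    have "ln (odds p) * env.\<mu> < 0" using drifts_right_ln[OF ab p d] by (simp add: env.\<mu>_def)
    from E.walk_transient_right[where 'n = "nat \<Rightarrow> int", OF this, of x0] AE_space
    have "AE u in L. AE x in Q u. \<forall>k::nat. \<exists>n0. \<forall>n\<ge>n0. int k \<le> x n"
    proof eventually_elim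
      case (elim u)
      then have "AE x in Q u. \<forall>k. eventually (\<lambda>n. k \<le> x n) sequentially" using bd by blast
      then show ?case by eventually_elim (simp add: eventually_sequentially)
    qed
    then have "AE \<omega> in M. \<forall>k::nat. \<exists>n0. \<forall>n\<ge>n0. int k \<le> X n \<omega>"
      by (rule transfer[rotated]) measurable
    then show ?thesis
    proof eventually_elim
      case (elim \<omega>)
      show ?case unfolding filterlim_at_top eventually_sequentially
      proof
        fix k
        obtain n0 where n0: "\<forall>n\<ge>n0. int (nat k) \<le> X n \<omega>" using elim by blast
        have "k \<le> X n \<omega>" if "n0 \<le> n" for n
          by (rule order_trans[OF _ n0[rule_format, OF that]]) simp
        then show "\<exists>n0. \<forall>n\<ge>n0. k \<le> X n \<omega>" by blast
      qed
    qed
  qed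
  have left: "AE \<omega> in M. filterlim (\<lambda>n. X n \<omega>) at_bot sequentially" if d: "drifts_right a b (1 - p)"
  proof -
    have "ln (odds (1 - p)) * env.\<mu> < 0" using drifts_right_ln[OF ab q d] by (simp add: env.\<mu>_def)
    from R.walk_transient_right[where 'n = "nat \<Rightarrow> int", OF this, of "- x0"] AE_space
    have "AE u in L. AE x in Q u. \<forall>k::nat. \<exists>n0. \<forall>n\<ge>n0. x n \<le> - int k"
    proof eventually_elim
      case (elim u)
      then have "AE x in Q u. \<forall>k. eventually (\<lambda>n. k \<le> - x n) sequentially" using bd' by blast
      then show ?case
      proof eventually_elim
        case (elim x)
        show ?case
        proof
          fix k :: nat
          obtain n0 where "\<forall>n\<ge>n0. int k \<le> - x n" using elim by (auto simp: eventually_sequentially)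
          then show "\<exists>n0. \<forall>n\<ge>n0. x n \<le> - int k" by (intro exI[of _ n0]) force
        qed
      qed
    qed
    then have "AE \<omega> in M. \<forall>k::nat. \<exists>n0. \<forall>n\<ge>n0. X n \<omega> \<le> - int k"
      by (rule transfer[rotated]) measurable
    then show ?thesis
    proof eventually_elim
      case (elim \<omega>)
      show ?case unfolding filterlim_at_bot eventually_sequentially
      proof
        fix k
        obtain n0 where n0: "\<forall>n\<ge>n0. X n \<omega> \<le> - int (nat (- k))" using elim by blast
        have "X n \<omega> \<le> k" if "n0 \<le> n" for n
          by (rule order_trans[OF n0[rule_format, OF that]]) simp
        then show "\<exists>n0. \<forall>n\<ge>n0. X n \<omega> \<le> k" by blast
      qed
    qed
  qed
  have rec: "AE \<omega> in M. liminf (\<lambda>n. ereal (real_of_int (X n \<omega>))) = - \<infinity> \<and>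
      limsup (\<lambda>n. ereal (real_of_int (X n \<omega>))) = \<infinity>" if d: "a = b \<or> p = 1 / 2"
  proof -
    have d': "a = b \<or> 1 - p = 1 / 2" using d by auto
    from E.walk_unbounded_above[where 'n = "nat \<Rightarrow> int", OF d, of x0]
      R.walk_unbounded_above[where 'n = "nat \<Rightarrow> int", OF d', of "- x0"] AE_space
    have "AE u in L. AE x in Q u. \<forall>k::nat. (\<exists>n. int k \<le> x n) \<and> (\<exists>n. x n \<le> - int k)"
    proof eventually_elim
      case (elim u)
      then have "AE x in Q u. \<forall>k. \<exists>n. k \<le> x n" "AE x in Q u. \<forall>k. \<exists>n. k \<le> - x n" using bd bd' by blast+
      then show ?case
      proof eventually_elim
        case (elim x)
        show ?case
        proof (intro allI conjI)
          fix k :: nat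
          show "\<exists>n. int k \<le> x n" using elim(1) by blast
          obtain n where "int k \<le> - x n" using elim(2) by blast
          then show "\<exists>n. x n \<le> - int k" by (intro exI[of _ n]) simp
        qed
      qed
    qed
    then have "AE \<omega> in M. \<forall>k::nat. (\<exists>n. int k \<le> X n \<omega>) \<and> (\<exists>n. X n \<omega> \<le> - int k)"
      by (rule transfer[rotated]) measurable
    then show ?thesis
    proof eventually_elim
      case (elim \<omega>)
      show ?case
      proof
        show "liminf (\<lambda>n. ereal (real_of_int (X n \<omega>))) = - \<infinity>"
          by (rule liminf_minus_infinity) (rule elim[rule_format, THEN conjunct2])
        show "limsup (\<lambda>n. ereal (real_of_int (X n \<omega>))) = \<infinity>"
          by (rule limsup_infinity) (rule elim[rule_format, THEN conjunct1])
      qed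
    qed
  qed

  have pos: "0 < speed a b p'" if "0 < ballistic_det a b (odds p')" "0 < p'" "p' < 1" for p'
  proof -
    have "0 < odds p'" using that by (simp add: odds_def)
    then have "0 < passage_mean a b (odds p')" by (rule trunc_passage_mean_geometric[OF ab _ that(1)])
    then show ?thesis using that(1) by (simp add: speed_def)
  qed
  have formula: "speed a b p' = (2 * p' - 1) * (((1 - b) * (1 - p') - (1 - a) * p') /
      ((b + (a - b) / (a + b)) * (1 - p') + (a - (a - b) / (a + b)) * p'))"
    if "0 < ballistic_det a b (odds p')" "0 < p'" "p' < 1" for p'
    using that passage_mean_p[OF ab that(2,3)] by (simp add: speed_def odds_def)
  show ?thesis
  proof (intro exI[of _ V] conjI impI)
    show "AE \<omega> in M. (\<lambda>n. real_of_int (X n \<omega>) / real n) \<longlonglongrightarrow> V" by (rule speed)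
    show "\<not> (ballistic_right a b p \<or> ballistic_left a b p \<or> zero_speed_right a b p \<or> zero_speed_left a b p)
        \<longleftrightarrow> a = b \<or> p = 1 / 2"
      by (rule cases_exhaustive[OF ab p])
  next
    assume "ballistic_right a b p"
    then have d: "drifts_right a b p" "0 < ballistic_det a b (odds p)"
      by (simp_all add: ballistic_right_iff[OF ab p])
    then have V: "V = speed a b p" using drift_det[OF ab p d(1)] by (simp add: V_def speed_def)
    show "AE \<omega> in M. filterlim (\<lambda>n. X n \<omega>) at_top sequentially" by (rule right[OF d(1)])
    show "V = (2 * p - 1) * (((1 - b) * (1 - p) - (1 - a) * p) /
        ((b + (a - b) / (a + b)) * (1 - p) + (a - (a - b) / (a + b)) * p))"
      unfolding V by (rule formula[OF d(2) p])
    show "V > 0" unfolding V by (rule pos[OF d(2) p])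
  next
    assume "ballistic_left a b p"
    then have d: "drifts_right a b (1 - p)" "0 < ballistic_det a b (odds (1 - p))"
      by (simp_all add: ballistic_left_iff[OF ab p] ballistic_right_iff[OF ab q])
    then have V: "V = - speed a b (1 - p)" using drift_det[OF ab q d(1)] by (simp add: V_def speed_def)
    show "AE \<omega> in M. filterlim (\<lambda>n. X n \<omega>) at_bot sequentially" by (rule left[OF d(1)])
    have "2 * (1 - p) - 1 = 1 - 2 * p" "1 - (1 - p) = p" by simp_all
    then show "V = - (1 - 2 * p) * (((1 - b) * p - (1 - a) * (1 - p)) /
        ((b + (a - b) / (a + b)) * p + (a - (a - b) / (a + b)) * (1 - p)))"
      unfolding V formula[OF d(2) q] by (simp only: mult_minus_left)
    show "V < 0" unfolding V using pos[OF d(2) q] by simp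
  next
    assume "zero_speed_right a b p"
    then have d: "drifts_right a b p" "ballistic_det a b (odds p) \<le> 0"
      by (simp_all add: zero_speed_right_iff[OF ab p])
    show "AE \<omega> in M. filterlim (\<lambda>n. X n \<omega>) at_top sequentially" by (rule right[OF d(1)])
    show "V = 0" using d(2) drift_det[OF ab p d(1)] by (simp add: V_def speed_def)
  next
    assume "zero_speed_left a b p"
    then have d: "drifts_right a b (1 - p)" "ballistic_det a b (odds (1 - p)) \<le> 0"
      by (simp_all add: zero_speed_left_iff[OF ab p] zero_speed_right_iff[OF ab q])
    show "AE \<omega> in M. filterlim (\<lambda>n. X n \<omega>) at_bot sequentially" by (rule left[OF d(1)])
    show "V = 0" using d(2) drift_det[OF ab q d(1)] by (simp add: V_def speed_def)
  next
    assume d: "a = b \<or> p = 1 / 2"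
    then have d': "a = b \<or> 1 - p = 1 / 2" by auto
    have s: "AE \<omega> in M. liminf (\<lambda>n. ereal (real_of_int (X n \<omega>))) = - \<infinity> \<and>
        limsup (\<lambda>n. ereal (real_of_int (X n \<omega>))) = \<infinity>" by (rule rec[OF d])
    show "AE \<omega> in M. liminf (\<lambda>n. ereal (real_of_int (X n \<omega>))) = - \<infinity> \<and>
        limsup (\<lambda>n. ereal (real_of_int (X n \<omega>))) = \<infinity>" by (rule s)
    show "V = 0" using recurrent_det[OF ab p d] recurrent_det[OF ab q d'] by (simp add: V_def speed_def)
  qed
qed

end
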